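(* Let $(M,G,\mathcal J)$ be the four-dimensional toric generalized K\"ahler manifold defined by a symplectic potential $\tau=\tau(\mu^{1},\mu^{2})$ and a skew-symmetric matrix $C=(C_{ij})$ with $C_{12}\neq0$, with $\Psi=\mathrm{Hess}(\tau)+C$ (see context). Let $X_{0}:=-\frac{\partial}{\partial t^{1}}$, let $f$ and $h$ be non-vanishing functions on $M$ independent of $t^{1}$, with $f^{2}-1$ non-vanishing, and assume that $h=h(\mu^{1})$ depends only on $\mu^{1}$ (write $h'=dh/d\mu^{1}$). Let $F$ be a real $2$-form and $a$ a non-vanishing function on $M$. Then $F$ is closed and $X_{0}$-invariant, $da=-i_{X_{0}}F$, and the conditions (KK1)--(KK5) stated in the context are satisfied, if and only if: i) the function $f$ depends only on $\mu^{1}$; ii) the function $a$ and the form $F$ are given by $a=k_{0}h^{-2}$ (where $k_{0}\in\mathbb{R}\setminus\{0\}$) and $$F=\frac{2ah'}{h}d\mu^{1}\wedge dt^{1}+\left(\frac{(\Psi_{12})^{s}}{\Psi_{22}}\Big(\lambda-\frac{2ah'}{h}\Big)d\mu^{1}+\lambda\,d\mu^{2}\right)\wedge dt^{2},$$ where $\lambda\in C^{\infty}(M)$ is independent of $t^{1}$; iii) the following relations hold: $$\frac{\partial}{\partial\mu^{2}}\left(\frac{(\Psi_{12})^{s}}{\Psi_{22}}\right)=-\frac{1}{(f^{2}-1)a}\left(\lambda+\frac{2ah'f^{2}}{h}\right),$$ $$\frac{(\Psi_{12})^{s}}{\Psi_{22}}\frac{\partial\lambda}{\partial\mu^{2}}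-\frac{\partial\lambda}{\partial\mu^{1}}=\frac{1}{(f^{2}-1)a}\left(\lambda+\frac{2ah'f^{2}}{h}\right)\left(\lambda-\frac{2ah'}{h}\right).$$
   Context: Generalized geometry. $\mathbb{T}M=TM\oplus T^{*}M$ with projections $\mathrm{pr}_{T},\mathrm{pr}_{T^{*}}$, and $\langle X+\xi,Y+\eta\rangle=\frac12(\eta(X)+\xi(Y))$; everything is extended complex (bi)linearly to $(\mathbb{T}M)^{\mathbb{C}}$. For a pair $(G,\mathcal J)$ of a positive definite metric $G$ on $\mathbb{T}M$ and a $G$-orthogonal, $\langle\cdot,\cdot\rangle$-skew $\mathcal J\in\Gamma\,\mathrm{End}(\mathbb{T}M)$ with $\mathcal J^{2}=-\mathrm{Id}$, $G^{\mathrm{end}}$ is defined by $G(u,v)=\langle G^{\mathrm{end}}u,v\rangle$ (with $(G^{\mathrm{end}})^{2}=\mathrm{Id}$); $\mathcal J_{1}=\mathcal J$, $\mathcal J_{2}=G^{\mathrm{end}}\mathcal J$, $\mathcal J_{3}=\mathcal J_{1}\mathcal J_{2}=-G^{\mathrm{end}}$. $L_{i}$ is the $i$-eigenbundle ($(1,0)$-bundle) of $\mathcal J_{i}$ in $(\mathbb{T}M)^{\mathbb{C}}$ ($i=1,2$), $E_{i}=\mathrm{pr}_{T}(L_{i})$ and $\epsilon_{i}\in\Gamma(\Lambda^{2}E_{i}^{*})$ is determined by $L_{i}=\{X+\xi\in E_{i}\oplus(T^{*}M)^{\mathbb{C}}:\xi|_{E_{i}}=i_{X}\epsilon_{i}\}$.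 Toric (diagonal) generalized K\"ahler structures in dimension four. $M$ is a connected $4$-manifold with coordinates $(t^{1},t^{2},\mu^{1},\mu^{2})$; $\tau(\mu^{1},\mu^{2})$ is smooth with positive definite Hessian, $C$ is a constant real skew-symmetric $2\times2$ matrix and $\Psi_{ij}=\frac{\partial^{2}\tau}{\partial\mu^{i}\partial\mu^{j}}+C_{ij}$, with inverse $(\Psi^{ij})$. $(\Psi_{12})^{s}=\frac12(\Psi_{12}+\Psi_{21})$ is the symmetric part. Put $\omega=\sum_{i}d\mu^{i}\wedge dt^{i}$, $$J_{+}=\sum_{i,j}\Psi_{ij}\frac{\partial}{\partial t^{i}}\otimes d\mu^{j}-\sum_{i,j}\Psi^{ij}\frac{\partial}{\partial\mu^{i}}\otimes dt^{j},\qquad J_{-}=\sum_{i,j}\Psi_{ji}\frac{\partial}{\partial t^{i}}\otimes d\mu^{j}-\sum_{i,j}\Psi^{ji}\frac{\partial}{\partial\mu^{i}}\otimes dt^{j},$$ and, with $\omega:TM\to T^{*}M$, $X\mapsto i_{X}\omega$, $g=-\frac12\omega\circ(J_{+}+J_{-})$ (a Riemannian metric), $b=-\frac12\omega\circ(J_{+}-J_{-})$ (a $2$-form), viewed as maps $TM\to T^{*}M$. The structure $(G,\mathcal J)$ is: $G^{\mathrm{end}}=\pm\mathrm{Id}$ on $C_{\pm}=\{X+(b\pm g)(X)\}$ and $\mathcal J(X+(b\pm g)X)=J_{\pm}X+(b\pm g)J_{\pm}X$. It is generalized K\"ahler with $\mathcal J_{2}(X+\xi)=-\omega^{-1}(\xi)+i_{X}\omega$;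 $X_{0}=-\partial/\partial t^{1}$ satisfies $\mathcal L_{X_{0}}\mathcal J=0$, $\mathcal L_{X_{0}}G=0$, $\mathcal J_{2}X_{0}=d\mu^{1}$. $X_{0}$-invariant means invariant under the flow of $X_{0}$. Auxiliary objects. $\mathcal S=\mathrm{span}\{X_{0},\mathcal J_{1}X_{0},\mathcal J_{2}X_{0},\mathcal J_{3}X_{0}\}$, $\mathcal S^{\perp}$ its orthogonal complement (the same for $G$ and $\langle\cdot,\cdot\rangle$), subscript $\mathbb{C}$ = complexification, and $$v_{f}:=X_{0}-i\mathcal JX_{0}-\tfrac{1}{f^{2}}(\mathcal J_{3}X_{0}+i\mathcal J_{2}X_{0}),\quad v_{if}:=X_{0}-i\mathcal JX_{0}+\tfrac{1}{f^{2}}(\mathcal J_{3}X_{0}+i\mathcal J_{2}X_{0}),\quad\alpha:=-d\left(\ln\frac{|f^{2}-1|}{f^{2}G(X_{0},X_{0})}\right).$$ Conditions. (KK1) $F$ vanishes on $\Lambda^{2}\mathrm{pr}_{T}(L_{1}\cap L_{2}\cap\mathcal S_{\mathbb{C}}^{\perp})\oplus\Lambda^{2}\mathrm{pr}_{T}(L_{1}\cap\bar L_{2}\cap\mathcal S_{\mathbb{C}}^{\perp})$, and $F(X,Y)X_{0}\in\Gamma(E_{1})$ for all $X\wedge Y\in\Lambda^{2}E_{1}$. (KK2) For $X\in\Gamma\,\mathrm{pr}_{T}(L_{1}\cap L_{2}\cap\mathcal S^{\perp}_{\mathbb{C}})$: $[\mathrm{pr}_{T}(\mathcal J_{3}X_{0}),X]+\alpha(X)\mathrm{pr}_{T}(\mathcal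 J_{3}X_{0})+\frac{f^{2}F(\mathrm{pr}_{T}(v_{f}),X)}{a(f^{2}-1)}X_{0}\in\Gamma\,\mathrm{pr}_{T}(L_{1}\cap L_{2}\cap\mathcal S^{\perp}_{\mathbb{C}})$; for $X\in\Gamma\,\mathrm{pr}_{T}(L_{1}\cap\bar L_{2}\cap\mathcal S^{\perp}_{\mathbb{C}})$: $[\mathrm{pr}_{T}(\mathcal J_{3}X_{0}),X]+\alpha(X)\mathrm{pr}_{T}(\mathcal J_{3}X_{0})-\frac{f^{2}F(\mathrm{pr}_{T}(v_{if}),X)}{a(f^{2}-1)}X_{0}\in\Gamma\,\mathrm{pr}_{T}(L_{1}\cap\bar L_{2}\cap\mathcal S^{\perp}_{\mathbb{C}})$. (KK3) $X(af^{2}h^{2})=0$ for all $X\in\mathrm{pr}_{T}(\mathcal S^{\perp})$. (KK4) $(i_{X_{0}}\epsilon_{1})\wedge F=-\frac{2a}{h}\epsilon_{1}\wedge dh$ on $\Lambda^{3}E_{1}$, and $\epsilon_{2}\wedge dh=0$ on $\mathrm{pr}_{T}(L_{1}\cap L_{2}\cap\mathcal S_{\mathbb{C}}^{\perp})\wedge\mathrm{pr}_{T}(\bar L_{1}\cap L_{2}\cap\mathcal S_{\mathbb{C}}^{\perp})\wedge\mathrm{pr}_{T}(L_{2}\cap\mathcal S_{\mathbb{C}}^{\perp})$. (KK5) On $\Lambda^{2}\mathrm{pr}_{T}(L_{2}\cap\mathcal S_{\mathbb{C}}^{\perp})$: $$d\left(\frac{1-f^{2}}{f^{2}G(X_{0},X_{0})}\mathrm{pr}_{T^{*}}(\mathcal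 J_{3}X_{0})\right)+\frac{f^{2}-1}{f^{2}G(X_{0},X_{0})}\mathcal D\epsilon_{2}+\frac{2}{af^{2}}F=\frac{2}{hG(X_{0},X_{0})}\left(\mathrm{pr}_{T}(v_{f})(h)\epsilon_{2}+\mathrm{pr}_{T^{*}}(v_{f})\wedge dh\right),$$ where, with $Z:=\mathrm{pr}_{T}(\mathcal J_{3}X_{0})$, $(\mathcal D\epsilon_{2})(X,Y)=Z(\epsilon_{2}(X,Y))-\epsilon_{2}([Z,X]+\alpha(X)Z,Y)-\epsilon_{2}(X,[Z,Y]+\alpha(Y)Z)$. *)

theory Defs
  imports "HOL-Analysis.Analysis"
begin

section \<open>Calculus in a coordinate domain\<close>

text \<open>
  A manifold with global coordinates is identified with its coordinate domain, an open subset of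
  \<open>real ^ 'n\<close>.  Tangent vectors and covectors are given by their components with respect to the
  coordinate frames, and 2-forms by their skew component matrices.  All fields are total functions
  of which only the values on the domain matter.
\<close>

definition partial :: "'n::finite \<Rightarrow> (real ^ 'n \<Rightarrow> 'b::real_normed_vector) \<Rightarrow> real ^ 'n \<Rightarrow> 'b" where
  "partial i u p = frechet_derivative u (at p) (axis i 1)"

primrec C_k_on :: "nat \<Rightarrow> (real ^ 'n::finite) set \<Rightarrow> (real ^ 'n \<Rightarrow> 'b::real_normed_vector) \<Rightarrow> bool" where
  "C_k_on 0 M u \<longleftrightarrow> continuous_on M u"
| "C_k_on (Suc k) M u \<longleftrightarrow> (\<forall>p\<in>M. u differentiable (at p)) \<and> (\<forall>i. C_k_on k M (partial i u))"

definition smooth_on :: "(real ^ 'n::finite) set \<Rightarrow> (real ^ 'n \<Rightarrow> 'b::real_normed_vector) \<Rightarrow> bool" where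
  "smooth_on M u \<longleftrightarrow> (\<forall>k. C_k_on k M u)"

text \<open>
  Dependence on coordinates is understood locally, through partial derivatives, because the
  domain need not have connected coordinate slices.
\<close>

definition independent_of :: "(real ^ 'n::finite) set \<Rightarrow> 'n \<Rightarrow> (real ^ 'n \<Rightarrow> real) \<Rightarrow> bool" where
  "independent_of M i u \<longleftrightarrow> (\<forall>p\<in>M. partial i u p = 0)"

definition depends_only_on :: "(real ^ 'n::finite) set \<Rightarrow> 'n set \<Rightarrow> (real ^ 'n \<Rightarrow> real) \<Rightarrow> bool" where
  "depends_only_on M K u \<longleftrightarrow> (\<forall>i. i \<notin> K \<longrightarrow> independent_of M i u)"

definition pair :: "'a::comm_ring_1 ^ 'n::finite \<Rightarrow> 'a ^ 'n \<Rightarrow> 'a" where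
  "pair \<xi> X = (\<Sum>i\<in>UNIV. \<xi> $ i * X $ i)"

definition cvec :: "real ^ 'n::finite \<Rightarrow> complex ^ 'n" where
  "cvec x = (\<chi> i. complex_of_real (x $ i))"

definition cmat :: "real ^ 'n::finite ^ 'n \<Rightarrow> complex ^ 'n ^ 'n" where
  "cmat B = (\<chi> i j. complex_of_real (B $ i $ j))"

definition differential :: "(real ^ 'n::finite \<Rightarrow> real) \<Rightarrow> real ^ 'n \<Rightarrow> real ^ 'n" where
  "differential u p = (\<chi> i. partial i u p)"

definition deriv_along :: "(real ^ 'n::finite \<Rightarrow> complex ^ 'n) \<Rightarrow> (real ^ 'n \<Rightarrow> complex) \<Rightarrow> real ^ 'n \<Rightarrow> complex" where
  "deriv_along X u p = (\<Sum>i\<in>UNIV. X p $ i * partial i u p)"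

definition lie_bracket :: "(real ^ 'n::finite \<Rightarrow> complex ^ 'n) \<Rightarrow> (real ^ 'n \<Rightarrow> complex ^ 'n) \<Rightarrow> real ^ 'n \<Rightarrow> complex ^ 'n" where
  "lie_bracket X Y p = (\<chi> j. deriv_along X (\<lambda>q. Y q $ j) p - deriv_along Y (\<lambda>q. X q $ j) p)"

definition smooth_sections :: "(real ^ 'n::finite) set \<Rightarrow> (real ^ 'n \<Rightarrow> (complex ^ 'n) set) \<Rightarrow> (real ^ 'n \<Rightarrow> complex ^ 'n) set" where
  "smooth_sections M D = {X. smooth_on M X \<and> (\<forall>p\<in>M. X p \<in> D p)}"

definition skew_matrix :: "real ^ 'n::finite ^ 'n \<Rightarrow> bool" where
  "skew_matrix B \<longleftrightarrow> transpose B = - B"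

definition eval2 :: "'a::comm_ring_1 ^ 'n::finite ^ 'n \<Rightarrow> 'a ^ 'n \<Rightarrow> 'a ^ 'n \<Rightarrow> 'a" where
  "eval2 B X Y = (\<Sum>i\<in>UNIV. \<Sum>j\<in>UNIV. B $ i $ j * X $ i * Y $ j)"

definition contract :: "'a::comm_ring_1 ^ 'n::finite \<Rightarrow> 'a ^ 'n ^ 'n \<Rightarrow> 'a ^ 'n" where
  "contract X B = (\<chi> j. \<Sum>i\<in>UNIV. B $ i $ j * X $ i)"

text \<open>Wedge products are normalised by \<open>(\<xi> \<and> \<eta>)(X, Y) = \<xi>(X) \<eta>(Y) - \<xi>(Y) \<eta>(X)\<close>.\<close>

definition wedge :: "'a::comm_ring_1 ^ 'n::finite \<Rightarrow> 'a ^ 'n \<Rightarrow> 'a ^ 'n ^ 'n" where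
  "wedge \<xi> \<eta> = (\<chi> i j. \<xi> $ i * \<eta> $ j - \<xi> $ j * \<eta> $ i)"

text \<open>
  The value \<open>(\<xi> \<and> \<beta>)(X, Y, Z) = (\<beta> \<and> \<xi>)(X, Y, Z)\<close> for a 1-form and a 2-form that may be
  defined on a subspace only.
\<close>

definition wedge12 :: "('v \<Rightarrow> 'a::comm_ring_1) \<Rightarrow> ('v \<Rightarrow> 'v \<Rightarrow> 'a) \<Rightarrow> 'v \<Rightarrow> 'v \<Rightarrow> 'v \<Rightarrow> 'a" where
  "wedge12 \<xi> \<beta> X Y Z = \<xi> X * \<beta> Y Z + \<xi> Y * \<beta> Z X + \<xi> Z * \<beta> X Y"

definition ext_deriv1 :: "(real ^ 'n::finite \<Rightarrow> real ^ 'n) \<Rightarrow> real ^ 'n \<Rightarrow> real ^ 'n ^ 'n" where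
  "ext_deriv1 \<theta> p = (\<chi> i j. partial i (\<lambda>q. \<theta> q $ j) p - partial j (\<lambda>q. \<theta> q $ i) p)"

definition closed_2form :: "(real ^ 'n::finite) set \<Rightarrow> (real ^ 'n \<Rightarrow> real ^ 'n ^ 'n) \<Rightarrow> bool" where
  "closed_2form M F \<longleftrightarrow> (\<forall>p\<in>M. \<forall>i j k.
     partial i (\<lambda>q. F q $ j $ k) p + partial j (\<lambda>q. F q $ k $ i) p + partial k (\<lambda>q. F q $ i $ j) p = 0)"

text \<open>Invariance of a 2-form under the local flow on \<open>M\<close> obtained by restricting \<open>\<phi>\<close>.\<close>

definition flow_invariant ::
  "(real ^ 'n::finite) set \<Rightarrow> (real \<Rightarrow> real ^ 'n \<Rightarrow> real ^ 'n) \<Rightarrow> (real ^ 'n \<Rightarrow> real ^ 'n ^ 'n) \<Rightarrow> bool" where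
  "flow_invariant M \<phi> F \<longleftrightarrow> (\<forall>p\<in>M. \<forall>s. (\<forall>r\<in>closed_segment 0 s. \<phi> r p \<in> M) \<longrightarrow>
     (\<forall>u v. eval2 (F (\<phi> s p)) (frechet_derivative (\<phi> s) (at p) u) (frechet_derivative (\<phi> s) (at p) v)
        = eval2 (F p) u v))"

text \<open>The flow of the vector field with constant components \<open>x\<close>.\<close>

definition const_field_flow :: "real ^ 'n::finite \<Rightarrow> real \<Rightarrow> real ^ 'n \<Rightarrow> real ^ 'n" where
  "const_field_flow x s p = p + s *\<^sub>R x"


section \<open>Linear algebra on a fibre of the generalized tangent bundle\<close>

text \<open>A pair \<open>(X, \<xi>)\<close> stands for \<open>X + \<xi>\<close>; thus \<open>fst\<close> and \<open>snd\<close> are the two projections.\<close>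

type_synonym 'n gvec = "(real ^ 'n) \<times> (real ^ 'n)"
type_synonym 'n cgvec = "(complex ^ 'n) \<times> (complex ^ 'n)"
type_synonym 'n gendo = "'n gvec \<Rightarrow> 'n gvec"

definition pairing :: "'n::finite gvec \<Rightarrow> 'n gvec \<Rightarrow> real" where
  "pairing u v = (1/2) * (pair (snd v) (fst u) + pair (snd u) (fst v))"

definition gRe :: "'n::finite cgvec \<Rightarrow> 'n gvec" where
  "gRe w = (\<chi> i. Re (fst w $ i), \<chi> i. Re (snd w $ i))"

definition gIm :: "'n::finite cgvec \<Rightarrow> 'n gvec" where
  "gIm w = (\<chi> i. Im (fst w $ i), \<chi> i. Im (snd w $ i))"

text \<open>\<open>gComplex u v\<close> is \<open>u + i v\<close>.\<close>

definition gComplex :: "'n::finite gvec \<Rightarrow> 'n gvec \<Rightarrow> 'n cgvec" where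
  "gComplex u v = (\<chi> i. Complex (fst u $ i) (fst v $ i), \<chi> i. Complex (snd u $ i) (snd v $ i))"

definition gscale :: "complex \<Rightarrow> 'n::finite cgvec \<Rightarrow> 'n cgvec" where
  "gscale c w = (c *s fst w, c *s snd w)"

definition gcnj :: "'n::finite cgvec \<Rightarrow> 'n cgvec" where
  "gcnj w = (\<chi> i. cnj (fst w $ i), \<chi> i. cnj (snd w $ i))"

definition complex_ext :: "'n::finite gendo \<Rightarrow> 'n cgvec \<Rightarrow> 'n cgvec" where
  "complex_ext A w = gComplex (A (gRe w)) (A (gIm w))"

definition complexified :: "'n::finite gvec set \<Rightarrow> 'n cgvec set" where
  "complexified W = {w. gRe w \<in> W \<and> gIm w \<in> W}"

definition i_eigenspace :: "'n::finite gendo \<Rightarrow> 'n cgvec set" where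
  "i_eigenspace A = {w. complex_ext A w = gscale \<i> w}"

text \<open>
  The form \<open>\<epsilon>\<close> on \<open>fst ` L\<close> with \<open>L = {X + \<xi>. X \<in> fst ` L, \<xi> = \<epsilon>(X, _) on fst ` L}\<close>, for a
  maximal isotropic \<open>L\<close>.
\<close>

definition eps :: "'n::finite cgvec set \<Rightarrow> complex ^ 'n \<Rightarrow> complex ^ 'n \<Rightarrow> complex" where
  "eps L X Y = (THE c. \<exists>\<xi>. (X, \<xi>) \<in> L \<and> c = pair \<xi> Y)"

text \<open>
  Below, \<open>Ge\<close> and \<open>J\<close> are the values at a point of \<open>G\<^sup>e\<^sup>n\<^sup>d\<close> and of the generalized almost complex
  structure, and \<open>x\<close> is the value of the vector field \<open>X\<^sub>0\<close>, regarded as an element of the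
  generalized tangent space.
\<close>

definition metric :: "'n::finite gendo \<Rightarrow> 'n gvec \<Rightarrow> 'n gvec \<Rightarrow> real" where
  "metric Ge u v = pairing (Ge u) v"

definition J2 :: "'n::finite gendo \<Rightarrow> 'n gendo \<Rightarrow> 'n gendo" where
  "J2 Ge J = Ge \<circ> J"

definition J3 :: "'n::finite gendo \<Rightarrow> 'n gendo \<Rightarrow> 'n gendo" where
  "J3 Ge J = J \<circ> J2 Ge J"

definition L1 :: "'n::finite gendo \<Rightarrow> 'n cgvec set" where
  "L1 J = i_eigenspace J"

definition L2 :: "'n::finite gendo \<Rightarrow> 'n gendo \<Rightarrow> 'n cgvec set" where
  "L2 Ge J = i_eigenspace (J2 Ge J)"

definition S_space :: "'n::finite gendo \<Rightarrow> 'n gendo \<Rightarrow> 'n gvec \<Rightarrow> 'n gvec set" where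
  "S_space Ge J x = span {x, J x, J2 Ge J x, J3 Ge J x}"

definition S_perp :: "'n::finite gendo \<Rightarrow> 'n gendo \<Rightarrow> 'n gvec \<Rightarrow> 'n gvec set" where
  "S_perp Ge J x = {u. \<forall>s\<in>S_space Ge J x. metric Ge u s = 0}"

definition S_perp_c :: "'n::finite gendo \<Rightarrow> 'n gendo \<Rightarrow> 'n gvec \<Rightarrow> 'n cgvec set" where
  "S_perp_c Ge J x = complexified (S_perp Ge J x)"

definition T_L1_L2 :: "'n::finite gendo \<Rightarrow> 'n gendo \<Rightarrow> 'n gvec \<Rightarrow> (complex ^ 'n) set" where
  "T_L1_L2 Ge J x = fst ` (L1 J \<inter> L2 Ge J \<inter> S_perp_c Ge J x)"

definition T_L1_cL2 :: "'n::finite gendo \<Rightarrow> 'n gendo \<Rightarrow> 'n gvec \<Rightarrow> (complex ^ 'n) set" where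
  "T_L1_cL2 Ge J x = fst ` (L1 J \<inter> gcnj ` L2 Ge J \<inter> S_perp_c Ge J x)"

definition T_cL1_L2 :: "'n::finite gendo \<Rightarrow> 'n gendo \<Rightarrow> 'n gvec \<Rightarrow> (complex ^ 'n) set" where
  "T_cL1_L2 Ge J x = fst ` (gcnj ` L1 J \<inter> L2 Ge J \<inter> S_perp_c Ge J x)"

definition T_L2 :: "'n::finite gendo \<Rightarrow> 'n gendo \<Rightarrow> 'n gvec \<Rightarrow> (complex ^ 'n) set" where
  "T_L2 Ge J x = fst ` (L2 Ge J \<inter> S_perp_c Ge J x)"

text \<open>\<open>v_vec Ge J x z\<close> is \<open>v\<^sub>z\<close>, to be used with \<open>z = f\<close> and \<open>z = i f\<close>.\<close>

definition v_vec :: "'n::finite gendo \<Rightarrow> 'n gendo \<Rightarrow> 'n gvec \<Rightarrow> complex \<Rightarrow> 'n cgvec" where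
  "v_vec Ge J x z = gComplex x (- J x) - gscale (1 / z\<^sup>2) (gComplex (J3 Ge J x) (J2 Ge J x))"


section \<open>The conditions\<close>

text \<open>From here on \<open>Ge\<close> and \<open>J\<close> are fields, and \<open>X0\<close> is a vector field.\<close>

definition tng :: "(real ^ 'n::finite \<Rightarrow> real ^ 'n) \<Rightarrow> real ^ 'n \<Rightarrow> 'n gvec" where
  "tng X0 p = (X0 p, 0)"

definition norm2_X0 :: "(real ^ 'n::finite \<Rightarrow> 'n gendo) \<Rightarrow> (real ^ 'n \<Rightarrow> real ^ 'n) \<Rightarrow> real ^ 'n \<Rightarrow> real" where
  "norm2_X0 Ge X0 p = metric (Ge p) (tng X0 p) (tng X0 p)"

definition Z_field ::
  "(real ^ 'n::finite \<Rightarrow> 'n gendo) \<Rightarrow> (real ^ 'n \<Rightarrow> 'n gendo) \<Rightarrow> (real ^ 'n \<Rightarrow> real ^ 'n) \<Rightarrow> real ^ 'n \<Rightarrow> complex ^ 'n" where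
  "Z_field Ge J X0 p = cvec (fst (J3 (Ge p) (J p) (tng X0 p)))"

definition \<alpha>_form ::
  "(real ^ 'n::finite \<Rightarrow> 'n gendo) \<Rightarrow> (real ^ 'n \<Rightarrow> real ^ 'n) \<Rightarrow> (real ^ 'n \<Rightarrow> real) \<Rightarrow> real ^ 'n \<Rightarrow> real ^ 'n" where
  "\<alpha>_form Ge X0 f p =
     - differential (\<lambda>q. ln (\<bar>(f q)\<^sup>2 - 1\<bar> / ((f q)\<^sup>2 * norm2_X0 Ge X0 q))) p"

definition KK1 ::
  "(real ^ 'n::finite) set \<Rightarrow> (real ^ 'n \<Rightarrow> 'n gendo) \<Rightarrow> (real ^ 'n \<Rightarrow> 'n gendo) \<Rightarrow> (real ^ 'n \<Rightarrow> real ^ 'n) \<Rightarrow>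
   (real ^ 'n \<Rightarrow> real ^ 'n ^ 'n) \<Rightarrow> bool" where
  "KK1 M Ge J X0 F \<longleftrightarrow> (\<forall>p\<in>M.
     (\<forall>X\<in>T_L1_L2 (Ge p) (J p) (tng X0 p). \<forall>Y\<in>T_L1_L2 (Ge p) (J p) (tng X0 p). eval2 (cmat (F p)) X Y = 0) \<and>
     (\<forall>X\<in>T_L1_cL2 (Ge p) (J p) (tng X0 p). \<forall>Y\<in>T_L1_cL2 (Ge p) (J p) (tng X0 p). eval2 (cmat (F p)) X Y = 0) \<and>
     (\<forall>X\<in>fst ` L1 (J p). \<forall>Y\<in>fst ` L1 (J p). eval2 (cmat (F p)) X Y *s cvec (X0 p) \<in> fst ` L1 (J p)))"

definition KK2 ::
  "(real ^ 'n::finite) set \<Rightarrow> (real ^ 'n \<Rightarrow> 'n gendo) \<Rightarrow> (real ^ 'n \<Rightarrow> 'n gendo) \<Rightarrow> (real ^ 'n \<Rightarrow> real ^ 'n) \<Rightarrow>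
   (real ^ 'n \<Rightarrow> real) \<Rightarrow> (real ^ 'n \<Rightarrow> real) \<Rightarrow> (real ^ 'n \<Rightarrow> real ^ 'n ^ 'n) \<Rightarrow> bool" where
  "KK2 M Ge J X0 f a F \<longleftrightarrow>
     (let D = (\<lambda>p. T_L1_L2 (Ge p) (J p) (tng X0 p)); D' = (\<lambda>p. T_L1_cL2 (Ge p) (J p) (tng X0 p));
          Z = Z_field Ge J X0
      in (\<forall>X\<in>smooth_sections M D.
           (\<lambda>p. lie_bracket Z X p + pair (cvec (\<alpha>_form Ge X0 f p)) (X p) *s Z p
              + (of_real ((f p)\<^sup>2)
                  * eval2 (cmat (F p)) (fst (v_vec (Ge p) (J p) (tng X0 p) (of_real (f p)))) (X p)
                  / of_real (a p * ((f p)\<^sup>2 - 1))) *s cvec (X0 p))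
           \<in> smooth_sections M D) \<and>
         (\<forall>X\<in>smooth_sections M D'.
           (\<lambda>p. lie_bracket Z X p + pair (cvec (\<alpha>_form Ge X0 f p)) (X p) *s Z p
              - (of_real ((f p)\<^sup>2)
                  * eval2 (cmat (F p)) (fst (v_vec (Ge p) (J p) (tng X0 p) (\<i> * of_real (f p)))) (X p)
                  / of_real (a p * ((f p)\<^sup>2 - 1))) *s cvec (X0 p))
           \<in> smooth_sections M D'))"

definition KK3 ::
  "(real ^ 'n::finite) set \<Rightarrow> (real ^ 'n \<Rightarrow> 'n gendo) \<Rightarrow> (real ^ 'n \<Rightarrow> 'n gendo) \<Rightarrow> (real ^ 'n \<Rightarrow> real ^ 'n) \<Rightarrow>
   (real ^ 'n \<Rightarrow> real) \<Rightarrow> (real ^ 'n \<Rightarrow> real) \<Rightarrow> (real ^ 'n \<Rightarrow> real) \<Rightarrow> bool" where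
  "KK3 M Ge J X0 f h a \<longleftrightarrow> (\<forall>p\<in>M. \<forall>X\<in>fst ` S_perp (Ge p) (J p) (tng X0 p).
     pair (differential (\<lambda>q. a q * (f q)\<^sup>2 * (h q)\<^sup>2) p) X = 0)"

definition KK4 ::
  "(real ^ 'n::finite) set \<Rightarrow> (real ^ 'n \<Rightarrow> 'n gendo) \<Rightarrow> (real ^ 'n \<Rightarrow> 'n gendo) \<Rightarrow> (real ^ 'n \<Rightarrow> real ^ 'n) \<Rightarrow>
   (real ^ 'n \<Rightarrow> real) \<Rightarrow> (real ^ 'n \<Rightarrow> real) \<Rightarrow> (real ^ 'n \<Rightarrow> real ^ 'n ^ 'n) \<Rightarrow> bool" where
  "KK4 M Ge J X0 h a F \<longleftrightarrow> (\<forall>p\<in>M.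
     (\<forall>X\<in>fst ` L1 (J p). \<forall>Y\<in>fst ` L1 (J p). \<forall>W\<in>fst ` L1 (J p).
        wedge12 (eps (L1 (J p)) (cvec (X0 p))) (eval2 (cmat (F p))) X Y W
        = - of_real (2 * a p / h p)
          * wedge12 (pair (cvec (differential h p))) (eps (L1 (J p))) X Y W) \<and>
     (\<forall>X\<in>T_L1_L2 (Ge p) (J p) (tng X0 p). \<forall>Y\<in>T_cL1_L2 (Ge p) (J p) (tng X0 p).
      \<forall>W\<in>T_L2 (Ge p) (J p) (tng X0 p).
        wedge12 (pair (cvec (differential h p))) (eps (L2 (Ge p) (J p))) X Y W = 0))"

definition D_eps2 ::
  "(real ^ 'n::finite \<Rightarrow> 'n gendo) \<Rightarrow> (real ^ 'n \<Rightarrow> 'n gendo) \<Rightarrow> (real ^ 'n \<Rightarrow> real ^ 'n) \<Rightarrow> (real ^ 'n \<Rightarrow> real) \<Rightarrow>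
   (real ^ 'n \<Rightarrow> complex ^ 'n) \<Rightarrow> (real ^ 'n \<Rightarrow> complex ^ 'n) \<Rightarrow> real ^ 'n \<Rightarrow> complex" where
  "D_eps2 Ge J X0 f X Y p =
     (let Z = Z_field Ge J X0; \<alpha> = (\<lambda>q. cvec (\<alpha>_form Ge X0 f q)); \<epsilon> = (\<lambda>q. eps (L2 (Ge q) (J q)))
      in deriv_along Z (\<lambda>q. \<epsilon> q (X q) (Y q)) p
         - \<epsilon> p (lie_bracket Z X p + pair (\<alpha> p) (X p) *s Z p) (Y p)
         - \<epsilon> p (X p) (lie_bracket Z Y p + pair (\<alpha> p) (Y p) *s Z p))"

definition KK5 ::
  "(real ^ 'n::finite) set \<Rightarrow> (real ^ 'n \<Rightarrow> 'n gendo) \<Rightarrow> (real ^ 'n \<Rightarrow> 'n gendo) \<Rightarrow> (real ^ 'n \<Rightarrow> real ^ 'n) \<Rightarrow>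
   (real ^ 'n \<Rightarrow> real) \<Rightarrow> (real ^ 'n \<Rightarrow> real) \<Rightarrow> (real ^ 'n \<Rightarrow> real) \<Rightarrow> (real ^ 'n \<Rightarrow> real ^ 'n ^ 'n) \<Rightarrow> bool" where
  "KK5 M Ge J X0 f h a F \<longleftrightarrow>
     (let D = (\<lambda>p. T_L2 (Ge p) (J p) (tng X0 p)); N = norm2_X0 Ge X0;
          vf = (\<lambda>p. v_vec (Ge p) (J p) (tng X0 p) (of_real (f p)));
          dh = (\<lambda>p. cvec (differential h p))
      in \<forall>X\<in>smooth_sections M D. \<forall>Y\<in>smooth_sections M D. \<forall>p\<in>M.
           eval2 (cmat (ext_deriv1
              (\<lambda>q. ((1 - (f q)\<^sup>2) / ((f q)\<^sup>2 * N q)) *\<^sub>R snd (J3 (Ge q) (J q) (tng X0 q))) p)) (X p) (Y p)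
           + of_real (((f p)\<^sup>2 - 1) / ((f p)\<^sup>2 * N p)) * D_eps2 Ge J X0 f X Y p
           + of_real (2 / (a p * (f p)\<^sup>2)) * eval2 (cmat (F p)) (X p) (Y p)
           = of_real (2 / (h p * N p))
             * (pair (dh p) (fst (vf p)) * eps (L2 (Ge p) (J p)) (X p) (Y p)
                + eval2 (wedge (snd (vf p)) (dh p)) (X p) (Y p)))"


section \<open>Toric generalized Kaehler structures in dimension four\<close>

text \<open>
  The coordinates \<open>(t\<^sup>1, t\<^sup>2, \<mu>\<^sup>1, \<mu>\<^sup>2)\<close> are indexed by \<open>Inl 1\<close>, \<open>Inl 2\<close>, \<open>Inr 1\<close>, \<open>Inr 2\<close>.
\<close>

type_synonym ix = "2 + 2"

definition dt :: "2 \<Rightarrow> real ^ ix" where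
  "dt i = axis (Inl i) 1"

definition d\<mu> :: "2 \<Rightarrow> real ^ ix" where
  "d\<mu> i = axis (Inr i) 1"

definition hess :: "(real ^ ix \<Rightarrow> real) \<Rightarrow> real ^ ix \<Rightarrow> real ^ 2 ^ 2" where
  "hess \<tau> p = (\<chi> i j. partial (Inr i) (partial (Inr j) \<tau>) p)"

definition positive_definite :: "real ^ 'n::finite ^ 'n \<Rightarrow> bool" where
  "positive_definite A \<longleftrightarrow> (\<forall>v. v \<noteq> 0 \<longrightarrow> v \<bullet> (A *v v) > 0)"

definition \<Psi> :: "(real ^ ix \<Rightarrow> real) \<Rightarrow> real ^ 2 ^ 2 \<Rightarrow> real ^ ix \<Rightarrow> real ^ 2 ^ 2" where
  "\<Psi> \<tau> C p = hess \<tau> p + C"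

text \<open>
  The endomorphism \<open>\<Sum> A\<^sub>i\<^sub>j \<partial>/\<partial>t\<^sup>i \<otimes> d\<mu>\<^sup>j - \<Sum> B\<^sub>i\<^sub>j \<partial>/\<partial>\<mu>\<^sup>i \<otimes> dt\<^sup>j\<close>, as a matrix acting on column vectors.
\<close>

definition block_J :: "real ^ 2 ^ 2 \<Rightarrow> real ^ 2 ^ 2 \<Rightarrow> real ^ ix ^ ix" where
  "block_J A B = (\<chi> r c. case r of
       Inl i \<Rightarrow> (case c of Inl j \<Rightarrow> 0 | Inr j \<Rightarrow> A $ i $ j)
     | Inr i \<Rightarrow> (case c of Inl j \<Rightarrow> - B $ i $ j | Inr j \<Rightarrow> 0))"

text \<open>Here \<open>A\<close> is the value of \<open>\<Psi>\<close> at a point.\<close>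

definition J_plus :: "real ^ 2 ^ 2 \<Rightarrow> real ^ ix ^ ix" where
  "J_plus A = block_J A (matrix_inv A)"

definition J_minus :: "real ^ 2 ^ 2 \<Rightarrow> real ^ ix ^ ix" where
  "J_minus A = block_J (transpose A) (transpose (matrix_inv A))"

definition \<omega>_form :: "real ^ ix ^ ix" where
  "\<omega>_form = (\<Sum>i\<in>UNIV. wedge (d\<mu> i) (dt i))"

text \<open>
  The matrix of the map \<open>X \<mapsto> i\<^sub>X \<omega>\<close>, that is \<open>\<omega>_map *v X = contract X \<omega>_form\<close>.
\<close>

definition \<omega>_map :: "real ^ ix ^ ix" where
  "\<omega>_map = transpose \<omega>_form"

definition g_map :: "real ^ 2 ^ 2 \<Rightarrow> real ^ ix ^ ix" where
  "g_map A = (- 1/2) *\<^sub>R (\<omega>_map ** (J_plus A + J_minus A))"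

definition b_map :: "real ^ 2 ^ 2 \<Rightarrow> real ^ ix ^ ix" where
  "b_map A = (- 1/2) *\<^sub>R (\<omega>_map ** (J_plus A - J_minus A))"

text \<open>
  The tangent components of the decomposition \<open>X + \<xi> = (X\<^sub>+ + (b + g) X\<^sub>+) + (X\<^sub>- + (b - g) X\<^sub>-)\<close>
  along \<open>C\<^sub>+ \<oplus> C\<^sub>-\<close>: here \<open>X = X\<^sub>+ + X\<^sub>-\<close> and \<open>\<xi> - b X = g (X\<^sub>+ - X\<^sub>-)\<close>.
\<close>

definition plus_comp :: "real ^ 2 ^ 2 \<Rightarrow> ix gvec \<Rightarrow> real ^ ix" where
  "plus_comp A u = (1/2) *\<^sub>R (fst u + matrix_inv (g_map A) *v (snd u - b_map A *v fst u))"

definition minus_comp :: "real ^ 2 ^ 2 \<Rightarrow> ix gvec \<Rightarrow> real ^ ix" where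
  "minus_comp A u = (1/2) *\<^sub>R (fst u - matrix_inv (g_map A) *v (snd u - b_map A *v fst u))"

definition lift_plus :: "real ^ 2 ^ 2 \<Rightarrow> real ^ ix \<Rightarrow> ix gvec" where
  "lift_plus A X = (X, (b_map A + g_map A) *v X)"

definition lift_minus :: "real ^ 2 ^ 2 \<Rightarrow> real ^ ix \<Rightarrow> ix gvec" where
  "lift_minus A X = (X, (b_map A - g_map A) *v X)"

definition G_end :: "real ^ 2 ^ 2 \<Rightarrow> ix gendo" where
  "G_end A u = lift_plus A (plus_comp A u) - lift_minus A (minus_comp A u)"

definition J_end :: "real ^ 2 ^ 2 \<Rightarrow> ix gendo" where
  "J_end A u = lift_plus A (J_plus A *v plus_comp A u) + lift_minus A (J_minus A *v minus_comp A u)"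

definition toric_G :: "(real ^ ix \<Rightarrow> real) \<Rightarrow> real ^ 2 ^ 2 \<Rightarrow> real ^ ix \<Rightarrow> ix gendo" where
  "toric_G \<tau> C p = G_end (\<Psi> \<tau> C p)"

definition toric_J :: "(real ^ ix \<Rightarrow> real) \<Rightarrow> real ^ 2 ^ 2 \<Rightarrow> real ^ ix \<Rightarrow> ix gendo" where
  "toric_J \<tau> C p = J_end (\<Psi> \<tau> C p)"

definition toric_X0 :: "real ^ ix \<Rightarrow> real ^ ix" where
  "toric_X0 p = - axis (Inl 1) 1"

definition \<Psi>_ratio :: "(real ^ ix \<Rightarrow> real) \<Rightarrow> real ^ 2 ^ 2 \<Rightarrow> real ^ ix \<Rightarrow> real" where
  "\<Psi>_ratio \<tau> C p = ((\<Psi> \<tau> C p $ 1 $ 2 + \<Psi> \<tau> C p $ 2 $ 1) / 2) / \<Psi> \<tau> C p $ 2 $ 2"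


subsection \<open>The defining properties of the structure\<close>

lemma positive_definite_add_skew:
  assumes "positive_definite H" "skew_matrix C"
  shows "positive_definite (H + C)"
proof -
  have "v \<bullet> (C *v v) = 0" for v
  proof -
    have "v \<bullet> (C *v v) = (transpose C *v v) \<bullet> v"
      by (metis dot_lmul_matrix transpose_matrix_vector)
    also have "\<dots> = - ((C *v v) \<bullet> v)"
      using assms(2) by (simp add: skew_matrix_def matrix_vector_mult_def inner_vec_def sum_negf)
    finally show ?thesis by (simp add: inner_commute)
  qed
  then show ?thesis
    using assms(1) by (simp add: positive_definite_def matrix_vector_mult_add_rdistrib inner_add_right)
qed

lemma invertible_if_kernel_trivial:
  fixes A :: "real ^ 'n::finite ^ 'n"
  assumes "\<And>v. A *v v = 0 \<Longrightarrow> v = 0"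
  shows "invertible A"
  using assms by (metis invertible_left_inverse matrix_left_invertible_ker)

lemma matrix_inv_mult:
  fixes A :: "real ^ 'n::finite ^ 'n"
  assumes "invertible A"
  shows "A ** matrix_inv A = mat 1" "matrix_inv A ** A = mat 1"
  using someI_ex[OF assms[unfolded invertible_def]] by (simp_all add: matrix_inv_def)

lemma invertible_positive_definite: "positive_definite A \<Longrightarrow> invertible A"
  by (rule invertible_if_kernel_trivial) (metis inner_zero_right less_irrefl positive_definite_def)

lemma sum_ix: "(\<Sum>k\<in>(UNIV::ix set). s k) = s (Inl 1) + s (Inl 2) + s (Inr 1) + (s (Inr 2) :: real)"
proof -
  have "(\<Sum>k\<in>(UNIV::ix set). s k) = (\<Sum>k\<in>UNIV <+> UNIV. s k)" by (simp add: UNIV_Plus_UNIV)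
  also have "\<dots> = (\<Sum>k\<in>UNIV. s (Inl k)) + (\<Sum>k\<in>UNIV. s (Inr k))"
    by (subst sum.Plus) (auto simp: o_def)
  finally show ?thesis by (simp add: sum_2)
qed

lemma \<omega>_map_apply:
  "(\<omega>_map *v X) $ Inl i = X $ Inr i" "(\<omega>_map *v X) $ Inr i = - X $ Inl i"
  using exhaust_2[of i]
  by (auto simp: matrix_vector_mult_def \<omega>_map_def \<omega>_form_def transpose_def wedge_def d\<mu>_def dt_def
      sum_ix sum_2 axis_def)

lemma invertible_g_map:
  assumes A: "positive_definite A"
  shows "invertible (g_map A)"
proof (rule invertible_if_kernel_trivial)
  fix v assume "g_map A *v v = 0"
  then have w0: "\<omega>_map *v ((J_plus A + J_minus A) *v v) = 0"
    by (simp add: g_map_def matrix_vector_mul_assoc flip: scaleR_minus_left scaleR_matrix_vector_assoc)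
  define w where "w = (J_plus A + J_minus A) *v v"
  have w: "w $ Inl i = 0" "w $ Inr i = 0" for i
    using w0 \<omega>_map_apply[of w i] by (simp_all add: w_def[symmetric])
  define x y where "x = (\<chi> i. v $ Inl i)" and "y = (\<chi> i. v $ Inr i)"
  define B where "B = matrix_inv A"
  have "A *v y + transpose A *v y = 0"
    using w(1) by (simp add: vec_eq_iff w_def J_plus_def J_minus_def block_J_def matrix_vector_mult_def
        sum_ix sum_2 y_def transpose_def algebra_simps)
  then have "y \<bullet> (A *v y) + y \<bullet> (transpose A *v y) = 0"
    by (metis inner_add_right inner_zero_right)
  moreover have "y \<bullet> (transpose A *v y) = y \<bullet> (A *v y)"
    by (metis dot_lmul_matrix inner_commute transpose_matrix_vector)
  ultimately have y: "y = 0"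
    using A by (fastforce simp: positive_definite_def)
  have "- (B *v x + transpose B *v x) = 0"
    using w(2) by (simp add: vec_eq_iff w_def J_plus_def J_minus_def block_J_def matrix_vector_mult_def
        sum_ix sum_2 x_def transpose_def B_def algebra_simps)
  then have "x \<bullet> (B *v x) + x \<bullet> (transpose B *v x) = 0"
    by (metis inner_add_right inner_zero_right neg_equal_0_iff_equal)
  moreover have "x \<bullet> (transpose B *v x) = x \<bullet> (B *v x)"
    by (metis dot_lmul_matrix inner_commute transpose_matrix_vector)
  ultimately have "x \<bullet> (B *v x) = 0" by simp
  moreover have xB: "x = A *v (B *v x)"
    using matrix_inv_mult(1)[OF invertible_positive_definite[OF A]]
    by (simp add: matrix_vector_mul_assoc B_def)
  ultimately have "(B *v x) \<bullet> (A *v (B *v x)) = 0"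
    by (metis inner_commute)
  then have "B *v x = 0"
    using A by (metis less_irrefl positive_definite_def)
  then have "x = 0" using xB by simp
  with y show "v = 0"
    by (simp add: vec_eq_iff split_sum_all x_def y_def)
qed

lemma plus_minus_comp_lift:
  assumes "positive_definite A"
  shows "plus_comp A (lift_plus A X) = X" "minus_comp A (lift_plus A X) = 0"
    and "plus_comp A (lift_minus A X) = 0" "minus_comp A (lift_minus A X) = X"
  using matrix_inv_mult(2)[OF invertible_g_map[OF assms]]
  by (simp_all add: plus_comp_def minus_comp_def lift_plus_def lift_minus_def
      matrix_vector_mult_add_rdistrib matrix_vector_mult_diff_rdistrib matrix_vector_mul_assoc
      linear_neg[OF matrix_vector_mul_linear] flip: scaleR_2)

lemma lift_0: "lift_plus A 0 = 0" "lift_minus A 0 = 0"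
  by (simp_all add: lift_plus_def lift_minus_def zero_prod_def)

lemma G_end_lift:
  assumes "positive_definite A"
  shows "G_end A (lift_plus A X) = lift_plus A X" "G_end A (lift_minus A X) = - lift_minus A X"
  by (simp_all add: G_end_def plus_minus_comp_lift[OF assms] lift_0)

lemma J_end_lift:
  assumes "positive_definite A"
  shows "J_end A (lift_plus A X) = lift_plus A (J_plus A *v X)"
    and "J_end A (lift_minus A X) = lift_minus A (J_minus A *v X)"
  by (simp_all add: J_end_def plus_minus_comp_lift[OF assms] lift_0)

lemma lift_plus_minus_comp:
  assumes "positive_definite A"
  shows "lift_plus A (plus_comp A u) + lift_minus A (minus_comp A u) = u"
proof -
  define z where "z = matrix_inv (g_map A) *v (snd u - b_map A *v fst u)"
  have gz: "g_map A *v z = snd u - b_map A *v fst u"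
    using matrix_inv_mult(1)[OF invertible_g_map[OF assms]] by (simp add: z_def matrix_vector_mul_assoc)
  have "plus_comp A u + minus_comp A u = fst u" "plus_comp A u - minus_comp A u = z"
    by (simp_all add: plus_comp_def minus_comp_def z_def vec_eq_iff field_simps)
  then have b: "b_map A *v plus_comp A u + b_map A *v minus_comp A u = b_map A *v fst u"
    and g: "g_map A *v plus_comp A u - g_map A *v minus_comp A u = snd u - b_map A *v fst u"
    and fst: "plus_comp A u + minus_comp A u = fst u"
    by (simp_all add: gz flip: matrix_vector_right_distrib matrix_vector_mult_diff_distrib)
  have "(b_map A + g_map A) *v plus_comp A u + (b_map A - g_map A) *v minus_comp A u
      = (b_map A *v plus_comp A u + b_map A *v minus_comp A u)
        + (g_map A *v plus_comp A u - g_map A *v minus_comp A u)"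
    by (simp add: matrix_vector_mult_add_rdistrib matrix_vector_mult_diff_rdistrib)
  also have "\<dots> = snd u"
    unfolding b g by simp
  finally show ?thesis
    using fst by (simp add: lift_plus_def lift_minus_def prod_eq_iff)
qed

end

theory Submission
  imports Defs
begin

text \<open>
  Everything happens in explicit coordinates, and the structure is so rigid that the conditions
  reduce to a few scalar equations.  Write \<open>\<Psi> = S + C\<close> with \<open>S = Hess \<tau>\<close>, and put
  \<open>c = C\<^sub>1\<^sub>2\<close>, \<open>\<Delta> = det S\<close>, \<open>\<rho> = S\<^sub>1\<^sub>2 / S\<^sub>2\<^sub>2\<close>, \<open>N = G(X\<^sub>0, X\<^sub>0) = S\<^sub>2\<^sub>2 / (2 \<Delta>)\<close> and
  \<open>\<kappa> = 2 a h' / h\<close>; indices of \<open>\<partial>\<close> below refer to the coordinates \<open>\<mu>\<^sub>1, \<mu>\<^sub>2\<close>.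

  On a fibre, \<open>L\<^sub>2\<close> is the graph of \<open>- i \<omega>\<close>, and \<open>L\<^sub>1\<close> is the graph of the 2-form
  \<open>\<epsilon>\<^sub>1 = (\<beta>\<^sub>1 \<and> \<beta>\<^sub>2) / c - c d\<mu>\<^sub>1 \<and> d\<mu>\<^sub>2\<close>, where \<open>\<beta>\<^sub>j = dt\<^sub>j + i \<Sum>\<^sub>k S\<^sub>j\<^sub>k d\<mu>\<^sub>k\<close>.  The latter uses
  \<open>c \<noteq> 0\<close>, which makes \<open>L\<^sub>1\<close> project onto the whole complexified tangent space.  A vector in the
  projection of \<open>\<S>\<^sup>\<bottom>\<close> has no component along \<open>\<partial>/\<partial>\<mu>\<^sub>1\<close>, and the two intersections of
  \<open>L\<^sub>1\<close> with \<open>L\<^sub>2\<close> and its conjugate inside \<open>\<S>\<^sup>\<bottom>\<close> are complex lines.  Hence (KK1) holds,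
  and so does the second half of (KK4), because \<open>dh\<close> is a multiple of \<open>d\<mu>\<^sub>1\<close>.

  The first half of (KK4) says \<open>\<beta>\<^sub>2 \<and> (F - \<kappa> d\<mu>\<^sub>1 \<and> \<beta>\<^sub>1) = 0\<close>, so \<open>F\<close> is
  \<open>\<kappa> d\<mu>\<^sub>1 \<and> \<beta>\<^sub>1\<close> plus the wedge product of some 1-form with \<open>\<beta>\<^sub>2\<close>.  As \<open>F\<close> is
  real, this is exactly the asserted shape of \<open>F\<close> (\<open>KK4_iff\<close>).  For such \<open>F\<close> the equation \<open>da = - i\<^bsub>X\<^sub>0\<^esub> F\<close> becomes
  \<open>da = - \<kappa> d\<mu>\<^sub>1\<close>, that is \<open>d(a h\<^sup>2) = 0\<close>, which integrates on a connected domain (\<open>a_eq_iff\<close>);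
  then (KK3) says that \<open>f\<close> is a function of \<open>\<mu>\<^sub>1\<close> (\<open>f_indep_iff\<close>), and \<open>dF = 0\<close> says that
  \<open>\<lambda>\<close> is independent of \<open>t\<^sub>1\<close> and \<open>\<partial>\<^sub>1 \<lambda> = \<partial>\<^sub>2 (\<rho> (\<lambda> - \<kappa>))\<close> (\<open>closed_iff\<close>).

  Finally, the tangent part of \<open>\<J>\<^sub>3 X\<^sub>0\<close> is \<open>Z = - 2 c N (\<rho> \<partial>/\<partial>t\<^sub>1 + \<partial>/\<partial>t\<^sub>2)\<close>.  In
  \<open>[Z, X] + \<alpha>(X) Z\<close> the derivatives of \<open>N\<close> cancel, and only a multiple of \<open>\<partial>\<^sub>2 \<rho>\<close> along
  \<open>\<partial>/\<partial>t\<^sub>1\<close> remains (\<open>bracket_nth\<close>).  Consequently \<open>\<D>\<epsilon>\<^sub>2 = 0\<close>, and (KK5) is the first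
  relation of iii) (\<open>KK5_iff\<close>), which also implies (KK2) (\<open>KK2_holds\<close>).  Substituting that relation
  into \<open>dF = 0\<close> gives the second one.
\<close>

section \<open>Partial derivatives and smooth functions\<close>

lemma partial_has_derivative:
  "(u has_derivative u') (at p) \<Longrightarrow> partial i u p = u' (axis i 1)"
  by (simp add: partial_def frechet_derivative_at[symmetric])

lemma has_derivative_frechet:
  "u differentiable (at p) \<Longrightarrow> (u has_derivative frechet_derivative u (at p)) (at p)"
  by (simp add: frechet_derivative_works)

lemma partial_const [simp]: "partial i (\<lambda>q. c) p = 0"
  by (rule partial_has_derivative[where u' = "\<lambda>_. 0"]) simp

lemma partial_linear:
  assumes "bounded_linear L" "u differentiable (at p)"
  shows "partial i (\<lambda>q. L (u q)) p = L (partial i u p)"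
  using partial_has_derivative[OF bounded_linear.has_derivative[OF assms(1) has_derivative_frechet[OF assms(2)]]]
  by (simp add: partial_def)

lemma partial_add:
  assumes "u differentiable (at p)" "v differentiable (at p)"
  shows "partial i (\<lambda>q. u q + v q) p = partial i u p + partial i v p"
  using partial_has_derivative[OF has_derivative_add[OF assms[THEN has_derivative_frechet]]]
  by (simp add: partial_def)

lemma partial_bilinear:
  assumes "bounded_bilinear B" "u differentiable (at p)" "v differentiable (at p)"
  shows "partial i (\<lambda>q. B (u q) (v q)) p = B (u p) (partial i v p) + B (partial i u p) (v p)"
  using partial_has_derivative[OF bounded_bilinear.FDERIV[OF assms(1) assms(2,3)[THEN has_derivative_frechet]]]
  by (simp add: partial_def)

lemmas partial_mult = partial_bilinear[OF bounded_bilinear_mult]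

lemma partial_of_real:
  "u differentiable (at p) \<Longrightarrow> partial i (\<lambda>q. complex_of_real (u q)) p = complex_of_real (partial i u p)"
  by (rule partial_linear[OF bounded_linear_of_real])

lemma partial_minus:
  "u differentiable (at p) \<Longrightarrow> partial i (\<lambda>q. - u q) p = - partial i u p"
  by (rule partial_linear[OF bounded_linear_minus[OF bounded_linear_ident]])

lemma partial_diff:
  assumes "u differentiable (at p)" "v differentiable (at p)"
  shows "partial i (\<lambda>q. u q - v q) p = partial i u p - partial i v p"
  using partial_has_derivative[OF has_derivative_diff[OF assms[THEN has_derivative_frechet]]]
  by (simp add: partial_def)

lemma partial_cmult:
  fixes c :: "'b::real_normed_algebra"
  shows "u differentiable (at p) \<Longrightarrow> partial i (\<lambda>q. c * u q) p = c * partial i u p"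
  by (rule partial_linear[OF bounded_linear_mult_right])

lemma partial_power2:
  fixes u :: "real ^ 'n::finite \<Rightarrow> real"
  shows "u differentiable (at p) \<Longrightarrow> partial i (\<lambda>q. (u q)\<^sup>2) p = 2 * u p * partial i u p"
  by (simp add: power2_eq_square partial_mult)

lemma partial_inverse:
  fixes u :: "real ^ 'n::finite \<Rightarrow> real"
  assumes "u differentiable (at p)" "u p \<noteq> 0"
  shows "partial i (\<lambda>q. inverse (u q)) p = - (partial i u p * (inverse (u p) * inverse (u p)))"
  using partial_has_derivative[OF Deriv.has_derivative_inverse[OF assms(2) has_derivative_frechet[OF assms(1)]]]
  by (simp add: partial_def mult_ac)

lemma partial_cong_open:
  assumes "open M" "p \<in> M" "\<And>q. q \<in> M \<Longrightarrow> u q = v q"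
  shows "partial i u p = partial i v p"
proof -
  have "(u has_derivative u') (at p) \<longleftrightarrow> (v has_derivative u') (at p)" for u'
    using assms by (auto elim!: has_derivative_transform_within_open)
  then show ?thesis
    by (simp add: partial_def frechet_derivative_def)
qed

lemma differentiable_cong_open:
  assumes "open M" "p \<in> M" "\<And>q. q \<in> M \<Longrightarrow> u q = v q" "u differentiable (at p)"
  shows "v differentiable (at p)"
  using assms has_derivative_transform_within_open unfolding differentiable_def by blast

lemma partial_zero_if_const_on:
  "open M \<Longrightarrow> p \<in> M \<Longrightarrow> (\<And>q. q \<in> M \<Longrightarrow> u q = c) \<Longrightarrow> partial i u p = 0"
  using partial_cong_open[of M p u "\<lambda>_. c"] by simp

lemma C_k_on_cong:
  assumes "open M"
  shows "(\<And>q. q \<in> M \<Longrightarrow> u q = v q) \<Longrightarrow> C_k_on k M u \<Longrightarrow> C_k_on k M v"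
proof (induction k arbitrary: u v)
  case 0
  then show ?case by (simp cong: continuous_on_cong)
next
  case (Suc k)
  show ?case
    unfolding C_k_on.simps
  proof (intro conjI ballI allI)
    show "v differentiable (at p)" if "p \<in> M" for p
      using Suc.prems that differentiable_cong_open[OF assms that, of u v] by simp
    show "C_k_on k M (partial i v)" for i
      using Suc.prems(2) Suc.IH[of "partial i u" "partial i v"] partial_cong_open[OF assms _ Suc.prems(1)]
      by simp
  qed
qed

lemma C_k_on_Suc_continuous: "C_k_on (Suc k) M u \<Longrightarrow> continuous_on M u"
  by (simp add: continuous_at_imp_continuous_on differentiable_imp_continuous_within)

lemma C_k_on_Suc: "C_k_on (Suc k) M u \<Longrightarrow> C_k_on k M u"
proof (induction k arbitrary: u)
  case 0
  then show ?case using C_k_on_Suc_continuous by (metis C_k_on.simps(1))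
next
  case (Suc k)
  then show ?case by (metis C_k_on.simps(2))
qed

lemma smooth_on_differentiable: "smooth_on M u \<Longrightarrow> p \<in> M \<Longrightarrow> u differentiable (at p)"
  by (metis smooth_on_def C_k_on.simps(2))

lemma smooth_on_partial: "smooth_on M u \<Longrightarrow> smooth_on M (partial i u)"
  by (metis smooth_on_def C_k_on.simps(2))

lemma smooth_on_cong:
  "open M \<Longrightarrow> (\<And>q. q \<in> M \<Longrightarrow> u q = v q) \<Longrightarrow> smooth_on M u \<Longrightarrow> smooth_on M v"
  unfolding smooth_on_def using C_k_on_cong by blast

lemma C_k_on_const: "C_k_on k M (\<lambda>q :: real ^ 'n::finite. c)"
proof (induction k arbitrary: c)
  case (Suc k)
  have "partial i (\<lambda>q :: real ^ 'n. c) = (\<lambda>q. 0)" for i by (simp add: fun_eq_iff)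
  then show ?case using Suc by simp
qed simp

lemma C_k_on_linear:
  assumes "open M" "bounded_linear L"
  shows "C_k_on k M u \<Longrightarrow> C_k_on k M (\<lambda>q. L (u q))"
proof (induction k arbitrary: u)
  case 0
  then show ?case using assms(2) by (simp add: bounded_linear.continuous_on)
next
  case (Suc k)
  have "C_k_on k M (partial i (\<lambda>q. L (u q)))" for i
    by (rule C_k_on_cong[OF assms(1), of "\<lambda>q. L (partial i u q)"])
      (use Suc.prems Suc.IH[of "partial i u"] in \<open>auto simp: partial_linear[OF assms(2)]\<close>)
  moreover have "(\<lambda>q. L (u q)) differentiable (at p)" if "p \<in> M" for p
    using Suc.prems that bounded_linear.has_derivative[OF assms(2)] unfolding C_k_on.simps differentiable_def by blast
  ultimately show ?case by simp
qed

lemma C_k_on_add: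
  assumes "open M"
  shows "C_k_on k M u \<Longrightarrow> C_k_on k M v \<Longrightarrow> C_k_on k M (\<lambda>q. u q + v q)"
proof (induction k arbitrary: u v)
  case 0
  then show ?case by (simp add: continuous_on_add)
next
  case (Suc k)
  have "C_k_on k M (partial i (\<lambda>q. u q + v q))" for i
    by (rule C_k_on_cong[OF assms(1), of "\<lambda>q. partial i u q + partial i v q"])
      (use Suc.prems Suc.IH[of "partial i u" "partial i v"] in \<open>auto simp: partial_add\<close>)
  then show ?case using Suc.prems by auto
qed

lemma C_k_on_bilinear:
  assumes "open M" "bounded_bilinear B"
  shows "C_k_on k M u \<Longrightarrow> C_k_on k M v \<Longrightarrow> C_k_on k M (\<lambda>q. B (u q) (v q))"
proof (induction k arbitrary: u v)
  case 0
  then show ?case using assms(2) by (simp add: bounded_bilinear.continuous_on)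
next
  case (Suc k)
  have "C_k_on k M (partial i (\<lambda>q. B (u q) (v q)))" for i
    by (rule C_k_on_cong[OF assms(1), of "\<lambda>q. B (u q) (partial i v q) + B (partial i u q) (v q)"])
      (use Suc.prems Suc.IH[of u "partial i v"] Suc.IH[of "partial i u" v] C_k_on_Suc[of k M u] C_k_on_Suc[of k M v] in \<open>auto simp: partial_bilinear[OF assms(2)] intro: C_k_on_add[OF assms(1)]\<close>)
  moreover have "(\<lambda>q. B (u q) (v q)) differentiable (at p)" if "p \<in> M" for p
    using Suc.prems that bounded_bilinear.FDERIV[OF assms(2)] unfolding C_k_on.simps differentiable_def by blast
  ultimately show ?case by simp
qed

text \<open>
  The induction goes through because the derivative of \<open>1 / u\<close> is a polynomial in the derivatives of
  \<open>u\<close> and in \<open>1 / u\<close> itself, which is already known to have one derivative less.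
\<close>

lemma C_k_on_inverse:
  fixes u :: "real ^ 'n::finite \<Rightarrow> real"
  assumes "open M" "\<And>p. p \<in> M \<Longrightarrow> u p \<noteq> 0"
  shows "C_k_on k M u \<Longrightarrow> C_k_on k M (\<lambda>q. inverse (u q))"
proof (induction k)
  case 0
  then show ?case using assms(2) by (simp add: continuous_on_inverse)
next
  case (Suc k)
  have inv: "C_k_on k M (\<lambda>q. inverse (u q))"
    using Suc C_k_on_Suc by blast
  have "C_k_on k M (partial i (\<lambda>q. inverse (u q)))" for i
    by (rule C_k_on_cong[OF assms(1), of "\<lambda>q. - (partial i u q * (inverse (u q) * inverse (u q)))"])
      (use Suc.prems inv assms(2) in \<open>auto simp: partial_inverse intro!: C_k_on_bilinear[OF assms(1) bounded_bilinear_mult]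
        C_k_on_linear[OF assms(1) bounded_linear_minus[OF bounded_linear_ident]]\<close>)
  then show ?case using Suc.prems assms(2) by auto
qed

lemma smooth_on_const [simp]: "smooth_on M (\<lambda>q. c)"
  by (simp add: smooth_on_def C_k_on_const)

lemma smooth_on_linear: "open M \<Longrightarrow> bounded_linear L \<Longrightarrow> smooth_on M u \<Longrightarrow> smooth_on M (\<lambda>q. L (u q))"
  by (simp add: smooth_on_def C_k_on_linear)

lemma smooth_on_add: "open M \<Longrightarrow> smooth_on M u \<Longrightarrow> smooth_on M v \<Longrightarrow> smooth_on M (\<lambda>q. u q + v q)"
  by (simp add: smooth_on_def C_k_on_add)

lemma smooth_on_mult:
  fixes u v :: "real ^ 'n::finite \<Rightarrow> 'b::real_normed_algebra"
  shows "open M \<Longrightarrow> smooth_on M u \<Longrightarrow> smooth_on M v \<Longrightarrow> smooth_on M (\<lambda>q. u q * v q)"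
  by (simp add: smooth_on_def C_k_on_bilinear[OF _ bounded_bilinear_mult])

lemma smooth_on_inverse:
  fixes u :: "real ^ 'n::finite \<Rightarrow> real"
  shows "open M \<Longrightarrow> (\<And>p. p \<in> M \<Longrightarrow> u p \<noteq> 0) \<Longrightarrow> smooth_on M u \<Longrightarrow> smooth_on M (\<lambda>q. inverse (u q))"
  by (simp add: smooth_on_def C_k_on_inverse)

lemma smooth_on_minus: "open M \<Longrightarrow> smooth_on M u \<Longrightarrow> smooth_on M (\<lambda>q. - u q)"
  by (rule smooth_on_linear[OF _ bounded_linear_minus[OF bounded_linear_ident]])

lemma smooth_on_diff: "open M \<Longrightarrow> smooth_on M u \<Longrightarrow> smooth_on M v \<Longrightarrow> smooth_on M (\<lambda>q. u q - v q)"
  using smooth_on_add[of M u "\<lambda>q. - v q"] by (simp add: smooth_on_minus)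

lemma smooth_on_divide:
  fixes u v :: "real ^ 'n::finite \<Rightarrow> real"
  shows "open M \<Longrightarrow> smooth_on M u \<Longrightarrow> smooth_on M v \<Longrightarrow> (\<And>p. p \<in> M \<Longrightarrow> v p \<noteq> 0) \<Longrightarrow> smooth_on M (\<lambda>q. u q / v q)"
  by (simp add: divide_inverse smooth_on_mult smooth_on_inverse)

lemma smooth_on_of_real:
  "open M \<Longrightarrow> smooth_on M u \<Longrightarrow> smooth_on M (\<lambda>q. complex_of_real (u q))"
  by (rule smooth_on_linear[OF _ bounded_linear_of_real])

lemma smooth_on_vec_nth:
  fixes u :: "real ^ 'n::finite \<Rightarrow> 'b::real_normed_vector ^ 'm::finite"
  shows "open M \<Longrightarrow> smooth_on M u \<Longrightarrow> smooth_on M (\<lambda>q. u q $ j)"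
  by (rule smooth_on_linear[OF _ bounded_linear_vec_nth])

lemma smooth_on_sum:
  assumes "open M" "finite I" "\<And>i. i \<in> I \<Longrightarrow> smooth_on M (u i)"
  shows "smooth_on M (\<lambda>q. \<Sum>i\<in>I. u i q)"
  using assms(2,3) by (induction I rule: finite_induct) (auto simp: smooth_on_add[OF assms(1)])

lemma bounded_linear_axis: "bounded_linear (axis i :: 'b::real_normed_vector \<Rightarrow> 'b ^ 'm::finite)"
proof (rule bounded_linear_intro[where K = 1])
  show "norm (axis i x :: 'b ^ 'm) \<le> norm x * 1" for x
  proof -
    have "norm (axis i x :: 'b ^ 'm) \<le> (\<Sum>j\<in>UNIV. norm (axis i x $ j))"
      unfolding norm_vec_def by (rule L2_set_le_sum) simp
    also have "\<dots> = norm x"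
      by (simp add: axis_def if_distrib cong: if_cong)
    finally show ?thesis by simp
  qed
qed (simp_all add: vec_eq_iff axis_def)

text \<open>Componentwise smoothness suffices because a vector is the sum of its components along the axes.\<close>

lemma smooth_on_vec:
  fixes u :: "real ^ 'n::finite \<Rightarrow> 'b::real_normed_vector ^ 'm::finite"
  assumes "open M" "\<And>j. smooth_on M (\<lambda>q. u q $ j)"
  shows "smooth_on M u"
proof -
  have "u = (\<lambda>q. \<Sum>j\<in>UNIV. axis j (u q $ j))"
    by (simp add: fun_eq_iff vec_eq_iff axis_def)
  moreover have "smooth_on M (\<lambda>q. \<Sum>j\<in>UNIV. axis j (u q $ j))"
    using assms by (intro smooth_on_sum smooth_on_linear[OF _ bounded_linear_axis]) auto
  ultimately show ?thesis by simp
qed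

lemma DERIV_along_axis:
  assumes "u differentiable (at (q + x *\<^sub>R axis i 1))"
  shows "((\<lambda>x. u (q + x *\<^sub>R axis i 1)) has_real_derivative partial i u (q + x *\<^sub>R axis i 1)) (at x)"
proof -
  let ?D = "frechet_derivative u (at (q + x *\<^sub>R axis i 1))"
  have u: "(u has_derivative ?D) (at (q + x *\<^sub>R axis i 1))"
    using assms by (rule has_derivative_frechet)
  have "((\<lambda>x. q + x *\<^sub>R axis i 1) has_derivative (\<lambda>x. x *\<^sub>R axis i 1)) (at x)"
    by (auto intro!: derivative_eq_intros)
  from diff_chain_at[OF this u]
  have "((\<lambda>x. u (q + x *\<^sub>R axis i 1)) has_derivative (\<lambda>x. ?D (x *\<^sub>R axis i 1))) (at x)"
    by (simp add: o_def)
  moreover have "(\<lambda>x. ?D (x *\<^sub>R axis i 1)) = (*) (partial i u (q + x *\<^sub>R axis i 1))"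
    using linear_scale[OF has_derivative_linear[OF u]] by (auto simp: partial_def fun_eq_iff)
  ultimately show ?thesis by (simp add: has_field_derivative_def)
qed

text \<open>
  Two applications of the mean value theorem express the second difference of \<open>u\<close> over a small
  square as \<open>s\<^sup>2\<close> times a value of a mixed second derivative near \<open>p\<close>.
\<close>

lemma second_difference:
  fixes u :: "real ^ 'n::finite \<Rightarrow> real"
  assumes B: "ball p r \<subseteq> M" and s: "0 < s" "2 * s < r"
    and u: "\<And>q. q \<in> M \<Longrightarrow> u differentiable (at q)"
    and ui: "\<And>q. q \<in> M \<Longrightarrow> partial i u differentiable (at q)"
  obtains q where "dist p q \<le> 2 * s"
    "u (p + s *\<^sub>R axis i 1 + s *\<^sub>R axis j 1) - u (p + s *\<^sub>R axis i 1) - u (p + s *\<^sub>R axis j 1) + u p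
      = s * s * partial j (partial i u) q"
proof -
  let ?e = "axis i (1::real)" and ?d = "axis j (1::real)"
  have near: "dist p (p + x *\<^sub>R ?e + y *\<^sub>R ?d) \<le> 2 * s" if "0 \<le> x" "x \<le> s" "0 \<le> y" "y \<le> s" for x y
  proof -
    have "dist p (p + x *\<^sub>R ?e + y *\<^sub>R ?d) = norm (x *\<^sub>R ?e + y *\<^sub>R ?d)"
      by (metis add.assoc add_diff_cancel_left' dist_commute dist_norm)
    also have "\<dots> \<le> x + y"
      using norm_triangle_ineq[of "x *\<^sub>R ?e" "y *\<^sub>R ?d"] that by simp
    finally show ?thesis using that by simp
  qed
  have inM: "p + x *\<^sub>R ?e + y *\<^sub>R ?d \<in> M" if "0 \<le> x" "x \<le> s" "0 \<le> y" "y \<le> s" for x y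
    using near[OF that] s(2) B by (intro subsetD[OF B]) (simp add: mem_ball)
  define \<phi> where "\<phi> x = u (p + s *\<^sub>R ?d + x *\<^sub>R ?e) - u (p + x *\<^sub>R ?e)" for x
  have "\<exists>x. 0 < x \<and> x < s \<and> \<phi> s - \<phi> 0 = (s - 0) * (partial i u (p + s *\<^sub>R ?d + x *\<^sub>R ?e) - partial i u (p + x *\<^sub>R ?e))"
  proof (rule MVT2[OF s(1)])
    fix x :: real assume "0 \<le> x" "x \<le> s"
    then show "(\<phi> has_real_derivative partial i u (p + s *\<^sub>R ?d + x *\<^sub>R ?e) - partial i u (p + x *\<^sub>R ?e)) (at x)"
      unfolding \<phi>_def using inM[of x s] inM[of x 0] s(1)
      by (intro DERIV_diff DERIV_along_axis u) (auto simp: add_ac)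
  qed
  then obtain x where x: "0 < x" "x < s"
    "\<phi> s - \<phi> 0 = s * (partial i u (p + s *\<^sub>R ?d + x *\<^sub>R ?e) - partial i u (p + x *\<^sub>R ?e))" by auto
  have "\<exists>y. 0 < y \<and> y < s \<and> partial i u (p + x *\<^sub>R ?e + s *\<^sub>R ?d) - partial i u (p + x *\<^sub>R ?e + 0 *\<^sub>R ?d)
      = (s - 0) * partial j (partial i u) (p + x *\<^sub>R ?e + y *\<^sub>R ?d)"
  proof (rule MVT2[OF s(1)])
    fix y :: real assume "0 \<le> y" "y \<le> s"
    then show "((\<lambda>y. partial i u (p + x *\<^sub>R ?e + y *\<^sub>R ?d)) has_real_derivative
        partial j (partial i u) (p + x *\<^sub>R ?e + y *\<^sub>R ?d)) (at y)"
      using inM[of x y] x by (intro DERIV_along_axis ui) auto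
  qed
  then obtain y where y: "0 < y" "y < s"
    "partial i u (p + x *\<^sub>R ?e + s *\<^sub>R ?d) - partial i u (p + x *\<^sub>R ?e) = s * partial j (partial i u) (p + x *\<^sub>R ?e + y *\<^sub>R ?d)"
    by auto
  show thesis
  proof (rule that)
    show "dist p (p + x *\<^sub>R ?e + y *\<^sub>R ?d) \<le> 2 * s" using near x y by simp
    show "u (p + s *\<^sub>R ?e + s *\<^sub>R ?d) - u (p + s *\<^sub>R ?e) - u (p + s *\<^sub>R ?d) + u p
        = s * s * partial j (partial i u) (p + x *\<^sub>R ?e + y *\<^sub>R ?d)"
      using x(3) y(3) by (simp add: \<phi>_def add_ac)
  qed
qed

text \<open>
  The second difference over a square does not depend on the order of the two directions, so values of
  the two mixed derivatives agree at points arbitrarily close to \<open>p\<close>; continuity does the rest.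
\<close>

lemma partial_commute:
  fixes u :: "real ^ 'n::finite \<Rightarrow> real"
  assumes M: "open M" "p \<in> M" and u: "C_k_on 2 M u"
  shows "partial i (partial j u) p = partial j (partial i u) p"
proof (rule ccontr)
  let ?A = "partial i (partial j u)" and ?B = "partial j (partial i u)"
  assume "?A p \<noteq> ?B p"
  then have e: "\<bar>?A p - ?B p\<bar> / 2 > 0" (is "?e > 0") by simp
  have u1: "u differentiable (at q)" "partial k u differentiable (at q)" if "q \<in> M" for q k
    using u that by (auto simp: numeral_2_eq_2)
  have "continuous_on M (partial k (partial l u))" for k l
    using u by (auto simp: numeral_2_eq_2)
  then have cont: "isCont (partial k (partial l u)) p" for k l
    using M continuous_on_eq_continuous_at by blast
  obtain d1 where d1: "d1 > 0" "\<And>q. dist q p < d1 \<Longrightarrow> dist (?A q) (?A p) < ?e"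
    using cont[of i j] e unfolding continuous_at_eps_delta by blast
  obtain d2 where d2: "d2 > 0" "\<And>q. dist q p < d2 \<Longrightarrow> dist (?B q) (?B p) < ?e"
    using cont[of j i] e unfolding continuous_at_eps_delta by blast
  obtain r where r: "r > 0" "ball p r \<subseteq> M"
    using M open_contains_ball by blast
  define s where "s = min r (min d1 d2) / 3"
  have s: "0 < s" "2 * s < r" "2 * s < d1" "2 * s < d2"
    using r(1) d1(1) d2(1) by (auto simp: s_def)
  obtain q where q: "dist p q \<le> 2 * s"
    "u (p + s *\<^sub>R axis i 1 + s *\<^sub>R axis j 1) - u (p + s *\<^sub>R axis i 1) - u (p + s *\<^sub>R axis j 1) + u p
      = s * s * ?B q"
    using second_difference[OF r(2) s(1,2) u1(1) u1(2)[of _ i], of j] by blast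
  obtain q' where q': "dist p q' \<le> 2 * s"
    "u (p + s *\<^sub>R axis j 1 + s *\<^sub>R axis i 1) - u (p + s *\<^sub>R axis j 1) - u (p + s *\<^sub>R axis i 1) + u p
      = s * s * ?A q'"
    using second_difference[OF r(2) s(1,2) u1(1) u1(2)[of _ j], of i] by blast
  have swap: "p + s *\<^sub>R axis j 1 + s *\<^sub>R axis i 1 = p + s *\<^sub>R axis i 1 + s *\<^sub>R axis j (1::real)"
    by (simp add: add_ac)
  have "s * s * ?A q' = s * s * ?B q"
    using q(2) q'(2)[unfolded swap] by linarith
  then have "?A q' = ?B q" using s(1) by simp
  moreover have "dist (?A q') (?A p) < ?e" "dist (?B q) (?B p) < ?e"
    using d1(2)[of q'] d2(2)[of q] q(1) q'(1) s by (simp_all add: dist_commute)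
  ultimately show False by (simp add: dist_real_def abs_if split: if_splits)
qed

lemma smooth_on_partial_commute:
  fixes u :: "real ^ 'n::finite \<Rightarrow> real"
  shows "open M \<Longrightarrow> smooth_on M u \<Longrightarrow> p \<in> M \<Longrightarrow> partial i (partial j u) p = partial j (partial i u) p"
  by (rule partial_commute) (auto simp: smooth_on_def)

lemma frechet_derivative_partials:
  fixes u :: "real ^ 'n::finite \<Rightarrow> real"
  assumes "u differentiable (at p)"
  shows "frechet_derivative u (at p) v = (\<Sum>i\<in>UNIV. v $ i * partial i u p)"
proof -
  have lin: "linear (frechet_derivative u (at p))"
    using has_derivative_linear[OF has_derivative_frechet[OF assms]] .
  have "v = (\<Sum>i\<in>UNIV. v $ i *\<^sub>R axis i 1)"
    by (simp add: vec_eq_iff axis_def if_distrib cong: if_cong)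
  then have "frechet_derivative u (at p) v = frechet_derivative u (at p) (\<Sum>i\<in>UNIV. v $ i *\<^sub>R axis i 1)"
    by simp
  also have "\<dots> = (\<Sum>i\<in>UNIV. v $ i * partial i u p)"
    by (simp add: linear_sum[OF lin] linear_scale[OF lin] partial_def)
  finally show ?thesis .
qed

lemma constant_if_partials_zero:
  fixes u :: "real ^ 'n::finite \<Rightarrow> real"
  assumes "open M" "connected M" "smooth_on M u" "\<And>p i. p \<in> M \<Longrightarrow> partial i u p = 0"
  shows "\<exists>c. \<forall>p\<in>M. u p = c"
proof -
  have "(u has_derivative (\<lambda>v. 0)) (at p)" if "p \<in> M" for p
  proof -
    have d: "u differentiable (at p)" using assms(3) that by (rule smooth_on_differentiable)
    have "frechet_derivative u (at p) = (\<lambda>v. 0)"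
      using frechet_derivative_partials[OF d] assms(4)[OF that] by (simp add: fun_eq_iff)
    then show ?thesis using has_derivative_frechet[OF d] by simp
  qed
  then show ?thesis
    using has_derivative_zero_unique_connected[OF assms(1,2)] by metis
qed

lemma partial_divide_zero:
  fixes u v :: "real ^ 'n::finite \<Rightarrow> real"
  assumes "u differentiable (at p)" "v differentiable (at p)" "v p \<noteq> 0" "partial i u p = 0" "partial i v p = 0"
  shows "partial i (\<lambda>q. u q / v q) p = 0"
  using partial_mult[OF assms(1), of "\<lambda>q. inverse (v q)" i] partial_inverse[OF assms(2,3), of i] assms
  by (simp add: divide_inverse)

lemma partial_ln:
  assumes "u differentiable (at p)" "u p > (0::real)"
  shows "partial i (\<lambda>q. ln (u q)) p = partial i u p / u p"
  using partial_has_derivative[OF has_derivative_ln[OF assms(2) has_derivative_frechet[OF assms(1)]]]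
  by (simp add: partial_def divide_inverse mult.commute)

lemma differential_nth: "differential u p $ k = partial k u p"
  by (simp add: differential_def)

lemma deriv_along_mult:
  assumes "u differentiable (at p)" "v differentiable (at p)"
  shows "deriv_along Z (\<lambda>q. u q * v q) p = u p * deriv_along Z v p + deriv_along Z u p * v p"
  by (simp add: deriv_along_def partial_mult[OF assms] algebra_simps sum.distrib sum_distrib_left)

lemma deriv_along_diff:
  assumes "u differentiable (at p)" "v differentiable (at p)"
  shows "deriv_along Z (\<lambda>q. u q - v q) p = deriv_along Z u p - deriv_along Z v p"
  by (simp add: deriv_along_def partial_diff[OF assms] algebra_simps sum_subtractf)

lemma deriv_along_cmult:
  "u differentiable (at p) \<Longrightarrow> deriv_along Z (\<lambda>q. k * u q) p = k * deriv_along Z u p"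
  by (simp add: deriv_along_def partial_cmult sum_distrib_left algebra_simps)

lemma deriv_along_cong_open:
  "open M \<Longrightarrow> p \<in> M \<Longrightarrow> (\<And>q. q \<in> M \<Longrightarrow> u q = v q) \<Longrightarrow> deriv_along Z u p = deriv_along Z v p"
  unfolding deriv_along_def using partial_cong_open[of M p u v] by simp

section \<open>Forms and vectors in the four coordinates\<close>

lemma sum_coords:
  fixes s :: "ix \<Rightarrow> 'a::comm_monoid_add"
  shows "(\<Sum>k\<in>UNIV. s k) = s (Inl 1) + s (Inl 2) + s (Inr 1) + s (Inr 2)"
proof -
  have "(\<Sum>k\<in>UNIV. s k) = (\<Sum>k\<in>UNIV <+> UNIV. s k)" by (simp add: UNIV_Plus_UNIV)
  also have "\<dots> = (\<Sum>k\<in>UNIV. s (Inl k)) + (\<Sum>k\<in>UNIV. s (Inr k))"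
    by (subst sum.Plus) (auto simp: o_def)
  finally show ?thesis by (simp add: sum_2 add.assoc)
qed

lemma all_coords: "(\<forall>k::ix. P k) \<longleftrightarrow> P (Inl 1) \<and> P (Inl 2) \<and> P (Inr 1) \<and> P (Inr 2)"
  by (simp add: split_sum_all forall_2)

lemma coords_eq_iff:
  fixes x y :: "'a ^ ix"
  shows "x = y \<longleftrightarrow> x $ Inl 1 = y $ Inl 1 \<and> x $ Inl 2 = y $ Inl 2 \<and> x $ Inr 1 = y $ Inr 1 \<and> x $ Inr 2 = y $ Inr 2"
  by (simp add: vec_eq_iff all_coords)

definition coords :: "'a \<Rightarrow> 'a \<Rightarrow> 'a \<Rightarrow> 'a \<Rightarrow> 'a ^ ix" where
  "coords t\<^sub>1 t\<^sub>2 m\<^sub>1 m\<^sub>2 = (\<chi> k. case k of Inl i \<Rightarrow> (if i = 1 then t\<^sub>1 else t\<^sub>2) | Inr i \<Rightarrow> (if i = 1 then m\<^sub>1 else m\<^sub>2))"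

lemma coords_nth [simp]:
  "coords t\<^sub>1 t\<^sub>2 m\<^sub>1 m\<^sub>2 $ Inl 1 = t\<^sub>1" "coords t\<^sub>1 t\<^sub>2 m\<^sub>1 m\<^sub>2 $ Inl 2 = t\<^sub>2"
  "coords t\<^sub>1 t\<^sub>2 m\<^sub>1 m\<^sub>2 $ Inr 1 = m\<^sub>1" "coords t\<^sub>1 t\<^sub>2 m\<^sub>1 m\<^sub>2 $ Inr 2 = m\<^sub>2"
  by (simp_all add: coords_def)

lemma pair_coords:
  "pair \<xi> X = \<xi> $ Inl 1 * X $ Inl 1 + \<xi> $ Inl 2 * X $ Inl 2 + \<xi> $ Inr 1 * X $ Inr 1 + \<xi> $ Inr 2 * X $ Inr 2"
  for X :: "'a::comm_ring_1 ^ ix"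
  by (simp add: pair_def sum_coords)

lemma skew_matrix_nth: "skew_matrix B \<Longrightarrow> B $ j $ i = - B $ i $ j"
proof -
  assume "skew_matrix B"
  then have "transpose B $ i $ j = (- B) $ i $ j"
    by (simp only: skew_matrix_def)
  then show ?thesis by (simp add: transpose_def)
qed

lemma toric_X0_eq: "toric_X0 p = coords (- 1) 0 0 0"
  by (simp add: toric_X0_def coords_eq_iff axis_def)

lemma tng_toric_X0: "tng toric_X0 p = (coords (- 1) 0 0 0, 0)"
  by (simp add: tng_def toric_X0_eq)

lemma eval2_coords:
  fixes X :: "'a::comm_ring_1 ^ ix"
  shows "eval2 B X Y =
    B $ Inl 1 $ Inl 1 * X $ Inl 1 * Y $ Inl 1 + B $ Inl 1 $ Inl 2 * X $ Inl 1 * Y $ Inl 2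
    + B $ Inl 1 $ Inr 1 * X $ Inl 1 * Y $ Inr 1 + B $ Inl 1 $ Inr 2 * X $ Inl 1 * Y $ Inr 2
    + (B $ Inl 2 $ Inl 1 * X $ Inl 2 * Y $ Inl 1 + B $ Inl 2 $ Inl 2 * X $ Inl 2 * Y $ Inl 2
    + B $ Inl 2 $ Inr 1 * X $ Inl 2 * Y $ Inr 1 + B $ Inl 2 $ Inr 2 * X $ Inl 2 * Y $ Inr 2)
    + (B $ Inr 1 $ Inl 1 * X $ Inr 1 * Y $ Inl 1 + B $ Inr 1 $ Inl 2 * X $ Inr 1 * Y $ Inl 2
    + B $ Inr 1 $ Inr 1 * X $ Inr 1 * Y $ Inr 1 + B $ Inr 1 $ Inr 2 * X $ Inr 1 * Y $ Inr 2)
    + (B $ Inr 2 $ Inl 1 * X $ Inr 2 * Y $ Inl 1 + B $ Inr 2 $ Inl 2 * X $ Inr 2 * Y $ Inl 2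
    + B $ Inr 2 $ Inr 1 * X $ Inr 2 * Y $ Inr 1 + B $ Inr 2 $ Inr 2 * X $ Inr 2 * Y $ Inr 2)"
  by (simp add: eval2_def sum_coords)

text \<open>The shape \<open>\<kappa> d\<mu>\<^sub>1 \<and> dt\<^sub>1 + (g d\<mu>\<^sub>1 + l d\<mu>\<^sub>2) \<and> dt\<^sub>2\<close> to which (KK4) reduces \<open>F\<close>.\<close>

definition kform :: "real \<Rightarrow> real \<Rightarrow> real \<Rightarrow> real ^ ix ^ ix" where
  "kform \<kappa> g l = \<kappa> *\<^sub>R wedge (d\<mu> 1) (dt 1) + wedge (g *\<^sub>R d\<mu> 1 + l *\<^sub>R d\<mu> 2) (dt 2)"

lemma kform_nth:
  "kform \<kappa> g l $ Inl i $ Inl j = 0" "kform \<kappa> g l $ Inr i $ Inr j = 0"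
  "kform \<kappa> g l $ Inl 1 $ Inr 1 = - \<kappa>" "kform \<kappa> g l $ Inl 1 $ Inr 2 = 0"
  "kform \<kappa> g l $ Inl 2 $ Inr 1 = - g" "kform \<kappa> g l $ Inl 2 $ Inr 2 = - l"
  "kform \<kappa> g l $ Inr 1 $ Inl 1 = \<kappa>" "kform \<kappa> g l $ Inr 2 $ Inl 1 = 0"
  "kform \<kappa> g l $ Inr 1 $ Inl 2 = g" "kform \<kappa> g l $ Inr 2 $ Inl 2 = l"
  by (simp_all add: kform_def wedge_def d\<mu>_def dt_def axis_def)

lemma eval2_kform:
  "eval2 (cmat (kform \<kappa> g l)) X Y =
    of_real \<kappa> * (X $ Inr 1 * Y $ Inl 1 - X $ Inl 1 * Y $ Inr 1)
    + (of_real g * X $ Inr 1 + of_real l * X $ Inr 2) * Y $ Inl 2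
    - (of_real g * Y $ Inr 1 + of_real l * Y $ Inr 2) * X $ Inl 2"
  by (simp add: eval2_coords cmat_def kform_nth algebra_simps)

lemma skew_eq_kform:
  assumes B: "skew_matrix B"
    and "B $ Inl 1 $ Inl 2 = 0" "B $ Inr 1 $ Inr 2 = 0" "B $ Inr 2 $ Inl 1 = 0"
  shows "B = kform (B $ Inr 1 $ Inl 1) (B $ Inr 1 $ Inl 2) (B $ Inr 2 $ Inl 2)"
proof -
  note sk = skew_matrix_nth[OF B]
  have "B $ k $ k = 0" for k using sk[of k k] by simp
  then show ?thesis
    using assms(2-) sk[of "Inl 1" "Inl 2"] sk[of "Inr 1" "Inr 2"] sk[of "Inl 1" "Inr 2"] sk[of "Inl 1" "Inr 1"]
      sk[of "Inl 2" "Inr 1"] sk[of "Inl 2" "Inr 2"]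
    by (simp add: vec_eq_iff all_coords kform_nth)
qed

section \<open>The structure on a fibre\<close>

lemma matrix_inv_unique:
  fixes A :: "real ^ 'n::finite ^ 'n"
  assumes "A ** B = mat 1"
  shows "matrix_inv A = B"
proof -
  have "invertible A" using assms by (metis invertible_def matrix_left_right_inverse)
  then have "matrix_inv A ** (A ** B) = B"
    by (simp add: matrix_mul_assoc matrix_inv_mult)
  then show ?thesis using assms by simp
qed

text \<open>
  The left-hand side is the eigenvalue equation of \<open>\<J>\<close> for a vector with components
  \<open>(t, m)\<close> and a covector with components \<open>(x, n)\<close>.  Its first four equations are the tangent part;
  they already determine the covector when \<open>c \<noteq> 0\<close>, and the other four follow.
\<close>

lemma i_eigen_equations:
  fixes s11 s12 s22 c t1 t2 m1 m2 x1 x2 n1 n2 \<Delta> D :: complex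
  assumes \<Delta>: "\<Delta> = s11 * s22 - s12\<^sup>2" "\<Delta> \<noteq> 0" and D: "D = \<Delta> + c\<^sup>2" and c: "c \<noteq> 0"
  shows
   "(s11 * (D * m1 + c * n2) + s12 * (D * m2 - c * n1)) / \<Delta> = \<i> * t1 \<and>
    (s12 * (D * m1 + c * n2) + s22 * (D * m2 - c * n1)) / \<Delta> = \<i> * t2 \<and>
    (s22 * (c * x2 - t1) - s12 * (- c * x1 - t2)) / \<Delta> = \<i> * m1 \<and>
    (s11 * (- c * x1 - t2) - s12 * (c * x2 - t1)) / \<Delta> = \<i> * m2 \<and>
    (s22 * n1 - s12 * n2 - c * (s12 * m1 + s22 * m2)) / \<Delta> = \<i> * x1 \<and>
    (s11 * n2 - s12 * n1 + c * (s11 * m1 + s12 * m2)) / \<Delta> = \<i> * x2 \<and>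
    (c * (s12 * t1 - s11 * t2) - D * (s11 * x1 + s12 * x2)) / \<Delta> = \<i> * n1 \<and>
    (c * (s22 * t1 - s12 * t2) - D * (s12 * x1 + s22 * x2)) / \<Delta> = \<i> * n2
    \<longleftrightarrow>
    x1 = - (t2 + \<i> * (s12 * m1 + s22 * m2)) / c \<and> x2 = (t1 + \<i> * (s11 * m1 + s12 * m2)) / c \<and>
    n1 = (D * m2 + \<i> * (s12 * t1 - s11 * t2)) / c \<and> n2 = (- D * m1 + \<i> * (s22 * t1 - s12 * t2)) / c"
   (is "?L \<longleftrightarrow> ?R")
proof
  assume L: ?L
  then have L: "s11 * (D * m1 + c * n2) + s12 * (D * m2 - c * n1) = \<Delta> * (\<i> * t1)"
    "s12 * (D * m1 + c * n2) + s22 * (D * m2 - c * n1) = \<Delta> * (\<i> * t2)"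
    "s22 * (c * x2 - t1) - s12 * (- c * x1 - t2) = \<Delta> * (\<i> * m1)"
    "s11 * (- c * x1 - t2) - s12 * (c * x2 - t1) = \<Delta> * (\<i> * m2)"
    using \<Delta>(2) by (simp_all add: field_simps)
  have "\<Delta> * (c * x1) = - \<Delta> * (t2 + \<i> * (s12 * m1 + s22 * m2))"
    using L(3,4) unfolding \<Delta>(1) by algebra
  moreover have "\<Delta> * (c * x2) = \<Delta> * (t1 + \<i> * (s11 * m1 + s12 * m2))"
    using L(3,4) unfolding \<Delta>(1) by algebra
  moreover have "\<Delta> * (c * n1) = \<Delta> * (D * m2 + \<i> * (s12 * t1 - s11 * t2))"
    using L(1,2) unfolding \<Delta>(1) by algebra
  moreover have "\<Delta> * (c * n2) = \<Delta> * (- D * m1 + \<i> * (s22 * t1 - s12 * t2))"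
    using L(1,2) unfolding \<Delta>(1) by algebra
  ultimately have "c * x1 = - (t2 + \<i> * (s12 * m1 + s22 * m2))" "c * x2 = t1 + \<i> * (s11 * m1 + s12 * m2)"
    "c * n1 = D * m2 + \<i> * (s12 * t1 - s11 * t2)" "c * n2 = - D * m1 + \<i> * (s22 * t1 - s12 * t2)"
    using \<Delta>(2) by (metis mult_cancel_left mult_minus_left mult_minus_right)+
  then show ?R using c by (simp_all add: nonzero_eq_divide_eq mult.commute)
next
  assume ?R
  then have R: "c * x1 = - (t2 + \<i> * (s12 * m1 + s22 * m2))" "c * x2 = t1 + \<i> * (s11 * m1 + s12 * m2)"
    "c * n1 = D * m2 + \<i> * (s12 * t1 - s11 * t2)" "c * n2 = - D * m1 + \<i> * (s22 * t1 - s12 * t2)"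
    using c by simp_all
  have i: "\<i> * \<i> = -1" by simp
  have "c * (s22 * n1 - s12 * n2 - c * (s12 * m1 + s22 * m2)) = c * (\<Delta> * (\<i> * x1))"
    using R(1,3,4) \<Delta>(1) D i by algebra
  moreover have "c * (s11 * n2 - s12 * n1 + c * (s11 * m1 + s12 * m2)) = c * (\<Delta> * (\<i> * x2))"
    using R(2,3,4) \<Delta>(1) D i by algebra
  moreover have "c * (c * (s12 * t1 - s11 * t2) - D * (s11 * x1 + s12 * x2)) = c * (\<Delta> * (\<i> * n1))"
    using R(1,2,3) \<Delta>(1) D i by algebra
  moreover have "c * (c * (s22 * t1 - s12 * t2) - D * (s12 * x1 + s22 * x2)) = c * (\<Delta> * (\<i> * n2))"
    using R(1,2,4) \<Delta>(1) D i by algebra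
  ultimately have "s22 * n1 - s12 * n2 - c * (s12 * m1 + s22 * m2) = \<Delta> * (\<i> * x1)"
    "s11 * n2 - s12 * n1 + c * (s11 * m1 + s12 * m2) = \<Delta> * (\<i> * x2)"
    "c * (s12 * t1 - s11 * t2) - D * (s11 * x1 + s12 * x2) = \<Delta> * (\<i> * n1)"
    "c * (s22 * t1 - s12 * t2) - D * (s12 * x1 + s22 * x2) = \<Delta> * (\<i> * n2)"
    using c by (metis mult_cancel_left)+
  moreover have "s11 * (D * m1 + c * n2) + s12 * (D * m2 - c * n1) = \<Delta> * (\<i> * t1)"
    using R(3,4) \<Delta>(1) by algebra
  moreover have "s12 * (D * m1 + c * n2) + s22 * (D * m2 - c * n1) = \<Delta> * (\<i> * t2)"
    using R(3,4) \<Delta>(1) by algebra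
  moreover have "s22 * (c * x2 - t1) - s12 * (- c * x1 - t2) = \<Delta> * (\<i> * m1)"
    using R(1,2) \<Delta>(1) by algebra
  moreover have "s11 * (- c * x1 - t2) - s12 * (c * x2 - t1) = \<Delta> * (\<i> * m2)"
    using R(1,2) \<Delta>(1) by algebra
  ultimately show ?L using \<Delta>(2) by (simp add: nonzero_divide_eq_eq mult.commute[of _ \<Delta>])
qed

text \<open>
  \<open>A\<close> is the value of \<open>\<Psi>\<close> at a point, split into its symmetric part with entries \<open>s11, s12, s22\<close>
  and its skew part with upper entry \<open>c\<close>.
\<close>

locale toric_fibre =
  fixes A :: "real ^ 2 ^ 2" and s11 s12 s22 c :: real
  assumes A_nth: "A $ 1 $ 1 = s11" "A $ 1 $ 2 = s12 + c" "A $ 2 $ 1 = s12 - c" "A $ 2 $ 2 = s22"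
    and pos: "positive_definite A"
    and c: "c \<noteq> 0"
begin

definition \<Delta> :: real where "\<Delta> = s11 * s22 - s12\<^sup>2"
definition D :: real where "D = \<Delta> + c\<^sup>2"

lemma s22_pos: "s22 > 0"
proof -
  have "axis 2 1 \<bullet> (A *v axis 2 1) > 0"
    using pos by (simp add: positive_definite_def)
  then show ?thesis
    by (simp add: inner_vec_def matrix_vector_mult_def sum_2 axis_def A_nth)
qed

lemma \<Delta>_pos: "\<Delta> > 0"
proof -
  define v :: "real ^ 2" where "v = vector [s22, - s12]"
  have v: "v $ 1 = s22" "v $ 2 = - s12" by (simp_all add: v_def vector_2)
  then have "v \<noteq> 0" using s22_pos by (metis less_irrefl zero_index)
  then have "v \<bullet> (A *v v) > 0" using pos by (simp add: positive_definite_def)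
  moreover have "v \<bullet> (A *v v) = s22 * \<Delta>"
    by (simp add: inner_vec_def matrix_vector_mult_def sum_2 v A_nth \<Delta>_def algebra_simps power2_eq_square)
  ultimately show ?thesis using s22_pos by (simp add: zero_less_mult_iff)
qed

lemma D_pos: "D > 0"
  using \<Delta>_pos by (simp add: D_def add_pos_nonneg)

lemma matrix_inv_nth:
  "matrix_inv A $ 1 $ 1 = s22 / D" "matrix_inv A $ 1 $ 2 = - (s12 + c) / D"
  "matrix_inv A $ 2 $ 1 = (c - s12) / D" "matrix_inv A $ 2 $ 2 = s11 / D"
proof -
  define B :: "real ^ 2 ^ 2" where "B = vector [vector [s22 / D, - (s12 + c) / D], vector [(c - s12) / D, s11 / D]]"
  have B: "B $ 1 $ 1 = s22 / D" "B $ 1 $ 2 = - (s12 + c) / D" "B $ 2 $ 1 = (c - s12) / D" "B $ 2 $ 2 = s11 / D"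
    by (simp_all add: B_def vector_2)
  have "D = s11 * s22 - (s12 + c) * (s12 - c)"
    by (simp add: D_def \<Delta>_def algebra_simps power2_eq_square)
  then have "A ** B = mat 1"
    using D_pos by (simp add: vec_eq_iff forall_2 matrix_matrix_mult_def sum_2 B A_nth mat_def field_simps)
  then show
    "matrix_inv A $ 1 $ 1 = s22 / D" "matrix_inv A $ 1 $ 2 = - (s12 + c) / D"
    "matrix_inv A $ 2 $ 1 = (c - s12) / D" "matrix_inv A $ 2 $ 2 = s11 / D"
    by (simp_all add: matrix_inv_unique[of A B] B)
qed

lemma J_plus_apply:
  "J_plus A *v X = coords
     (s11 * X $ Inr 1 + (s12 + c) * X $ Inr 2) ((s12 - c) * X $ Inr 1 + s22 * X $ Inr 2)
     (- (s22 * X $ Inl 1 - (s12 + c) * X $ Inl 2) / D) (- ((c - s12) * X $ Inl 1 + s11 * X $ Inl 2) / D)"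
  by (simp add: coords_eq_iff matrix_vector_mult_def sum_coords J_plus_def block_J_def A_nth matrix_inv_nth
      diff_divide_distrib add_divide_distrib algebra_simps)

lemma J_minus_apply:
  "J_minus A *v X = coords
     (s11 * X $ Inr 1 + (s12 - c) * X $ Inr 2) ((s12 + c) * X $ Inr 1 + s22 * X $ Inr 2)
     (- (s22 * X $ Inl 1 + (c - s12) * X $ Inl 2) / D) (- (s11 * X $ Inl 2 - (s12 + c) * X $ Inl 1) / D)"
  by (simp add: coords_eq_iff matrix_vector_mult_def sum_coords J_minus_def block_J_def A_nth matrix_inv_nth
      transpose_def diff_divide_distrib add_divide_distrib algebra_simps)

lemma \<omega>_map_coords: "\<omega>_map *v X = coords (X $ Inr 1) (X $ Inr 2) (- X $ Inl 1) (- X $ Inl 2)"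
  by (simp add: coords_eq_iff \<omega>_map_apply)

lemma g_map_apply:
  "g_map A *v X = coords
     ((s22 * X $ Inl 1 - s12 * X $ Inl 2) / D) ((s11 * X $ Inl 2 - s12 * X $ Inl 1) / D)
     (s11 * X $ Inr 1 + s12 * X $ Inr 2) (s12 * X $ Inr 1 + s22 * X $ Inr 2)"
proof -
  have eq: "g_map A *v X = (- 1/2) *\<^sub>R (\<omega>_map *v (J_plus A *v X + J_minus A *v X))"
    unfolding g_map_def scaleR_matrix_vector_assoc[symmetric] matrix_vector_mul_assoc[symmetric]
      matrix_vector_mult_add_rdistrib ..
  show ?thesis
    unfolding eq using D_pos by (simp add: coords_eq_iff \<omega>_map_coords J_plus_apply J_minus_apply field_simps)
qed

lemma b_map_apply:
  "b_map A *v X = coords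
     (- c * X $ Inl 2 / D) (c * X $ Inl 1 / D) (c * X $ Inr 2) (- c * X $ Inr 1)"
proof -
  have eq: "b_map A *v X = (- 1/2) *\<^sub>R (\<omega>_map *v (J_plus A *v X - J_minus A *v X))"
    unfolding b_map_def scaleR_matrix_vector_assoc[symmetric] matrix_vector_mul_assoc[symmetric]
      matrix_vector_mult_diff_rdistrib ..
  show ?thesis
    unfolding eq using D_pos by (simp add: coords_eq_iff \<omega>_map_coords J_plus_apply J_minus_apply field_simps)
qed

lemma inv_g_map_apply:
  "matrix_inv (g_map A) *v y = coords
     (D * (s11 * y $ Inl 1 + s12 * y $ Inl 2) / \<Delta>) (D * (s12 * y $ Inl 1 + s22 * y $ Inl 2) / \<Delta>)
     ((s22 * y $ Inr 1 - s12 * y $ Inr 2) / \<Delta>) ((s11 * y $ Inr 2 - s12 * y $ Inr 1) / \<Delta>)"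
  (is "_ = ?z")
proof -
  have "\<Delta> = s11 * s22 - s12 * s12" by (simp add: \<Delta>_def power2_eq_square)
  then have "g_map A *v ?z = y"
    using D_pos \<Delta>_pos by (simp add: coords_eq_iff g_map_apply field_simps) (intro conjI; algebra)
  then have "matrix_inv (g_map A) *v y = (matrix_inv (g_map A) ** g_map A) *v ?z"
    by (simp flip: matrix_vector_mul_assoc)
  then show ?thesis
    by (simp add: matrix_inv_mult(2)[OF invertible_g_map[OF pos]])
qed

lemma G_end_fst: "fst (G_end A u) = matrix_inv (g_map A) *v (snd u - b_map A *v fst u)"
  by (simp add: G_end_def lift_plus_def lift_minus_def plus_comp_def minus_comp_def vec_eq_iff field_simps)

lemma G_end_snd: "snd (G_end A u) = b_map A *v fst (G_end A u) + g_map A *v fst u"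
proof -
  let ?z = "matrix_inv (g_map A) *v (snd u - b_map A *v fst u)"
  have "snd (G_end A u) = b_map A *v (plus_comp A u - minus_comp A u) + g_map A *v (plus_comp A u + minus_comp A u)"
    by (simp add: G_end_def lift_plus_def lift_minus_def matrix_vector_mult_add_rdistrib
        matrix_vector_mult_diff_rdistrib matrix_vector_mult_diff_distrib matrix_vector_right_distrib)
  moreover have "plus_comp A u - minus_comp A u = fst (G_end A u)" "plus_comp A u + minus_comp A u = fst u"
    by (simp_all add: G_end_fst plus_comp_def minus_comp_def vec_eq_iff field_simps)
  ultimately show ?thesis by simp
qed

lemma G_end_coords:
  "G_end A (X, \<xi>) =
    (coords
      ((s11 * (D * \<xi> $ Inl 1 + c * X $ Inl 2) + s12 * (D * \<xi> $ Inl 2 - c * X $ Inl 1)) / \<Delta>)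
      ((s12 * (D * \<xi> $ Inl 1 + c * X $ Inl 2) + s22 * (D * \<xi> $ Inl 2 - c * X $ Inl 1)) / \<Delta>)
      ((s22 * (\<xi> $ Inr 1 - c * X $ Inr 2) - s12 * (\<xi> $ Inr 2 + c * X $ Inr 1)) / \<Delta>)
      ((s11 * (\<xi> $ Inr 2 + c * X $ Inr 1) - s12 * (\<xi> $ Inr 1 - c * X $ Inr 2)) / \<Delta>),
     coords
      ((s22 * X $ Inl 1 - s12 * X $ Inl 2 - c * (s12 * \<xi> $ Inl 1 + s22 * \<xi> $ Inl 2)) / \<Delta>)
      ((s11 * X $ Inl 2 - s12 * X $ Inl 1 + c * (s11 * \<xi> $ Inl 1 + s12 * \<xi> $ Inl 2)) / \<Delta>)
      ((D * (s11 * X $ Inr 1 + s12 * X $ Inr 2) + c * (s11 * \<xi> $ Inr 2 - s12 * \<xi> $ Inr 1)) / \<Delta>)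
      ((D * (s12 * X $ Inr 1 + s22 * X $ Inr 2) - c * (s22 * \<xi> $ Inr 1 - s12 * \<xi> $ Inr 2)) / \<Delta>))"
  (is "_ = (?z, ?y)")
proof -
  have z: "fst (G_end A (X, \<xi>)) = ?z"
    using D_pos \<Delta>_pos by (simp add: coords_eq_iff G_end_fst inv_g_map_apply b_map_apply field_simps)
  have D: "D = \<Delta> + c * c" by (simp add: D_def power2_eq_square)
  have "snd (G_end A (X, \<xi>)) = ?y"
    unfolding G_end_snd z using D_pos \<Delta>_pos
    by (simp add: coords_eq_iff b_map_apply g_map_apply field_simps) (simp add: D algebra_simps)
  with z show ?thesis by (simp add: prod_eq_iff)
qed

lemma comp_lifts:
  "plus_comp A (lift_plus A X + lift_minus A Y) = X" "minus_comp A (lift_plus A X + lift_minus A Y) = Y"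
proof -
  have "plus_comp A (u + v) = plus_comp A u + plus_comp A v" "minus_comp A (u + v) = minus_comp A u + minus_comp A v" for u v
    by (simp_all add: plus_comp_def minus_comp_def matrix_vector_right_distrib matrix_vector_mult_diff_distrib
        algebra_simps)
  then show "plus_comp A (lift_plus A X + lift_minus A Y) = X" "minus_comp A (lift_plus A X + lift_minus A Y) = Y"
    by (simp_all add: plus_minus_comp_lift[OF pos])
qed

lemma G_end_involutive: "G_end A (G_end A u) = u"
proof -
  have "lift_minus A (- X) = - lift_minus A X" for X
    by (simp add: lift_minus_def linear_neg[OF matrix_vector_mul_linear])
  then have "G_end A u = lift_plus A (plus_comp A u) + lift_minus A (- minus_comp A u)"
    by (simp add: G_end_def)
  then have "G_end A (G_end A u) = lift_plus A (plus_comp A u) + lift_minus A (minus_comp A u)"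
    using comp_lifts[of "plus_comp A u" "- minus_comp A u"] \<open>\<And>X. lift_minus A (- X) = - lift_minus A X\<close>
    by (simp add: G_end_def[of A "_ - _"])
  then show ?thesis by (simp add: lift_plus_minus_comp[OF pos])
qed

text \<open>
  \<open>\<J>\<^sub>2\<close> comes from \<open>\<omega>\<close> alone.  In terms of the components \<open>P\<close>, \<open>Q\<close> along \<open>C\<^sub>+\<close> and \<open>C\<^sub>-\<close> this
  follows from \<open>b + g = - \<omega> J\<^sub>+\<close>, \<open>b - g = \<omega> J\<^sub>-\<close> and \<open>J\<^sub>+\<^sup>2 = J\<^sub>-\<^sup>2 = - 1\<close>.
\<close>

lemma J2_coords:
  "J2 (G_end A) (J_end A) (X, \<xi>) =
    (coords (\<xi> $ Inr 1) (\<xi> $ Inr 2) (- \<xi> $ Inl 1) (- \<xi> $ Inl 2),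
     coords (X $ Inr 1) (X $ Inr 2) (- X $ Inl 1) (- X $ Inl 2))"
proof -
  define P Q where "P = plus_comp A (X, \<xi>)" and "Q = minus_comp A (X, \<xi>)"
  have "(X, \<xi>) = lift_plus A P + lift_minus A Q"
    by (simp add: P_def Q_def lift_plus_minus_comp[OF pos])
  then have X: "X = P + Q" and \<xi>: "\<xi> = (b_map A + g_map A) *v P + (b_map A - g_map A) *v Q"
    by (simp_all add: lift_plus_def lift_minus_def)
  have D: "D = s11 * s22 - s12 * s12 + c * c"
    by (simp add: D_def \<Delta>_def power2_eq_square)
  have plus: "(b_map A + g_map A) *v Y = coords
      ((s22 * Y $ Inl 1 - (s12 + c) * Y $ Inl 2) / D) ((s11 * Y $ Inl 2 - (s12 - c) * Y $ Inl 1) / D)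
      (s11 * Y $ Inr 1 + (s12 + c) * Y $ Inr 2) ((s12 - c) * Y $ Inr 1 + s22 * Y $ Inr 2)" for Y
    using D_pos by (simp add: matrix_vector_mult_add_rdistrib b_map_apply g_map_apply coords_eq_iff field_simps)
  have minus: "(b_map A - g_map A) *v Y = coords
      (- (s22 * Y $ Inl 1 - (s12 - c) * Y $ Inl 2) / D) (- (s11 * Y $ Inl 2 - (s12 + c) * Y $ Inl 1) / D)
      (- (s11 * Y $ Inr 1 + (s12 - c) * Y $ Inr 2)) (- ((s12 + c) * Y $ Inr 1 + s22 * Y $ Inr 2))" for Y
    using D_pos by (simp add: matrix_vector_mult_diff_rdistrib b_map_apply g_map_apply coords_eq_iff field_simps)
  \<comment> \<open>The entries of \<open>A\<^sup>-\<^sup>1 A = 1\<close> and \<open>A A\<^sup>-\<^sup>1 = 1\<close>, for \<open>A\<close> and for its transpose.\<close>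
  have inv:
    "(s22 * (s11 * x + (s12 + c) * y) - (s12 + c) * ((s12 - c) * x + s22 * y)) / D = x"
    "(s11 * ((s12 - c) * x + s22 * y) - (s12 - c) * (s11 * x + (s12 + c) * y)) / D = y"
    "(s22 * (s11 * x + (s12 - c) * y) - (s12 - c) * ((s12 + c) * x + s22 * y)) / D = x"
    "(s11 * ((s12 + c) * x + s22 * y) - (s12 + c) * (s11 * x + (s12 - c) * y)) / D = y" for x y
    using D_pos by (simp_all add: field_simps) (simp_all add: D algebra_simps)
  have inv':
    "s11 * ((s22 * x - (s12 + c) * y) / D) + (s12 + c) * ((s11 * y - (s12 - c) * x) / D) = x"
    "(s12 - c) * ((s22 * x - (s12 + c) * y) / D) + s22 * ((s11 * y - (s12 - c) * x) / D) = y"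
    "s11 * ((s22 * x - (s12 - c) * y) / D) + (s12 - c) * ((s11 * y - (s12 + c) * x) / D) = x"
    "(s12 + c) * ((s22 * x - (s12 - c) * y) / D) + s22 * ((s11 * y - (s12 + c) * x) / D) = y" for x y
    using D_pos by (simp_all add: field_simps) (simp_all add: D algebra_simps)
  have "J2 (G_end A) (J_end A) (X, \<xi>) = lift_plus A (J_plus A *v P) - lift_minus A (J_minus A *v Q)"
    by (simp add: J2_def J_end_def P_def Q_def G_end_def[of A "_ + _"] comp_lifts)
  moreover have "J_plus A *v P - J_minus A *v Q = coords (\<xi> $ Inr 1) (\<xi> $ Inr 2) (- \<xi> $ Inl 1) (- \<xi> $ Inl 2)"
    by (simp add: coords_eq_iff \<xi> b_map_apply g_map_apply J_plus_apply J_minus_apply diff_divide_distrib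
        add_divide_distrib algebra_simps)
  moreover have "(b_map A + g_map A) *v (J_plus A *v P) = coords (P $ Inr 1) (P $ Inr 2) (- P $ Inl 1) (- P $ Inl 2)"
    using inv[of "P $ Inr 1" "P $ Inr 2"] inv'[of "P $ Inl 1" "P $ Inl 2"]
    by (simp add: plus J_plus_apply coords_eq_iff)
      (simp add: diff_divide_distrib add_divide_distrib algebra_simps)
  moreover have "(b_map A - g_map A) *v (J_minus A *v Q) = - coords (Q $ Inr 1) (Q $ Inr 2) (- Q $ Inl 1) (- Q $ Inl 2)"
    using inv[of "Q $ Inr 1" "Q $ Inr 2"] inv'[of "Q $ Inl 1" "Q $ Inl 2"]
    by (simp add: minus J_minus_apply coords_eq_iff)
      (simp add: diff_divide_distrib add_divide_distrib algebra_simps)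
  ultimately show ?thesis
    by (simp add: lift_plus_def lift_minus_def prod_eq_iff) (simp add: coords_eq_iff X)
qed

text \<open>
  As \<open>G\<^sup>e\<^sup>n\<^sup>d\<close> is an involution, \<open>\<J> = G\<^sup>e\<^sup>n\<^sup>d \<J>\<^sub>2\<close>, so the simple form of \<open>\<J>\<^sub>2\<close> gives \<open>\<J>\<close>
  without composing with \<open>J\<^sub>\<plusminus>\<close> again.
\<close>

lemma J_end_coords:
  "J_end A (X, \<xi>) =
    (coords
      ((s11 * (D * X $ Inr 1 + c * \<xi> $ Inr 2) + s12 * (D * X $ Inr 2 - c * \<xi> $ Inr 1)) / \<Delta>)
      ((s12 * (D * X $ Inr 1 + c * \<xi> $ Inr 2) + s22 * (D * X $ Inr 2 - c * \<xi> $ Inr 1)) / \<Delta>)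
      ((s22 * (c * \<xi> $ Inl 2 - X $ Inl 1) - s12 * (- c * \<xi> $ Inl 1 - X $ Inl 2)) / \<Delta>)
      ((s11 * (- c * \<xi> $ Inl 1 - X $ Inl 2) - s12 * (c * \<xi> $ Inl 2 - X $ Inl 1)) / \<Delta>),
     coords
      ((s22 * \<xi> $ Inr 1 - s12 * \<xi> $ Inr 2 - c * (s12 * X $ Inr 1 + s22 * X $ Inr 2)) / \<Delta>)
      ((s11 * \<xi> $ Inr 2 - s12 * \<xi> $ Inr 1 + c * (s11 * X $ Inr 1 + s12 * X $ Inr 2)) / \<Delta>)
      ((c * (s12 * X $ Inl 1 - s11 * X $ Inl 2) - D * (s11 * \<xi> $ Inl 1 + s12 * \<xi> $ Inl 2)) / \<Delta>)
      ((c * (s22 * X $ Inl 1 - s12 * X $ Inl 2) - D * (s12 * \<xi> $ Inl 1 + s22 * \<xi> $ Inl 2)) / \<Delta>))"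
proof -
  have "J_end A (X, \<xi>) = G_end A (J2 (G_end A) (J_end A) (X, \<xi>))"
    by (simp add: J2_def G_end_involutive)
  then show ?thesis
    by (simp add: J2_coords G_end_coords prod_eq_iff coords_eq_iff algebra_simps)
qed

abbreviation "cs11 \<equiv> complex_of_real s11"
abbreviation "cs12 \<equiv> complex_of_real s12"
abbreviation "cs22 \<equiv> complex_of_real s22"
abbreviation "cc \<equiv> complex_of_real c"

lemma L1_iff:
  "(X, \<xi>) \<in> L1 (J_end A) \<longleftrightarrow>
    \<xi> $ Inl 1 = - (X $ Inl 2 + \<i> * (cs12 * X $ Inr 1 + cs22 * X $ Inr 2)) / cc \<and>
    \<xi> $ Inl 2 = (X $ Inl 1 + \<i> * (cs11 * X $ Inr 1 + cs12 * X $ Inr 2)) / cc \<and>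
    \<xi> $ Inr 1 = (of_real D * X $ Inr 2 + \<i> * (cs12 * X $ Inl 1 - cs11 * X $ Inl 2)) / cc \<and>
    \<xi> $ Inr 2 = (- of_real D * X $ Inr 1 + \<i> * (cs22 * X $ Inl 1 - cs12 * X $ Inl 2)) / cc"
proof -
  have "complex_of_real \<Delta> = cs11 * cs22 - cs12\<^sup>2" "complex_of_real \<Delta> \<noteq> 0"
    "complex_of_real D = of_real \<Delta> + cc\<^sup>2" "cc \<noteq> 0"
    using \<Delta>_pos c by (simp_all add: D_def) (simp add: \<Delta>_def)
  note eqs = i_eigen_equations[OF this]
  show ?thesis
    unfolding eqs[symmetric]
    by (simp add: L1_def i_eigenspace_def complex_ext_def gComplex_def gscale_def gRe_def gIm_def J_end_coords
        coords_eq_iff complex_eq_iff Re_divide_of_real Im_divide_of_real)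
qed

lemma L2_iff:
  "(X, \<xi>) \<in> L2 (G_end A) (J_end A) \<longleftrightarrow>
    \<xi> $ Inl 1 = - \<i> * X $ Inr 1 \<and> \<xi> $ Inl 2 = - \<i> * X $ Inr 2 \<and>
    \<xi> $ Inr 1 = \<i> * X $ Inl 1 \<and> \<xi> $ Inr 2 = \<i> * X $ Inl 2"
  by (auto simp: L2_def i_eigenspace_def complex_ext_def gComplex_def gscale_def gRe_def gIm_def J2_coords
      coords_eq_iff complex_eq_iff)

lemma cnj_L2_iff:
  "(X, \<xi>) \<in> gcnj ` L2 (G_end A) (J_end A) \<longleftrightarrow>
    \<xi> $ Inl 1 = \<i> * X $ Inr 1 \<and> \<xi> $ Inl 2 = \<i> * X $ Inr 2 \<and>
    \<xi> $ Inr 1 = - \<i> * X $ Inl 1 \<and> \<xi> $ Inr 2 = - \<i> * X $ Inl 2"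
proof -
  have gg: "gcnj (gcnj w) = w" for w :: "ix cgvec"
    by (simp add: gcnj_def prod_eq_iff vec_eq_iff)
  then have "w \<in> gcnj ` L \<longleftrightarrow> gcnj w \<in> L" for w :: "ix cgvec" and L
    using image_eqI[of w gcnj "gcnj w" L] by (auto simp: gg)
  then have "(X, \<xi>) \<in> gcnj ` L2 (G_end A) (J_end A) \<longleftrightarrow> gcnj (X, \<xi>) \<in> L2 (G_end A) (J_end A)"
    by blast
  also have "\<dots> \<longleftrightarrow>
    cnj (\<xi> $ Inl 1) = - \<i> * cnj (X $ Inr 1) \<and> cnj (\<xi> $ Inl 2) = - \<i> * cnj (X $ Inr 2) \<and>
    cnj (\<xi> $ Inr 1) = \<i> * cnj (X $ Inl 1) \<and> cnj (\<xi> $ Inr 2) = \<i> * cnj (X $ Inl 2)"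
    by (simp add: gcnj_def L2_iff)
  finally show ?thesis
    by (auto simp: complex_eq_iff)
qed

lemma fst_L1: "fst ` L1 (J_end A) = UNIV"
proof -
  have "\<exists>\<xi>. (X, \<xi>) \<in> L1 (J_end A)" for X
    by (rule exI[of _ "coords (- (X $ Inl 2 + \<i> * (cs12 * X $ Inr 1 + cs22 * X $ Inr 2)) / cc)
        ((X $ Inl 1 + \<i> * (cs11 * X $ Inr 1 + cs12 * X $ Inr 2)) / cc)
        ((of_real D * X $ Inr 2 + \<i> * (cs12 * X $ Inl 1 - cs11 * X $ Inl 2)) / cc)
        ((- of_real D * X $ Inr 1 + \<i> * (cs22 * X $ Inl 1 - cs12 * X $ Inl 2)) / cc)"])
      (simp add: L1_iff)
  then show ?thesis by (force simp: image_iff)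
qed

text \<open>The 1-forms \<open>dt\<^sub>j + i \<Sum>\<^sub>k S\<^sub>j\<^sub>k d\<mu>\<^sub>k\<close> in which \<open>\<epsilon>\<^sub>1\<close> takes its simplest form.\<close>

definition \<beta>\<^sub>1 :: "complex ^ ix \<Rightarrow> complex" where
  "\<beta>\<^sub>1 X = X $ Inl 1 + \<i> * (cs11 * X $ Inr 1 + cs12 * X $ Inr 2)"

definition \<beta>\<^sub>2 :: "complex ^ ix \<Rightarrow> complex" where
  "\<beta>\<^sub>2 X = X $ Inl 2 + \<i> * (cs12 * X $ Inr 1 + cs22 * X $ Inr 2)"

lemma eps_L1:
  "eps (L1 (J_end A)) X Y =
    (\<beta>\<^sub>1 X * \<beta>\<^sub>2 Y - \<beta>\<^sub>1 Y * \<beta>\<^sub>2 X) / cc - cc * (X $ Inr 1 * Y $ Inr 2 - Y $ Inr 1 * X $ Inr 2)"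
  (is "_ = ?e")
proof -
  have cc: "cc \<noteq> 0" using c by simp
  have D: "complex_of_real D = cs11 * cs22 - cs12 * cs12 + cc * cc"
    by (simp add: D_def \<Delta>_def power2_eq_square)
  have val: "pair \<xi> Y = ?e" if "(X, \<xi>) \<in> L1 (J_end A)" for \<xi>
  proof -
    note \<xi> = that[unfolded L1_iff]
    show ?thesis
      using cc by (simp add: pair_coords \<xi> \<beta>\<^sub>1_def \<beta>\<^sub>2_def D field_simps)
  qed
  obtain \<xi> where "(X, \<xi>) \<in> L1 (J_end A)"
    using fst_L1 by (metis UNIV_I imageE prod.collapse)
  then show ?thesis
    unfolding eps_def using val by (intro the_equality) (metis, metis)
qed

lemma eps_L2:
  "eps (L2 (G_end A) (J_end A)) X Y =
    - \<i> * (X $ Inr 1 * Y $ Inl 1 + X $ Inr 2 * Y $ Inl 2 - X $ Inl 1 * Y $ Inr 1 - X $ Inl 2 * Y $ Inr 2)"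
  (is "_ = ?e")
proof -
  have val: "pair \<xi> Y = ?e" if "(X, \<xi>) \<in> L2 (G_end A) (J_end A)" for \<xi>
    using that by (simp add: L2_iff pair_coords algebra_simps)
  have "(X, coords (- \<i> * X $ Inr 1) (- \<i> * X $ Inr 2) (\<i> * X $ Inl 1) (\<i> * X $ Inl 2)) \<in> L2 (G_end A) (J_end A)"
    by (simp add: L2_iff)
  then show ?thesis
    unfolding eps_def using val by (intro the_equality) (metis, metis)
qed

abbreviation x\<^sub>0 :: "ix gvec" where "x\<^sub>0 \<equiv> (coords (- 1) 0 0 0, 0)"

lemma J_x0: "J_end A x\<^sub>0 = (coords 0 0 (s22 / \<Delta>) (- s12 / \<Delta>), coords 0 0 (- c * s12 / \<Delta>) (- c * s22 / \<Delta>))"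
  by (simp add: J_end_coords)

lemma J2_x0: "J2 (G_end A) (J_end A) x\<^sub>0 = (0, coords 0 0 1 0)"
  by (simp add: J2_coords coords_eq_iff)

lemma J3_x0:
  "J3 (G_end A) (J_end A) x\<^sub>0 = (coords (- c * s12 / \<Delta>) (- c * s22 / \<Delta>) 0 0, coords (s22 / \<Delta>) (- s12 / \<Delta>) 0 0)"
  by (simp add: J3_def J2_x0 J_end_coords mult.commute)

lemma metric_x0: "metric (G_end A) x\<^sub>0 x\<^sub>0 = s22 / (2 * \<Delta>)"
  by (simp add: metric_def pairing_def G_end_coords pair_coords)

text \<open>
  By orthogonality of \<open>G\<^sup>e\<^sup>n\<^sup>d\<close> these four products are, up to sign, the pairings of \<open>(X, \<xi>)\<close> or of its
  image under \<open>G\<^sup>e\<^sup>n\<^sup>d\<close> with \<open>X\<^sub>0\<close> and \<open>d\<mu>\<^sub>1\<close>, which is why each of them is a multiple of a single component of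
  one of these two vectors.
\<close>

lemma metric_x0_images:
  "metric (G_end A) (X, \<xi>) x\<^sub>0 = (c * (s12 * \<xi> $ Inl 1 + s22 * \<xi> $ Inl 2) + s12 * X $ Inl 2 - s22 * X $ Inl 1) / (2 * \<Delta>)"
  "metric (G_end A) (X, \<xi>) (J_end A x\<^sub>0) = X $ Inr 1 / 2"
  "metric (G_end A) (X, \<xi>) (J2 (G_end A) (J_end A) x\<^sub>0)
    = (s22 * \<xi> $ Inr 1 - s12 * \<xi> $ Inr 2 - c * (s22 * X $ Inr 2 + s12 * X $ Inr 1)) / (2 * \<Delta>)"
  "metric (G_end A) (X, \<xi>) (J3 (G_end A) (J_end A) x\<^sub>0) = \<xi> $ Inl 1 / 2"
proof -
  have D: "D = s11 * s22 - s12 * s12 + c * c" and \<Delta>: "\<Delta> = s11 * s22 - s12 * s12"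
    by (simp_all add: D_def \<Delta>_def power2_eq_square)
  show "metric (G_end A) (X, \<xi>) x\<^sub>0 = (c * (s12 * \<xi> $ Inl 1 + s22 * \<xi> $ Inl 2) + s12 * X $ Inl 2 - s22 * X $ Inl 1) / (2 * \<Delta>)"
    using \<Delta>_pos by (simp add: metric_def pairing_def G_end_coords pair_coords field_simps)
  show "metric (G_end A) (X, \<xi>) (J_end A x\<^sub>0) = X $ Inr 1 / 2"
    unfolding J_x0 using \<Delta>_pos
    by (simp add: metric_def pairing_def G_end_coords pair_coords field_simps) (simp add: D \<Delta> algebra_simps)
  show "metric (G_end A) (X, \<xi>) (J2 (G_end A) (J_end A) x\<^sub>0)
    = (s22 * \<xi> $ Inr 1 - s12 * \<xi> $ Inr 2 - c * (s22 * X $ Inr 2 + s12 * X $ Inr 1)) / (2 * \<Delta>)"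
    unfolding J2_x0 using \<Delta>_pos
    by (simp add: metric_def pairing_def G_end_coords pair_coords field_simps)
  show "metric (G_end A) (X, \<xi>) (J3 (G_end A) (J_end A) x\<^sub>0) = \<xi> $ Inl 1 / 2"
    unfolding J3_x0 using \<Delta>_pos
    by (simp add: metric_def pairing_def G_end_coords pair_coords field_simps) (simp add: D \<Delta> algebra_simps)
qed

lemma S_perp_iff:
  "(X, \<xi>) \<in> S_perp (G_end A) (J_end A) x\<^sub>0 \<longleftrightarrow>
    X $ Inr 1 = 0 \<and> \<xi> $ Inl 1 = 0 \<and>
    s22 * X $ Inl 1 = s12 * X $ Inl 2 + c * s22 * \<xi> $ Inl 2 \<and>
    s22 * \<xi> $ Inr 1 = s12 * \<xi> $ Inr 2 + c * s22 * X $ Inr 2"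
proof -
  let ?B = "{x\<^sub>0, J_end A x\<^sub>0, J2 (G_end A) (J_end A) x\<^sub>0, J3 (G_end A) (J_end A) x\<^sub>0}"
  have "metric (G_end A) u (s + t) = metric (G_end A) u s + metric (G_end A) u t"
    "metric (G_end A) u (k *\<^sub>R s) = k * metric (G_end A) u s" "metric (G_end A) u 0 = 0" for u s t k
    by (simp_all add: metric_def pairing_def pair_coords algebra_simps)
  then have "subspace {s. metric (G_end A) (X, \<xi>) s = 0}"
    by (simp add: subspace_def)
  then have "(X, \<xi>) \<in> S_perp (G_end A) (J_end A) x\<^sub>0 \<longleftrightarrow> (\<forall>s\<in>?B. metric (G_end A) (X, \<xi>) s = 0)"
    unfolding S_perp_def S_space_def using span_minimal[of ?B "{s. metric (G_end A) (X, \<xi>) s = 0}"]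
    by (auto simp: subset_iff intro: span_base)
  also have "\<dots> \<longleftrightarrow> metric (G_end A) (X, \<xi>) x\<^sub>0 = 0 \<and> metric (G_end A) (X, \<xi>) (J_end A x\<^sub>0) = 0
      \<and> metric (G_end A) (X, \<xi>) (J2 (G_end A) (J_end A) x\<^sub>0) = 0 \<and> metric (G_end A) (X, \<xi>) (J3 (G_end A) (J_end A) x\<^sub>0) = 0"
    by blast
  finally show ?thesis
    unfolding metric_x0_images using \<Delta>_pos by (auto simp: algebra_simps)
qed

lemma S_perp_c_iff:
  "(X, \<xi>) \<in> S_perp_c (G_end A) (J_end A) x\<^sub>0 \<longleftrightarrow>
    X $ Inr 1 = 0 \<and> \<xi> $ Inl 1 = 0 \<and>
    cs22 * X $ Inl 1 = cs12 * X $ Inl 2 + cc * cs22 * \<xi> $ Inl 2 \<and>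
    cs22 * \<xi> $ Inr 1 = cs12 * \<xi> $ Inr 2 + cc * cs22 * X $ Inr 2"
  by (auto simp: S_perp_c_def complexified_def gRe_def gIm_def S_perp_iff complex_eq_iff)

text \<open>
  Because \<open>c \<noteq> 0\<close>, the covector component along \<open>dt\<^sub>2\<close> can be chosen to satisfy the remaining
  condition on \<open>X\<close>, so only the vanishing of the \<open>\<mu>\<^sub>1\<close>-component survives the projection.
\<close>

lemma fst_S_perp: "fst ` S_perp (G_end A) (J_end A) x\<^sub>0 = {X. X $ Inr 1 = 0}"
proof (intro equalityI subsetI)
  fix X :: "real ^ ix" assume "X \<in> {X. X $ Inr 1 = 0}"
  then have "(X, coords 0 ((s22 * X $ Inl 1 - s12 * X $ Inl 2) / (c * s22)) (c * X $ Inr 2) 0)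
      \<in> S_perp (G_end A) (J_end A) x\<^sub>0"
    using c s22_pos by (simp add: S_perp_iff)
  then show "X \<in> fst ` S_perp (G_end A) (J_end A) x\<^sub>0" by force
qed (auto simp: S_perp_iff)

lemma T_L2_eq:
  "T_L2 (G_end A) (J_end A) x\<^sub>0 =
    {X. X $ Inr 1 = 0 \<and> cs22 * X $ Inl 1 = cs12 * X $ Inl 2 - \<i> * cc * cs22 * X $ Inr 2}"
  (is "_ = ?R")
proof (intro equalityI subsetI)
  fix X assume X: "X \<in> ?R"
  then have "\<i> * (cs22 * X $ Inl 1) = \<i> * (cs12 * X $ Inl 2 - \<i> * cc * cs22 * X $ Inr 2)"
    by simp
  then have "cs22 * (\<i> * X $ Inl 1) = \<i> * cs12 * X $ Inl 2 + cc * cs22 * X $ Inr 2"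
    by (simp add: algebra_simps)
  with X have "(X, coords (- \<i> * X $ Inr 1) (- \<i> * X $ Inr 2) (\<i> * X $ Inl 1) (\<i> * X $ Inl 2))
      \<in> L2 (G_end A) (J_end A) \<inter> S_perp_c (G_end A) (J_end A) x\<^sub>0"
    by (simp add: L2_iff S_perp_c_iff algebra_simps)
  then show "X \<in> T_L2 (G_end A) (J_end A) x\<^sub>0"
    unfolding T_L2_def by force
qed (auto simp: T_L2_def L2_iff S_perp_c_iff algebra_simps)

lemma T_cL1_L2_subset: "T_cL1_L2 (G_end A) (J_end A) x\<^sub>0 \<subseteq> {X. X $ Inr 1 = 0}"
proof -
  have "T_cL1_L2 (G_end A) (J_end A) x\<^sub>0 \<subseteq> fst ` S_perp_c (G_end A) (J_end A) x\<^sub>0"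
    unfolding T_cL1_L2_def by blast
  then show ?thesis by (auto simp: S_perp_c_iff)
qed

lemma T_L1_L2_eq:
  "T_L1_L2 (G_end A) (J_end A) x\<^sub>0 =
    {X. X $ Inr 1 = 0 \<and> X $ Inl 1 = - \<i> * (cs12 + cc) * X $ Inr 2 \<and> X $ Inl 2 = - \<i> * cs22 * X $ Inr 2}"
  (is "_ = ?R")
proof (intro equalityI subsetI)
  fix X assume "X \<in> ?R"
  then have X: "X $ Inr 1 = 0" "X $ Inl 1 = - \<i> * (cs12 + cc) * X $ Inr 2" "X $ Inl 2 = - \<i> * cs22 * X $ Inr 2"
    by simp_all
  let ?\<xi> = "coords 0 (- \<i> * X $ Inr 2) (\<i> * X $ Inl 1) (\<i> * X $ Inl 2)"
  have cc: "cc \<noteq> 0" using c by simp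
  have D: "complex_of_real D = cs11 * cs22 - cs12 * cs12 + cc * cc"
    by (simp add: D_def \<Delta>_def power2_eq_square)
  have "(X, ?\<xi>) \<in> L1 (J_end A)"
    using cc by (simp add: L1_iff D X field_simps)
  moreover have "(X, ?\<xi>) \<in> L2 (G_end A) (J_end A)" "(X, ?\<xi>) \<in> S_perp_c (G_end A) (J_end A) x\<^sub>0"
    by (simp_all add: L2_iff S_perp_c_iff X algebra_simps)
  ultimately show "X \<in> T_L1_L2 (G_end A) (J_end A) x\<^sub>0"
    unfolding T_L1_L2_def by (intro image_eqI[where x = "(X, ?\<xi>)"]) (simp, blast)
next
  fix X assume "X \<in> T_L1_L2 (G_end A) (J_end A) x\<^sub>0"
  then obtain \<xi> where "(X, \<xi>) \<in> L1 (J_end A)" "(X, \<xi>) \<in> L2 (G_end A) (J_end A)"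
    "(X, \<xi>) \<in> S_perp_c (G_end A) (J_end A) x\<^sub>0"
    unfolding T_L1_L2_def by force
  then have "X $ Inr 1 = 0" "0 = - (X $ Inl 2 + \<i> * (cs22 * X $ Inr 2)) / cc"
    "- \<i> * X $ Inr 2 = (X $ Inl 1 + \<i> * (cs12 * X $ Inr 2)) / cc"
    by (auto simp: L1_iff L2_iff S_perp_c_iff)
  then show "X \<in> ?R"
    using c by (simp add: field_simps add_eq_0_iff)
qed

lemma T_L1_cL2_eq:
  "T_L1_cL2 (G_end A) (J_end A) x\<^sub>0 =
    {X. X $ Inr 1 = 0 \<and> X $ Inl 1 = - \<i> * (cs12 - cc) * X $ Inr 2 \<and> X $ Inl 2 = - \<i> * cs22 * X $ Inr 2}"
  (is "_ = ?R")
proof (intro equalityI subsetI)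
  fix X assume "X \<in> ?R"
  then have X: "X $ Inr 1 = 0" "X $ Inl 1 = - \<i> * (cs12 - cc) * X $ Inr 2" "X $ Inl 2 = - \<i> * cs22 * X $ Inr 2"
    by simp_all
  let ?\<xi> = "coords 0 (\<i> * X $ Inr 2) (- \<i> * X $ Inl 1) (- \<i> * X $ Inl 2)"
  have cc: "cc \<noteq> 0" using c by simp
  have D: "complex_of_real D = cs11 * cs22 - cs12 * cs12 + cc * cc"
    by (simp add: D_def \<Delta>_def power2_eq_square)
  have "(X, ?\<xi>) \<in> L1 (J_end A)"
    using cc by (simp add: L1_iff D X field_simps)
  moreover have "(X, ?\<xi>) \<in> gcnj ` L2 (G_end A) (J_end A)" "(X, ?\<xi>) \<in> S_perp_c (G_end A) (J_end A) x\<^sub>0"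
    by (simp_all add: cnj_L2_iff S_perp_c_iff X algebra_simps)
  ultimately show "X \<in> T_L1_cL2 (G_end A) (J_end A) x\<^sub>0"
    unfolding T_L1_cL2_def by (intro image_eqI[where x = "(X, ?\<xi>)"]) (simp, blast)
next
  fix X assume "X \<in> T_L1_cL2 (G_end A) (J_end A) x\<^sub>0"
  then obtain w where w: "X = fst w" "w \<in> L1 (J_end A) \<inter> gcnj ` L2 (G_end A) (J_end A) \<inter> S_perp_c (G_end A) (J_end A) x\<^sub>0"
    unfolding T_L1_cL2_def by (rule imageE)
  define \<xi> where "\<xi> = snd w"
  have "(X, \<xi>) \<in> L1 (J_end A)" "(X, \<xi>) \<in> gcnj ` L2 (G_end A) (J_end A)"
    "(X, \<xi>) \<in> S_perp_c (G_end A) (J_end A) x\<^sub>0"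
    using w by (simp_all add: \<xi>_def)
  then have "X $ Inr 1 = 0" "0 = - (X $ Inl 2 + \<i> * (cs22 * X $ Inr 2)) / cc"
    "\<i> * X $ Inr 2 = (X $ Inl 1 + \<i> * (cs12 * X $ Inr 2)) / cc"
    by (simp_all add: L1_iff cnj_L2_iff S_perp_c_iff)
  then show "X \<in> ?R"
    using c by (simp add: field_simps add_eq_0_iff)
qed

end

section \<open>The structure as a field over the domain\<close>

locale toric_structure =
  fixes M :: "(real ^ ix) set" and \<tau> :: "real ^ ix \<Rightarrow> real" and C :: "real ^ 2 ^ 2"
  assumes openM: "open M"
    and \<tau>_smooth: "smooth_on M \<tau>"
    and \<tau>_indep: "depends_only_on M {Inr 1, Inr 2} \<tau>"
    and hess_pos: "\<And>p. p \<in> M \<Longrightarrow> positive_definite (hess \<tau> p)"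
    and C_skew: "skew_matrix C" and C_nz: "C $ 1 $ 2 \<noteq> 0"
begin

definition c where "c = C $ 1 $ 2"
definition s where "s i j p = hess \<tau> p $ i $ j"
definition \<Delta> where "\<Delta> p = s 1 1 p * s 2 2 p - (s 1 2 p)\<^sup>2"
definition N where "N p = s 2 2 p / (2 * \<Delta> p)"
abbreviation \<rho> where "\<rho> \<equiv> \<Psi>_ratio \<tau> C"

lemma s_sym: "p \<in> M \<Longrightarrow> s 2 1 p = s 1 2 p"
  by (simp add: s_def hess_def smooth_on_partial_commute[OF openM \<tau>_smooth])

lemma C_nth: "C $ 1 $ 2 = c" "C $ 2 $ 1 = - c" "C $ 1 $ 1 = 0" "C $ 2 $ 2 = 0"
proof -
  from skew_matrix_nth[OF C_skew, of 2 1] skew_matrix_nth[OF C_skew, of 1 1] skew_matrix_nth[OF C_skew, of 2 2]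
  show "C $ 1 $ 2 = c" "C $ 2 $ 1 = - c" "C $ 1 $ 1 = 0" "C $ 2 $ 2 = 0"
    unfolding c_def by simp_all
qed

lemma fibre: "p \<in> M \<Longrightarrow> toric_fibre (\<Psi> \<tau> C p) (s 1 1 p) (s 1 2 p) (s 2 2 p) c"
  using s_sym[of p] C_nz positive_definite_add_skew[OF hess_pos C_skew, of p]
  by (simp add: toric_fibre_def \<Psi>_def s_def C_nth)

lemma c_nz: "c \<noteq> 0" by (simp add: c_def C_nz)

lemma fibre_\<Delta>: "p \<in> M \<Longrightarrow> toric_fibre.\<Delta> (s 1 1 p) (s 1 2 p) (s 2 2 p) = \<Delta> p"
  by (simp add: toric_fibre.\<Delta>_def[OF fibre] \<Delta>_def)

lemma s22_pos: "p \<in> M \<Longrightarrow> s 2 2 p > 0"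
  using toric_fibre.s22_pos[OF fibre] .

lemma \<Delta>_pos: "p \<in> M \<Longrightarrow> \<Delta> p > 0"
  using toric_fibre.\<Delta>_pos[OF fibre] by (simp add: fibre_\<Delta>)

lemma N_pos: "p \<in> M \<Longrightarrow> N p > 0"
  using s22_pos \<Delta>_pos by (simp add: N_def)

lemma \<rho>_eq: "p \<in> M \<Longrightarrow> \<rho> p = s 1 2 p / s 2 2 p"
  using s_sym[of p] by (simp add: \<Psi>_ratio_def \<Psi>_def C_nth s_def)

lemma s_smooth: "smooth_on M (s i j)"
  unfolding s_def[abs_def] hess_def by (simp add: smooth_on_partial \<tau>_smooth)

text \<open>
  Independence of \<open>t\<close> is an assumption on \<open>\<tau>\<close> only; it passes to the second derivatives because mixed
  partial derivatives commute.
\<close>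

lemma s_indep_t: "p \<in> M \<Longrightarrow> partial (Inl k) (s i j) p = 0"
proof -
  assume p: "p \<in> M"
  have t: "partial (Inl k) \<tau> q = 0" if "q \<in> M" for q
    using \<tau>_indep that by (simp add: depends_only_on_def independent_of_def)
  have t1: "partial (Inl k) (partial (Inr j) \<tau>) q = 0" if "q \<in> M" for q
    using smooth_on_partial_commute[OF openM \<tau>_smooth that, of "Inl k" "Inr j"]
      partial_zero_if_const_on[OF openM that t] by simp
  have "partial (Inl k) (partial (Inr i) (partial (Inr j) \<tau>)) p = 0"
    using smooth_on_partial_commute[OF openM smooth_on_partial[OF \<tau>_smooth] p, of "Inl k" "Inr i" "Inr j"]
      partial_zero_if_const_on[OF openM p t1] by simp
  then show ?thesis by (simp add: s_def[abs_def] hess_def)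
qed

lemma \<rho>_smooth: "smooth_on M \<rho>"
  by (rule smooth_on_cong[OF openM, of "\<lambda>p. s 1 2 p / s 2 2 p"])
    (use s22_pos in \<open>fastforce simp: \<rho>_eq intro!: smooth_on_divide openM s_smooth\<close>)+

lemma \<Delta>_smooth: "smooth_on M \<Delta>"
  unfolding \<Delta>_def[abs_def] power2_eq_square
  by (intro smooth_on_diff smooth_on_mult openM s_smooth)

lemma N_smooth: "smooth_on M N"
  unfolding N_def[abs_def] using \<Delta>_pos
  by (intro smooth_on_divide smooth_on_mult openM s_smooth \<Delta>_smooth smooth_on_const) fastforce

lemma \<rho>_indep_t: "p \<in> M \<Longrightarrow> partial (Inl k) \<rho> p = 0"
  using partial_cong_open[OF openM, of p \<rho> "\<lambda>p. s 1 2 p / s 2 2 p"] s22_pos[of p]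
    smooth_on_differentiable[OF s_smooth] s_indep_t
  by (simp add: \<rho>_eq partial_divide_zero)

lemma \<Delta>_indep_t: "p \<in> M \<Longrightarrow> partial (Inl k) \<Delta> p = 0"
  using smooth_on_differentiable[OF s_smooth]
  by (simp add: \<Delta>_def[abs_def] partial_diff partial_mult partial_power2 s_indep_t)

lemma N_indep_t: "p \<in> M \<Longrightarrow> partial (Inl k) N p = 0"
  unfolding N_def[abs_def]
  using smooth_on_differentiable[OF s_smooth] smooth_on_differentiable[OF \<Delta>_smooth] \<Delta>_pos[of p]
  by (intro partial_divide_zero) (simp_all add: s_indep_t \<Delta>_indep_t partial_cmult)

lemma norm2_X0_eq: "p \<in> M \<Longrightarrow> norm2_X0 (toric_G \<tau> C) toric_X0 p = N p"
  using toric_fibre.metric_x0[OF fibre]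
  by (simp add: norm2_X0_def tng_toric_X0 toric_G_def fibre_\<Delta> N_def)

lemma J3_X0:
  "p \<in> M \<Longrightarrow> J3 (toric_G \<tau> C p) (toric_J \<tau> C p) (tng toric_X0 p)
    = (coords (- 2 * c * N p * \<rho> p) (- 2 * c * N p) 0 0, coords (2 * N p) (- 2 * N p * \<rho> p) 0 0)"
  using s22_pos[of p] toric_fibre.J3_x0[OF fibre[of p]]
  by (simp add: toric_G_def toric_J_def tng_toric_X0 fibre_\<Delta> N_def \<rho>_eq)

lemma J_X0:
  "p \<in> M \<Longrightarrow> toric_J \<tau> C p (tng toric_X0 p)
    = (coords 0 0 (2 * N p) (- 2 * N p * \<rho> p), coords 0 0 (- 2 * c * N p * \<rho> p) (- 2 * c * N p))"
  using s22_pos[of p] toric_fibre.J_x0[OF fibre[of p]]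
  by (simp add: toric_J_def tng_toric_X0 fibre_\<Delta> N_def \<rho>_eq)

lemma J2_X0:
  "p \<in> M \<Longrightarrow> J2 (toric_G \<tau> C p) (toric_J \<tau> C p) (tng toric_X0 p) = (0, coords 0 0 1 0)"
  using toric_fibre.J2_x0[OF fibre[of p]] by (simp add: toric_G_def toric_J_def tng_toric_X0)

lemma v_vec_fst:
  "p \<in> M \<Longrightarrow> fst (v_vec (toric_G \<tau> C p) (toric_J \<tau> C p) (tng toric_X0 p) z)
    = coords (- 1 + 2 * of_real (c * N p * \<rho> p) / z\<^sup>2) (2 * of_real (c * N p) / z\<^sup>2)
        (- 2 * \<i> * of_real (N p)) (2 * \<i> * of_real (N p * \<rho> p))"
  by (simp add: v_vec_def J3_X0 J2_X0 J_X0)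
    (simp add: tng_toric_X0 gComplex_def gscale_def coords_eq_iff complex_of_real_def complex_eq_iff
      zero_complex.ctr one_complex.ctr Re_divide Im_divide)

abbreviation "G \<equiv> toric_G \<tau> C"
abbreviation "J \<equiv> toric_J \<tau> C"
abbreviation "Z \<equiv> Z_field G J toric_X0"

lemma Z_coords: "p \<in> M \<Longrightarrow> Z p = coords (of_real (- 2 * c * N p * \<rho> p)) (of_real (- 2 * c * N p)) 0 0"
  by (simp add: Z_field_def J3_X0 cvec_def coords_eq_iff)

lemma partial_Z:
  assumes p: "p \<in> M"
  shows "partial k (\<lambda>q. Z q $ Inl 1) p = of_real (- 2 * c * (partial k N p * \<rho> p + N p * partial k \<rho> p))"
    and "partial k (\<lambda>q. Z q $ Inl 2) p = of_real (- 2 * c * partial k N p)"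
    and "partial k (\<lambda>q. Z q $ Inr i) p = 0"
proof -
  have d: "N differentiable (at p)" "\<rho> differentiable (at p)"
    using smooth_on_differentiable[OF N_smooth p] smooth_on_differentiable[OF \<rho>_smooth p] by simp_all
  have "partial k (\<lambda>q. Z q $ Inl 1) p = partial k (\<lambda>q. complex_of_real (- 2 * c * (N q * \<rho> q))) p"
    by (rule partial_cong_open[OF openM p]) (simp add: Z_coords mult_ac)
  also have "\<dots> = of_real (partial k (\<lambda>q. - 2 * c * (N q * \<rho> q)) p)"
    by (rule partial_of_real) (use d in simp)
  also have "partial k (\<lambda>q. - 2 * c * (N q * \<rho> q)) p = - 2 * c * (partial k N p * \<rho> p + N p * partial k \<rho> p)"
    using d by (subst partial_cmult) (simp_all add: partial_mult)
  finally show "partial k (\<lambda>q. Z q $ Inl 1) p = of_real (- 2 * c * (partial k N p * \<rho> p + N p * partial k \<rho> p))" .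
  have "partial k (\<lambda>q. Z q $ Inl 2) p = partial k (\<lambda>q. complex_of_real (- 2 * c * N q)) p"
    by (rule partial_cong_open[OF openM p]) (simp add: Z_coords)
  also have "\<dots> = of_real (partial k (\<lambda>q. - 2 * c * N q) p)"
    by (rule partial_of_real) (use d in simp)
  also have "partial k (\<lambda>q. - 2 * c * N q) p = - 2 * c * partial k N p"
    by (rule partial_cmult) (rule d)
  finally show "partial k (\<lambda>q. Z q $ Inl 2) p = of_real (- 2 * c * partial k N p)" .
  show "partial k (\<lambda>q. Z q $ Inr i) p = 0"
    using exhaust_2[of i] by (auto intro!: partial_zero_if_const_on[OF openM p, of _ 0] simp: Z_coords)
qed

lemma smooth_on_coords:
  assumes "smooth_on M t\<^sub>1" "smooth_on M t\<^sub>2" "smooth_on M m\<^sub>1" "smooth_on M m\<^sub>2"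
  shows "smooth_on M (\<lambda>q. coords (t\<^sub>1 q) (t\<^sub>2 q) (m\<^sub>1 q) (m\<^sub>2 q))"
proof -
  have "\<forall>k. smooth_on M (\<lambda>q. coords (t\<^sub>1 q) (t\<^sub>2 q) (m\<^sub>1 q) (m\<^sub>2 q) $ k)"
    unfolding all_coords using assms by simp
  then show ?thesis by (intro smooth_on_vec openM) simp
qed

lemma T_L2_eq:
  "p \<in> M \<Longrightarrow> T_L2 (G p) (J p) (tng toric_X0 p) = {X. X $ Inr 1 = 0 \<and>
    of_real (s 2 2 p) * X $ Inl 1 = of_real (s 1 2 p) * X $ Inl 2 - \<i> * of_real c * of_real (s 2 2 p) * X $ Inr 2}"
  using toric_fibre.T_L2_eq[OF fibre] by (simp add: toric_G_def toric_J_def tng_toric_X0)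

lemma T_L1_L2_eq:
  "p \<in> M \<Longrightarrow> T_L1_L2 (G p) (J p) (tng toric_X0 p) = {X. X $ Inr 1 = 0 \<and>
    X $ Inl 1 = - \<i> * (of_real (s 1 2 p) + of_real c) * X $ Inr 2 \<and> X $ Inl 2 = - \<i> * of_real (s 2 2 p) * X $ Inr 2}"
  using toric_fibre.T_L1_L2_eq[OF fibre] by (simp add: toric_G_def toric_J_def tng_toric_X0)

lemma T_L1_cL2_eq:
  "p \<in> M \<Longrightarrow> T_L1_cL2 (G p) (J p) (tng toric_X0 p) = {X. X $ Inr 1 = 0 \<and>
    X $ Inl 1 = - \<i> * (of_real (s 1 2 p) - of_real c) * X $ Inr 2 \<and> X $ Inl 2 = - \<i> * of_real (s 2 2 p) * X $ Inr 2}"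
  using toric_fibre.T_L1_cL2_eq[OF fibre] by (simp add: toric_G_def toric_J_def tng_toric_X0)

lemma deriv_along_Z_zero:
  assumes "p \<in> M" "partial (Inl 1) u p = 0" "partial (Inl 2) u p = 0"
  shows "deriv_along Z u p = 0"
  using assms by (simp add: deriv_along_def sum_coords Z_coords)

text \<open>
  In a direction in which \<open>f\<close> is stationary only the factor \<open>G(X\<^sub>0, X\<^sub>0)\<close> contributes to \<open>\<alpha>\<close>.
\<close>

lemma \<alpha>_form_nth:
  assumes p: "p \<in> M" and f: "smooth_on M f" "\<And>q. q \<in> M \<Longrightarrow> f q \<noteq> 0" "\<And>q. q \<in> M \<Longrightarrow> (f q)\<^sup>2 - 1 \<noteq> 0"
    and k: "partial k f p = 0"
  shows "\<alpha>_form G toric_X0 f p $ k = partial k N p / N p"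
proof -
  have df: "f differentiable (at p)" and dN: "N differentiable (at p)"
    using smooth_on_differentiable[OF f(1) p] smooth_on_differentiable[OF N_smooth p] by simp_all
  \<comment> \<open>Writing \<open>ln |x|\<close> as \<open>ln (x\<^sup>2) / 2\<close> avoids differentiating the absolute value.\<close>
  have "partial k (\<lambda>q. ln (\<bar>(f q)\<^sup>2 - 1\<bar> / ((f q)\<^sup>2 * norm2_X0 G toric_X0 q))) p
      = partial k (\<lambda>q. (1/2) * ln (((f q)\<^sup>2 - 1)\<^sup>2) - ln ((f q)\<^sup>2) - ln (N q)) p"
  proof (rule partial_cong_open[OF openM p])
    fix q assume q: "q \<in> M"
    have "ln (((f q)\<^sup>2 - 1)\<^sup>2) = 2 * ln \<bar>(f q)\<^sup>2 - 1\<bar>"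
      using f(3)[OF q] ln_realpow[of "\<bar>(f q)\<^sup>2 - 1\<bar>" 2] by simp
    then show "ln (\<bar>(f q)\<^sup>2 - 1\<bar> / ((f q)\<^sup>2 * norm2_X0 G toric_X0 q))
        = 1/2 * ln (((f q)\<^sup>2 - 1)\<^sup>2) - ln ((f q)\<^sup>2) - ln (N q)"
      using f(2,3)[OF q] N_pos[OF q] by (simp add: norm2_X0_eq q ln_div ln_mult)
  qed
  also have "\<dots> = - (partial k N p / N p)"
  proof -
    have pos: "((f p)\<^sup>2 - 1)\<^sup>2 > 0" "(f p)\<^sup>2 > 0" "N p > 0"
      using f(2,3)[OF p] N_pos[OF p] by simp_all
    have d: "(\<lambda>q. (f q)\<^sup>2) differentiable (at p)" "(\<lambda>q. ((f q)\<^sup>2 - 1)\<^sup>2) differentiable (at p)"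
      using df by simp_all
    have ln: "(\<lambda>q. ln (u q)) differentiable (at p)" if "u differentiable (at p)" "u p > (0::real)" for u
      using has_derivative_ln[OF that(2) has_derivative_frechet[OF that(1)]] by (auto simp: differentiable_def)
    have "partial k (\<lambda>q. (f q)\<^sup>2) p = 0" "partial k (\<lambda>q. ((f q)\<^sup>2 - 1)\<^sup>2) p = 0"
      using df k by (simp_all add: partial_power2 partial_diff)
    then have 0: "partial k (\<lambda>q. ln ((f q)\<^sup>2)) p = 0" "partial k (\<lambda>q. ln (((f q)\<^sup>2 - 1)\<^sup>2)) p = 0"
      using partial_ln[OF d(1) pos(2)] partial_ln[OF d(2) pos(1)] by simp_all
    have l: "(\<lambda>q. ln ((f q)\<^sup>2)) differentiable (at p)" "(\<lambda>q. ln (((f q)\<^sup>2 - 1)\<^sup>2)) differentiable (at p)"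
      "(\<lambda>q. ln (N q)) differentiable (at p)" "(\<lambda>q. 1/2 * ln (((f q)\<^sup>2 - 1)\<^sup>2)) differentiable (at p)"
      using ln[OF d(1) pos(2)] ln[OF d(2) pos(1)] ln[OF dN pos(3)]
      by (simp_all add: differentiable_mult)
    show ?thesis
      unfolding partial_diff[OF differentiable_diff[OF l(4,1)] l(3)] partial_diff[OF l(4,1)]
        partial_cmult[OF l(2)] 0 partial_ln[OF dN pos(3)] by simp
  qed
  finally show ?thesis
    by (simp add: \<alpha>_form_def differential_nth)
qed

end

section \<open>The deformation data\<close>

locale kk_data = toric_structure M \<tau> C for M \<tau> C +
  fixes f h a :: "real ^ ix \<Rightarrow> real" and F :: "real ^ ix \<Rightarrow> real ^ ix ^ ix"
  assumes connM: "connected M"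
    and f: "smooth_on M f" "independent_of M (Inl 1) f"
           "\<And>p. p \<in> M \<Longrightarrow> f p \<noteq> 0" "\<And>p. p \<in> M \<Longrightarrow> (f p)\<^sup>2 - 1 \<noteq> 0"
    and h: "smooth_on M h" "depends_only_on M {Inr 1} h" "\<And>p. p \<in> M \<Longrightarrow> h p \<noteq> 0"
    and F: "smooth_on M F" "\<And>p. p \<in> M \<Longrightarrow> skew_matrix (F p)"
    and a: "smooth_on M a" "\<And>p. p \<in> M \<Longrightarrow> a p \<noteq> 0"
begin

definition \<kappa> where "\<kappa> p = 2 * a p * partial (Inr 1) h p / h p"

definition F_form where
  "F_form l \<longleftrightarrow> (\<forall>p\<in>M. F p = kform (\<kappa> p) (\<rho> p * (l p - \<kappa> p)) (l p))"

definition first_relation where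
  "first_relation l \<longleftrightarrow> (\<forall>p\<in>M. partial (Inr 2) \<rho> p = - (1 / (((f p)\<^sup>2 - 1) * a p)) * (l p + \<kappa> p * (f p)\<^sup>2))"

lemma h_indep: "p \<in> M \<Longrightarrow> k \<noteq> Inr 1 \<Longrightarrow> partial k h p = 0"
  using h(2) by (simp add: depends_only_on_def independent_of_def)

lemma dh_indep: "p \<in> M \<Longrightarrow> k \<noteq> Inr 1 \<Longrightarrow> partial k (partial (Inr 1) h) p = 0"
  using smooth_on_partial_commute[OF openM h(1), of p k "Inr 1"] partial_zero_if_const_on[OF openM, of p "partial k h" 0]
    h_indep by simp

lemma \<kappa>_smooth: "smooth_on M \<kappa>"
  unfolding \<kappa>_def[abs_def] using h(3)
  by (intro smooth_on_divide smooth_on_mult openM smooth_on_const a h smooth_on_partial) auto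

section \<open>The conditions (KK1), (KK2) and (KK5)\<close>

text \<open>The coefficient equation of (KK5), solved for \<open>D = \<partial>\<^sub>2 \<rho>\<close>.\<close>

lemma first_relation_iff:
  assumes "p \<in> M"
  shows "2 * ((f p)\<^sup>2 - 1) / (f p)\<^sup>2 * D + 2 * l / (a p * (f p)\<^sup>2) = - 4 * h' / h p \<longleftrightarrow>
    D = - (1 / (((f p)\<^sup>2 - 1) * a p)) * (l + 2 * a p * h' / h p * (f p)\<^sup>2)"
proof -
  define y z where "y = (f p)\<^sup>2" and "z = y - 1"
  have nz: "y \<noteq> 0" "z \<noteq> 0" "a p \<noteq> 0" "h p \<noteq> 0"
    using f(3,4)[OF assms] h(3)[OF assms] a(2)[OF assms] by (simp_all add: y_def z_def)
  show ?thesis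
    unfolding y_def[symmetric] z_def[symmetric] using nz
    by (simp add: field_simps) (auto simp: algebra_simps)
qed

text \<open>
  The cases \<open>e = 1\<close>, \<open>z = f\<close> and \<open>e = - 1\<close>, \<open>z = i f\<close> treat \<open>v\<^sub>f\<close> on \<open>L\<^sub>1 \<inter> L\<^sub>2\<close> and \<open>v\<^bsub>i f\<^esub>\<close> on
  \<open>L\<^sub>1\<close> intersected with the conjugate of \<open>L\<^sub>2\<close> at the same time: passing from one to the other changes the
  signs of \<open>c\<close> and of \<open>z\<^sup>2\<close>.
\<close>

lemma F_v_vec:
  assumes p: "p \<in> M" and l: "F_form l" and e: "e = 1 \<or> e = - 1"
    and X: "X $ Inr 1 = 0" "X $ Inl 1 = - \<i> * of_real (s 1 2 p + e * c) * X $ Inr 2"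
      "X $ Inl 2 = - \<i> * of_real (s 2 2 p) * X $ Inr 2"
    and z: "z\<^sup>2 = of_real (e * (f p)\<^sup>2)"
  shows "eval2 (cmat (F p)) (fst (v_vec (G p) (J p) (tng toric_X0 p) z)) X
    = - of_real (2 * e * c * N p * (l p + \<kappa> p * (f p)\<^sup>2) / (f p)\<^sup>2) * X $ Inr 2"
proof -
  have "F p = kform (\<kappa> p) (\<rho> p * (l p - \<kappa> p)) (l p)"
    using l p by (simp add: F_form_def)
  moreover have "\<rho> p * s 2 2 p = s 1 2 p"
    using s22_pos[OF p] by (simp add: \<rho>_eq[OF p])
  then have "complex_of_real (s 1 2 p) = of_real (\<rho> p) * of_real (s 2 2 p)"
    by (metis of_real_mult)
  ultimately show ?thesis
    unfolding v_vec_fst[OF p] z using e f(3)[OF p] by (auto simp: eval2_kform X field_simps power2_eq_square)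
qed

text \<open>
  The 2-form vanishes on complex lines, and the second part holds since \<open>L\<^sub>1\<close> projects onto everything.
\<close>

lemma KK1_holds:
  assumes l: "F_form l"
  shows "KK1 M G J toric_X0 F"
  unfolding KK1_def
proof (intro ballI conjI)
  fix p assume p: "p \<in> M"
  have F: "F p = kform (\<kappa> p) (\<rho> p * (l p - \<kappa> p)) (l p)"
    using l p by (simp add: F_form_def)
  show "eval2 (cmat (F p)) X Y = 0"
    if "X \<in> T_L1_L2 (G p) (J p) (tng toric_X0 p)" "Y \<in> T_L1_L2 (G p) (J p) (tng toric_X0 p)" for X Y
    using that by (simp add: F eval2_kform T_L1_L2_eq[OF p])
  show "eval2 (cmat (F p)) X Y = 0"
    if "X \<in> T_L1_cL2 (G p) (J p) (tng toric_X0 p)" "Y \<in> T_L1_cL2 (G p) (J p) (tng toric_X0 p)" for X Y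
    using that by (simp add: F eval2_kform T_L1_cL2_eq[OF p])
  show "eval2 (cmat (F p)) X Y *s cvec (toric_X0 p) \<in> fst ` L1 (J p)" for X Y
    using toric_fibre.fst_L1[OF fibre[OF p]] by (simp add: toric_J_def)
qed

context
  assumes f_indep: "\<And>p k. p \<in> M \<Longrightarrow> k \<noteq> Inr 1 \<Longrightarrow> partial k f p = 0"
begin

text \<open>
  On vectors without \<open>\<mu>\<^sub>1\<close>-component \<open>\<alpha>\<close> is \<open>d ln N\<close>, so that \<open>\<alpha>(X) Z\<close> cancels the
  derivative of the factor \<open>N\<close> in \<open>Z = - 2 c N (\<rho> \<partial>/\<partial>t\<^sub>1 + \<partial>/\<partial>t\<^sub>2)\<close>, and only the derivative of
  \<open>\<rho>\<close> is left.
\<close>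

lemma bracket_nth:
  assumes p: "p \<in> M" and X: "smooth_on M X" "\<And>q. q \<in> M \<Longrightarrow> X q $ Inr 1 = 0"
  defines "V \<equiv> lie_bracket Z X p + pair (cvec (\<alpha>_form G toric_X0 f p)) (X p) *s Z p"
  shows "V $ Inl 1 = deriv_along Z (\<lambda>q. X q $ Inl 1) p + of_real (2 * c * N p * partial (Inr 2) \<rho> p) * X p $ Inr 2"
    and "V $ Inl 2 = deriv_along Z (\<lambda>q. X q $ Inl 2) p"
    and "V $ Inr 1 = 0"
    and "V $ Inr 2 = deriv_along Z (\<lambda>q. X q $ Inr 2) p"
proof -
  have "partial k (\<lambda>q. X q $ Inr 1) p = 0" for k
    by (rule partial_zero_if_const_on[OF openM p]) (rule X)
  then have X1: "deriv_along Z (\<lambda>q. X q $ Inr 1) p = 0"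
    by (simp add: deriv_along_def)
  have \<alpha>: "pair (cvec (\<alpha>_form G toric_X0 f p)) (X p) = of_real (partial (Inr 2) N p / N p) * X p $ Inr 2"
    using X(2)[OF p] f(1,3,4) N_indep_t[OF p] f_indep[OF p]
    by (simp add: pair_coords cvec_def \<alpha>_form_nth[OF p])
  have XZ: "deriv_along X u p = X p $ Inr 2 * partial (Inr 2) u p"
    if "partial (Inl 1) u p = 0" "partial (Inl 2) u p = 0" for u
    using that X(2)[OF p] by (simp add: deriv_along_def sum_coords)
  note defs = V_def lie_bracket_def XZ partial_Z[OF p] N_indep_t[OF p] \<rho>_indep_t[OF p] \<alpha> Z_coords[OF p]
  show "V $ Inl 1 = deriv_along Z (\<lambda>q. X q $ Inl 1) p + of_real (2 * c * N p * partial (Inr 2) \<rho> p) * X p $ Inr 2"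
    using N_pos[OF p] by (simp add: defs field_simps)
  show "V $ Inl 2 = deriv_along Z (\<lambda>q. X q $ Inl 2) p"
    using N_pos[OF p] by (simp add: defs field_simps)
  show "V $ Inr 1 = 0"
    by (simp add: defs X1)
  show "V $ Inr 2 = deriv_along Z (\<lambda>q. X q $ Inr 2) p"
    by (simp add: defs)
qed

text \<open>
  On vectors without \<open>\<mu>\<^sub>1\<close>-component \<open>\<epsilon>\<^sub>2 = - i \<omega>\<close> involves only the components along \<open>t\<^sub>2\<close> and
  \<open>\<mu>\<^sub>2\<close>, and in these the corrected bracket with \<open>Z\<close> is plain differentiation along \<open>Z\<close>.  The
  statement is then the product rule.
\<close>

lemma D_eps2_zero:
  assumes p: "p \<in> M"
    and X: "smooth_on M X" "\<And>q. q \<in> M \<Longrightarrow> X q $ Inr 1 = 0"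
    and Y: "smooth_on M Y" "\<And>q. q \<in> M \<Longrightarrow> Y q $ Inr 1 = 0"
  shows "D_eps2 G J toric_X0 f X Y p = 0"
proof -
  have e: "eps (L2 (G q) (J q)) u v =
      - \<i> * (u $ Inr 1 * v $ Inl 1 + u $ Inr 2 * v $ Inl 2 - u $ Inl 1 * v $ Inr 1 - u $ Inl 2 * v $ Inr 2)"
    if "q \<in> M" for q u v
    using toric_fibre.eps_L2[OF fibre[OF that]] by (simp add: toric_G_def toric_J_def)
  have d: "(\<lambda>q. X q $ k) differentiable (at p)" "(\<lambda>q. Y q $ k) differentiable (at p)" for k
    using smooth_on_differentiable[OF smooth_on_vec_nth[OF openM X(1)] p]
      smooth_on_differentiable[OF smooth_on_vec_nth[OF openM Y(1)] p] by simp_all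
  have "deriv_along Z (\<lambda>q. eps (L2 (G q) (J q)) (X q) (Y q)) p
      = deriv_along Z (\<lambda>q. - \<i> * (X q $ Inr 2 * Y q $ Inl 2 - X q $ Inl 2 * Y q $ Inr 2)) p"
    by (rule deriv_along_cong_open[OF openM p]) (simp add: e X(2) Y(2))
  also have "\<dots> = - \<i> * (X p $ Inr 2 * deriv_along Z (\<lambda>q. Y q $ Inl 2) p + deriv_along Z (\<lambda>q. X q $ Inr 2) p * Y p $ Inl 2
      - (X p $ Inl 2 * deriv_along Z (\<lambda>q. Y q $ Inr 2) p + deriv_along Z (\<lambda>q. X q $ Inl 2) p * Y p $ Inr 2))"
    using d by (subst deriv_along_cmult) (simp_all add: deriv_along_diff deriv_along_mult)
  finally have main: "deriv_along Z (\<lambda>q. eps (L2 (G q) (J q)) (X q) (Y q)) p = \<dots>" .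
  define U V where "U = lie_bracket Z X p + pair (cvec (\<alpha>_form G toric_X0 f p)) (X p) *s Z p"
    and "V = lie_bracket Z Y p + pair (cvec (\<alpha>_form G toric_X0 f p)) (Y p) *s Z p"
  note U = bracket_nth[OF p X, folded U_def] and V = bracket_nth[OF p Y, folded V_def]
  have "D_eps2 G J toric_X0 f X Y p = deriv_along Z (\<lambda>q. eps (L2 (G q) (J q)) (X q) (Y q)) p
      - eps (L2 (G p) (J p)) U (Y p) - eps (L2 (G p) (J p)) (X p) V"
    by (simp add: D_eps2_def Let_def U_def V_def)
  then show ?thesis
    unfolding main e[OF p] by (simp add: U V X(2)[OF p] Y(2)[OF p] algebra_simps)
qed

text \<open>
  All terms of (KK5) are multiples of the single number \<open>w = (d\<mu>\<^sub>2 \<and> dt\<^sub>2)(X, Y)\<close>.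
\<close>

lemma KK5_equation:
  assumes p: "p \<in> M" and l: "F_form l"
    and X: "smooth_on M X" "\<And>q. q \<in> M \<Longrightarrow> X q $ Inr 1 = 0"
    and Y: "smooth_on M Y" "\<And>q. q \<in> M \<Longrightarrow> Y q $ Inr 1 = 0"
  defines "w \<equiv> X p $ Inr 2 * Y p $ Inl 2 - X p $ Inl 2 * Y p $ Inr 2"
  shows "eval2 (cmat (ext_deriv1
              (\<lambda>q. ((1 - (f q)\<^sup>2) / ((f q)\<^sup>2 * norm2_X0 G toric_X0 q)) *\<^sub>R snd (J3 (G q) (J q) (tng toric_X0 q))) p)) (X p) (Y p)
           + of_real (((f p)\<^sup>2 - 1) / ((f p)\<^sup>2 * norm2_X0 G toric_X0 p)) * D_eps2 G J toric_X0 f X Y p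
           + of_real (2 / (a p * (f p)\<^sup>2)) * eval2 (cmat (F p)) (X p) (Y p)
        = of_real (2 * ((f p)\<^sup>2 - 1) / (f p)\<^sup>2 * partial (Inr 2) \<rho> p + 2 * l p / (a p * (f p)\<^sup>2)) * w" (is "?L = _")
    and "of_real (2 / (h p * norm2_X0 G toric_X0 p))
             * (pair (cvec (differential h p)) (fst (v_vec (G p) (J p) (tng toric_X0 p) (of_real (f p)))) * eps (L2 (G p) (J p)) (X p) (Y p)
                + eval2 (wedge (snd (v_vec (G p) (J p) (tng toric_X0 p) (of_real (f p)))) (cvec (differential h p))) (X p) (Y p))
        = of_real (- 4 * partial (Inr 1) h p / h p) * w" (is "?R = _")
proof -
  define \<theta> where "\<theta> = (\<lambda>q. ((1 - (f q)\<^sup>2) / ((f q)\<^sup>2 * norm2_X0 G toric_X0 q)) *\<^sub>R snd (J3 (G q) (J q) (tng toric_X0 q)))"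
  define \<phi> where "\<phi> = (\<lambda>q. 2 * (1 - (f q)\<^sup>2) / (f q)\<^sup>2)"
  have \<theta>: "\<theta> q = coords (\<phi> q) (- \<phi> q * \<rho> q) 0 0" if "q \<in> M" for q
    using that N_pos[OF that] by (simp add: \<theta>_def \<phi>_def norm2_X0_eq J3_X0 coords_eq_iff)
  have df: "f differentiable (at p)" and d\<rho>: "\<rho> differentiable (at p)"
    using smooth_on_differentiable[OF f(1) p] smooth_on_differentiable[OF \<rho>_smooth p] by simp_all
  have "smooth_on M \<phi>"
    unfolding \<phi>_def power2_eq_square using f(3)
    by (intro smooth_on_divide smooth_on_mult smooth_on_diff openM smooth_on_const f) auto
  then have d\<phi>: "\<phi> differentiable (at p)" using p by (rule smooth_on_differentiable)
  have \<phi>0: "partial k \<phi> p = 0" if "k \<noteq> Inr 1" for k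
    unfolding \<phi>_def using df f(3)[OF p] f_indep[OF p that]
    by (intro partial_divide_zero) (simp_all add: partial_power2 partial_diff partial_cmult)
  have p1: "partial k (\<lambda>q. \<theta> q $ Inl 1) p = 0" if "k \<noteq> Inr 1" for k
    using partial_cong_open[OF openM p, of "\<lambda>q. \<theta> q $ Inl 1" \<phi>] \<phi>0[OF that] by (simp add: \<theta>)
  have p2: "partial k (\<lambda>q. \<theta> q $ Inl 2) p = - \<phi> p * partial k \<rho> p" if "k \<noteq> Inr 1" for k
  proof -
    have "partial k (\<lambda>q. \<theta> q $ Inl 2) p = partial k (\<lambda>q. - \<phi> q * \<rho> q) p"
      by (rule partial_cong_open[OF openM p]) (simp add: \<theta>)
    also have "\<dots> = - \<phi> p * partial k \<rho> p"
      using d\<phi> d\<rho> \<phi>0[OF that] by (subst partial_mult) (simp_all add: partial_minus)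
    finally show ?thesis .
  qed
  have p3: "partial k (\<lambda>q. \<theta> q $ Inr i) p = 0" for k i
    using exhaust_2[of i] by (auto intro!: partial_zero_if_const_on[OF openM p, of _ 0] simp: \<theta>)
  have \<phi>p: "\<phi> p = - (2 * ((f p)\<^sup>2 - 1) / (f p)\<^sup>2)"
    by (simp add: \<phi>_def diff_divide_distrib)
  have e\<theta>: "eval2 (cmat (ext_deriv1 \<theta> p)) (X p) (Y p) = - of_real (\<phi> p * partial (Inr 2) \<rho> p) * w"
    using X(2)[OF p] Y(2)[OF p]
    by (simp add: eval2_coords cmat_def ext_deriv1_def p1 p2 p3 \<rho>_indep_t[OF p] w_def algebra_simps)
  have eF: "eval2 (cmat (F p)) (X p) (Y p) = of_real (l p) * w"
    using l p X(2)[OF p] Y(2)[OF p] by (simp add: F_form_def eval2_kform w_def algebra_simps)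
  show "?L = of_real (2 * ((f p)\<^sup>2 - 1) / (f p)\<^sup>2 * partial (Inr 2) \<rho> p + 2 * l p / (a p * (f p)\<^sup>2)) * w"
    unfolding \<theta>_def[symmetric] e\<theta> eF \<phi>p
    by (simp add: D_eps2_zero[OF p X Y] distrib_right)
  have "pair (cvec (differential h p)) u = of_real (partial (Inr 1) h p) * u $ Inr 1" for u
    using h_indep[OF p] by (simp add: pair_coords cvec_def differential_nth)
  moreover have "eval2 (wedge \<xi> (cvec (differential h p))) (X p) (Y p) = 0" for \<xi>
    using h_indep[OF p] X(2)[OF p] Y(2)[OF p] by (simp add: eval2_coords wedge_def cvec_def differential_nth)
  moreover have "eps (L2 (G p) (J p)) (X p) (Y p) = - \<i> * w"
    using toric_fibre.eps_L2[OF fibre[OF p]] X(2)[OF p] Y(2)[OF p] by (simp add: toric_G_def toric_J_def w_def)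
  ultimately show "?R = of_real (- 4 * partial (Inr 1) h p / h p) * w"
    using N_pos[OF p] by (simp add: v_vec_fst[OF p] norm2_X0_eq[OF p] field_simps)
qed

lemma KK5_iff:
  assumes l: "F_form l"
  shows "KK5 M G J toric_X0 f h a F \<longleftrightarrow> first_relation l"
proof
  assume K: "KK5 M G J toric_X0 f h a F"
  \<comment> \<open>The generators of the two lines in \<open>L\<^sub>2 \<inter> \<S>\<^sup>\<bottom>\<close>, projected to the tangent space; \<open>(d\<mu>\<^sub>2 \<and> dt\<^sub>2)(X, Y)\<close> is
    \<open>2 i S\<^sub>2\<^sub>2\<close>, which is not zero.\<close>
  define X where "X q = coords (- \<i> * of_real (s 1 2 q + c)) (- \<i> * of_real (s 2 2 q)) 0 1" for q
  define Y where "Y q = coords (\<i> * of_real (s 1 2 q - c)) (\<i> * of_real (s 2 2 q)) 0 1" for q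
  have X: "smooth_on M X" "\<And>q. q \<in> M \<Longrightarrow> X q $ Inr 1 = 0" and Y: "smooth_on M Y" "\<And>q. q \<in> M \<Longrightarrow> Y q $ Inr 1 = 0"
    unfolding X_def Y_def
    by (auto intro!: smooth_on_coords smooth_on_mult smooth_on_minus smooth_on_of_real smooth_on_add
        smooth_on_diff smooth_on_const s_smooth openM simp del: of_real_add of_real_diff)
  have "X \<in> smooth_sections M (\<lambda>q. T_L2 (G q) (J q) (tng toric_X0 q))"
    "Y \<in> smooth_sections M (\<lambda>q. T_L2 (G q) (J q) (tng toric_X0 q))"
    using X Y by (simp_all add: smooth_sections_def T_L2_eq) (simp_all add: X_def Y_def algebra_simps)
  note K' = K[unfolded KK5_def Let_def, rule_format, OF this]
  show "first_relation l"
    unfolding first_relation_def \<kappa>_def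
  proof (rule ballI)
    fix p assume p: "p \<in> M"
    have "X p $ Inr 2 * Y p $ Inl 2 - X p $ Inl 2 * Y p $ Inr 2 \<noteq> 0"
      using s22_pos[OF p] by (simp add: X_def Y_def)
    then have "2 * ((f p)\<^sup>2 - 1) / (f p)\<^sup>2 * partial (Inr 2) \<rho> p + 2 * l p / (a p * (f p)\<^sup>2)
        = - 4 * partial (Inr 1) h p / h p"
      using trans[OF trans[OF KK5_equation(1)[OF p l X Y, symmetric] K'[OF p]] KK5_equation(2)[OF p l X Y]]
      by (simp only: mult_cancel_right of_real_eq_iff) simp
    then show "partial (Inr 2) \<rho> p = - (1 / (((f p)\<^sup>2 - 1) * a p)) * (l p + 2 * a p * partial (Inr 1) h p / h p * (f p)\<^sup>2)"
      unfolding first_relation_iff[OF p] .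
  qed
next
  assume R: "first_relation l"
  show "KK5 M G J toric_X0 f h a F"
    unfolding KK5_def Let_def
  proof (intro ballI)
    fix X Y p
    assume "X \<in> smooth_sections M (\<lambda>q. T_L2 (G q) (J q) (tng toric_X0 q))"
      "Y \<in> smooth_sections M (\<lambda>q. T_L2 (G q) (J q) (tng toric_X0 q))" and p: "p \<in> M"
    then have X: "smooth_on M X" "\<And>q. q \<in> M \<Longrightarrow> X q $ Inr 1 = 0" and Y: "smooth_on M Y" "\<And>q. q \<in> M \<Longrightarrow> Y q $ Inr 1 = 0"
      by (auto simp: smooth_sections_def T_L2_eq)
    have "2 * ((f p)\<^sup>2 - 1) / (f p)\<^sup>2 * partial (Inr 2) \<rho> p + 2 * l p / (a p * (f p)\<^sup>2)
        = - 4 * partial (Inr 1) h p / h p"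
      unfolding first_relation_iff[OF p] using R p by (simp add: first_relation_def \<kappa>_def)
    note eq = KK5_equation[OF p l X(1) _ Y(1), OF X(2) Y(2), simplified this]
    show "eval2 (cmat (ext_deriv1
              (\<lambda>q. ((1 - (f q)\<^sup>2) / ((f q)\<^sup>2 * norm2_X0 G toric_X0 q)) *\<^sub>R snd (J3 (G q) (J q) (tng toric_X0 q))) p)) (X p) (Y p)
           + of_real (((f p)\<^sup>2 - 1) / ((f p)\<^sup>2 * norm2_X0 G toric_X0 p)) * D_eps2 G J toric_X0 f X Y p
           + of_real (2 / (a p * (f p)\<^sup>2)) * eval2 (cmat (F p)) (X p) (Y p)
        = of_real (2 / (h p * norm2_X0 G toric_X0 p))
             * (pair (cvec (differential h p)) (fst (v_vec (G p) (J p) (tng toric_X0 p) (of_real (f p)))) * eps (L2 (G p) (J p)) (X p) (Y p)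
                + eval2 (wedge (snd (v_vec (G p) (J p) (tng toric_X0 p) (of_real (f p)))) (cvec (differential h p))) (X p) (Y p))"
      by (rule trans[OF eq(1) eq(2)[symmetric]]) simp_all
  qed
qed

text \<open>
  The sections of either line are determined by their \<open>\<mu>\<^sub>2\<close>-component with coefficients that are constant
  along \<open>Z\<close>.  By the first relation the term with \<open>F\<close> removes the multiple of \<open>\<partial>/\<partial>t\<^sub>1\<close> in the
  bracket, so the result is the section whose \<open>\<mu>\<^sub>2\<close>-component is \<open>Z(X\<^sub>\<mu>)\<close>, with \<open>X\<^sub>\<mu>\<close> that of \<open>X\<close>.
\<close>

lemma KK2_section:
  assumes l: "F_form l" and R: "first_relation l" and e: "e = 1 \<or> e = - 1"
    and X: "smooth_on M X" "\<And>q. q \<in> M \<Longrightarrow> X q $ Inr 1 = 0"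
      "\<And>q. q \<in> M \<Longrightarrow> X q $ Inl 1 = - \<i> * of_real (s 1 2 q + e * c) * X q $ Inr 2"
      "\<And>q. q \<in> M \<Longrightarrow> X q $ Inl 2 = - \<i> * of_real (s 2 2 q) * X q $ Inr 2"
    and z: "\<And>q. (z q)\<^sup>2 = of_real (e * (f q)\<^sup>2)"
  defines "V \<equiv> (\<lambda>p. lie_bracket Z X p + pair (cvec (\<alpha>_form G toric_X0 f p)) (X p) *s Z p
              + (of_real (e * (f p)\<^sup>2)
                  * eval2 (cmat (F p)) (fst (v_vec (G p) (J p) (tng toric_X0 p) (z p))) (X p)
                  / of_real (a p * ((f p)\<^sup>2 - 1))) *s cvec (toric_X0 p))"
  shows "smooth_on M V"
    and "\<And>p. p \<in> M \<Longrightarrow> V p $ Inr 1 = 0 \<and> V p $ Inl 1 = - \<i> * of_real (s 1 2 p + e * c) * V p $ Inr 2 \<and>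
      V p $ Inl 2 = - \<i> * of_real (s 2 2 p) * V p $ Inr 2"
proof -
  define w where "w = deriv_along Z (\<lambda>q. X q $ Inr 2)"
  have sX: "smooth_on M (\<lambda>q. X q $ k)" for k
    by (rule smooth_on_vec_nth[OF openM X(1)])
  have Z_coeff: "deriv_along Z (\<lambda>q. X q $ k) p = u p * w p"
    if p: "p \<in> M" and k: "\<And>q. q \<in> M \<Longrightarrow> X q $ k = u q * X q $ Inr 2" and u: "smooth_on M u"
      "partial (Inl 1) u p = 0" "partial (Inl 2) u p = 0" for p k u
  proof -
    have "deriv_along Z (\<lambda>q. X q $ k) p = deriv_along Z (\<lambda>q. u q * X q $ Inr 2) p"
      by (rule deriv_along_cong_open[OF openM p k])
    then show ?thesis
      using deriv_along_Z_zero[OF p u(2,3)]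
      by (simp add: deriv_along_mult[OF smooth_on_differentiable[OF u(1) p] smooth_on_differentiable[OF sX p]] w_def)
  qed
  have sm: "smooth_on M (\<lambda>q. - \<i> * of_real (s 1 2 q + e * c))" "smooth_on M (\<lambda>q. - \<i> * of_real (s 2 2 q))"
    by (intro smooth_on_mult smooth_on_of_real smooth_on_add smooth_on_const s_smooth openM)+
  have ind: "partial (Inl k) (\<lambda>q. - \<i> * complex_of_real (s 1 2 q + e * c)) p = 0"
    "partial (Inl k) (\<lambda>q. - \<i> * complex_of_real (s 2 2 q)) p = 0" if p: "p \<in> M" for p k
  proof -
    have d: "s i j differentiable (at p)" for i j
      using smooth_on_differentiable[OF s_smooth p] .
    have d1: "(\<lambda>q. s 1 2 q + e * c) differentiable (at p)" using d by simp
    have dc: "(\<lambda>q. complex_of_real (u q)) differentiable (at p)" if "u differentiable (at p)" for u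
      using bounded_linear.has_derivative[OF bounded_linear_of_real has_derivative_frechet[OF that]]
      by (auto simp: differentiable_def)
    show "partial (Inl k) (\<lambda>q. - \<i> * complex_of_real (s 1 2 q + e * c)) p = 0"
      unfolding partial_cmult[OF dc[OF d1]] partial_of_real[OF d1]
      using partial_add[OF d, of "\<lambda>q. e * c" "Inl k" 1 2] s_indep_t[OF p] by simp
    show "partial (Inl k) (\<lambda>q. - \<i> * complex_of_real (s 2 2 q)) p = 0"
      unfolding partial_cmult[OF dc[OF d]] partial_of_real[OF d] using s_indep_t[OF p] by simp
  qed
  have V: "V p = coords (- \<i> * of_real (s 1 2 p + e * c) * w p) (- \<i> * of_real (s 2 2 p) * w p) 0 (w p)"
    if p: "p \<in> M" for p
  proof -
    define K where "K = of_real (e * (f p)\<^sup>2)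
                  * eval2 (cmat (F p)) (fst (v_vec (G p) (J p) (tng toric_X0 p) (z p))) (X p)
                  / of_real (a p * ((f p)\<^sup>2 - 1))"
    have "K = of_real (e * (f p)\<^sup>2 * (- (2 * e * c * N p * (l p + \<kappa> p * (f p)\<^sup>2) / (f p)\<^sup>2)) / (a p * ((f p)\<^sup>2 - 1))) * X p $ Inr 2"
      unfolding K_def F_v_vec[OF p l e X(2-4)[OF p] z] by simp
    also have "e * (f p)\<^sup>2 * (- (2 * e * c * N p * (l p + \<kappa> p * (f p)\<^sup>2) / (f p)\<^sup>2)) / (a p * ((f p)\<^sup>2 - 1))
        = 2 * c * N p * partial (Inr 2) \<rho> p"
    proof -
      have "partial (Inr 2) \<rho> p = - (1 / (((f p)\<^sup>2 - 1) * a p)) * (l p + \<kappa> p * (f p)\<^sup>2)"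
        using R p by (simp add: first_relation_def)
      then show ?thesis using e f(3)[OF p] by (auto simp: mult_ac)
    qed
    finally have K: "K = of_real (2 * c * N p * partial (Inr 2) \<rho> p) * X p $ Inr 2" .
    define B where "B = lie_bracket Z X p + pair (cvec (\<alpha>_form G toric_X0 f p)) (X p) *s Z p"
    have B: "B $ Inl 1 = - \<i> * of_real (s 1 2 p + e * c) * w p + of_real (2 * c * N p * partial (Inr 2) \<rho> p) * X p $ Inr 2"
      "B $ Inl 2 = - \<i> * of_real (s 2 2 p) * w p" "B $ Inr 1 = 0" "B $ Inr 2 = w p"
      using bracket_nth[OF p X(1,2), folded B_def] Z_coeff[OF p X(3) sm(1) ind(1)[OF p] ind(1)[OF p]]
        Z_coeff[OF p X(4) sm(2) ind(2)[OF p] ind(2)[OF p]]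
      by (simp_all add: w_def)
    have "V p = B + K *s cvec (toric_X0 p)"
      by (simp add: V_def B_def K_def)
    then show ?thesis
      by (simp add: coords_eq_iff B K toric_X0_eq cvec_def)
  qed
  then show "p \<in> M \<Longrightarrow> V p $ Inr 1 = 0 \<and> V p $ Inl 1 = - \<i> * of_real (s 1 2 p + e * c) * V p $ Inr 2 \<and>
      V p $ Inl 2 = - \<i> * of_real (s 2 2 p) * V p $ Inr 2" for p
    by simp
  have sN: "smooth_on M (\<lambda>q. Z q $ k)" for k
  proof -
    have "smooth_on M (\<lambda>q. coords (of_real (- 2 * c * N q * \<rho> q)) (of_real (- 2 * c * N q)) 0 (0::complex))"
      by (intro smooth_on_coords smooth_on_of_real smooth_on_mult smooth_on_const N_smooth \<rho>_smooth openM)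
    then have "smooth_on M Z"
      by (rule smooth_on_cong[OF openM, rotated]) (simp add: Z_coords)
    then show ?thesis by (rule smooth_on_vec_nth[OF openM])
  qed
  have "smooth_on M w"
    unfolding w_def deriv_along_def sum_coords
    by (intro smooth_on_add smooth_on_mult smooth_on_partial sN sX openM)
  then have "smooth_on M (\<lambda>p. coords (- \<i> * of_real (s 1 2 p + e * c) * w p) (- \<i> * of_real (s 2 2 p) * w p) 0 (w p))"
    by (intro smooth_on_coords smooth_on_const smooth_on_mult[OF openM sm(1)] smooth_on_mult[OF openM sm(2)])
  then show "smooth_on M V"
    by (rule smooth_on_cong[OF openM, rotated]) (simp add: V)
qed

lemma KK2_holds:
  assumes l: "F_form l" and R: "first_relation l"
  shows "KK2 M G J toric_X0 f a F"
  unfolding KK2_def Let_def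
proof (intro conjI ballI)
  fix X assume "X \<in> smooth_sections M (\<lambda>p. T_L1_L2 (G p) (J p) (tng toric_X0 p))"
  then have X: "smooth_on M X" "\<And>q. q \<in> M \<Longrightarrow> X q $ Inr 1 = 0"
      "\<And>q. q \<in> M \<Longrightarrow> X q $ Inl 1 = - \<i> * of_real (s 1 2 q + 1 * c) * X q $ Inr 2"
      "\<And>q. q \<in> M \<Longrightarrow> X q $ Inl 2 = - \<i> * of_real (s 2 2 q) * X q $ Inr 2"
    by (simp_all add: smooth_sections_def T_L1_L2_eq)
  show "(\<lambda>p. lie_bracket Z X p + pair (cvec (\<alpha>_form G toric_X0 f p)) (X p) *s Z p
              + (of_real ((f p)\<^sup>2)
                  * eval2 (cmat (F p)) (fst (v_vec (G p) (J p) (tng toric_X0 p) (of_real (f p)))) (X p)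
                  / of_real (a p * ((f p)\<^sup>2 - 1))) *s cvec (toric_X0 p))
      \<in> smooth_sections M (\<lambda>p. T_L1_L2 (G p) (J p) (tng toric_X0 p))"
    using KK2_section[OF l R _ X, of "\<lambda>q. of_real (f q)"]
    by (simp add: smooth_sections_def T_L1_L2_eq)
next
  fix X assume "X \<in> smooth_sections M (\<lambda>p. T_L1_cL2 (G p) (J p) (tng toric_X0 p))"
  then have X: "smooth_on M X" "\<And>q. q \<in> M \<Longrightarrow> X q $ Inr 1 = 0"
      "\<And>q. q \<in> M \<Longrightarrow> X q $ Inl 1 = - \<i> * of_real (s 1 2 q + (- 1) * c) * X q $ Inr 2"
      "\<And>q. q \<in> M \<Longrightarrow> X q $ Inl 2 = - \<i> * of_real (s 2 2 q) * X q $ Inr 2"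
    by (simp_all add: smooth_sections_def T_L1_cL2_eq)
  show "(\<lambda>p. lie_bracket Z X p + pair (cvec (\<alpha>_form G toric_X0 f p)) (X p) *s Z p
              - (of_real ((f p)\<^sup>2)
                  * eval2 (cmat (F p)) (fst (v_vec (G p) (J p) (tng toric_X0 p) (\<i> * of_real (f p)))) (X p)
                  / of_real (a p * ((f p)\<^sup>2 - 1))) *s cvec (toric_X0 p))
      \<in> smooth_sections M (\<lambda>p. T_L1_cL2 (G p) (J p) (tng toric_X0 p))"
    using KK2_section[OF l R _ X, of "\<lambda>q. \<i> * of_real (f q)"]
    by (simp add: smooth_sections_def T_L1_cL2_eq power_mult_distrib)
qed

end

section \<open>The conditions (KK3) and (KK4) and the equations for \<open>a\<close> and \<open>F\<close>\<close>

lemma KK3_iff: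
  "KK3 M G J toric_X0 f h a \<longleftrightarrow> (\<forall>p\<in>M. \<forall>k. k \<noteq> Inr 1 \<longrightarrow> partial k (\<lambda>q. a q * (f q)\<^sup>2 * (h q)\<^sup>2) p = 0)"
proof -
  have "(\<forall>X\<in>fst ` S_perp (G p) (J p) (tng toric_X0 p). pair (differential u p) X = 0)
      \<longleftrightarrow> (\<forall>k. k \<noteq> Inr 1 \<longrightarrow> partial k u p = 0)" if p: "p \<in> M" for p u
  proof -
    have S: "fst ` S_perp (G p) (J p) (tng toric_X0 p) = {X. X $ Inr 1 = 0}"
      using toric_fibre.fst_S_perp[OF fibre[OF p]] by (simp add: toric_G_def toric_J_def tng_toric_X0)
    have "(\<forall>X. X $ Inr 1 = 0 \<longrightarrow> pair (differential u p) X = 0) \<longleftrightarrow>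
        partial (Inl 1) u p = 0 \<and> partial (Inl 2) u p = 0 \<and> partial (Inr 2) u p = 0" (is "?A \<longleftrightarrow> ?B")
    proof
      assume A: ?A
      show ?B
        using A[rule_format, of "coords 1 0 0 0"] A[rule_format, of "coords 0 1 0 0"] A[rule_format, of "coords 0 0 0 1"]
        by (simp add: pair_coords differential_nth)
    qed (simp add: pair_coords differential_nth)
    also have "\<dots> \<longleftrightarrow> (\<forall>k. k \<noteq> Inr 1 \<longrightarrow> partial k u p = 0)"
      by (simp add: all_coords)
    finally show ?thesis by (simp add: S)
  qed
  then show ?thesis by (simp add: KK3_def)
qed

text \<open>
  The 3-form equation is \<open>\<beta>\<^sub>2 \<and> (F - \<kappa> d\<mu>\<^sub>1 \<and> \<beta>\<^sub>1) = 0\<close>.  If \<open>F\<close> has the stated shape, then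
  \<open>F - \<kappa> d\<mu>\<^sub>1 \<and> \<beta>\<^sub>1 = \<gamma> \<and> \<beta>\<^sub>2\<close> with \<open>\<gamma> = \<rho> (l - \<kappa>) d\<mu>\<^sub>1 + l d\<mu>\<^sub>2\<close>, and the
  equation is clear.
\<close>

lemma KK4_first_iff:
  assumes p: "p \<in> M"
  shows "(\<forall>X Y W. wedge12 (eps (L1 (J p)) (cvec (toric_X0 p))) (eval2 (cmat (F p))) X Y W
        = - of_real (2 * a p / h p) * wedge12 (pair (cvec (differential h p))) (eps (L1 (J p))) X Y W)
      \<longleftrightarrow> F p = kform (\<kappa> p) (\<rho> p * (F p $ Inr 2 $ Inl 2 - \<kappa> p)) (F p $ Inr 2 $ Inl 2)"
    (is "(\<forall>X Y W. ?E X Y W) \<longleftrightarrow> _")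
proof -
  define s11 s12 s22 where "s11 = complex_of_real (s 1 1 p)" and "s12 = complex_of_real (s 1 2 p)"
    and "s22 = complex_of_real (s 2 2 p)"
  define \<beta>1 \<beta>2 where "\<beta>1 X = X $ Inl 1 + \<i> * (s11 * X $ Inr 1 + s12 * X $ Inr 2)"
    and "\<beta>2 X = X $ Inl 2 + \<i> * (s12 * X $ Inr 1 + s22 * X $ Inr 2)" for X :: "complex ^ ix"
  have eps: "eps (L1 (J p)) X Y = (\<beta>1 X * \<beta>2 Y - \<beta>1 Y * \<beta>2 X) / of_real c
      - of_real c * (X $ Inr 1 * Y $ Inr 2 - Y $ Inr 1 * X $ Inr 2)" for X Y
    unfolding \<beta>1_def \<beta>2_def s11_def s12_def s22_def using toric_fibre.eps_L1[OF fibre[OF p]]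
    by (simp add: toric_J_def toric_fibre.\<beta>\<^sub>1_def[OF fibre[OF p]] toric_fibre.\<beta>\<^sub>2_def[OF fibre[OF p]])
  have cc: "complex_of_real c \<noteq> 0" using c_nz by simp
  have dh: "pair (cvec (differential h p)) X = of_real (partial (Inr 1) h p) * X $ Inr 1" for X
    using h_indep[OF p] by (simp add: pair_coords cvec_def differential_nth)
  have epsX0: "eps (L1 (J p)) (cvec (toric_X0 p)) X = - \<beta>2 X / of_real c" for X
    using cc by (simp add: eps) (simp add: \<beta>1_def \<beta>2_def toric_X0_eq cvec_def field_simps)
  have E: "?E X Y W \<longleftrightarrow>
      \<beta>2 X * eval2 (cmat (F p)) Y W + \<beta>2 Y * eval2 (cmat (F p)) W X + \<beta>2 W * eval2 (cmat (F p)) X Y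
      = of_real (\<kappa> p) * (X $ Inr 1 * (\<beta>1 Y * \<beta>2 W - \<beta>1 W * \<beta>2 Y) + Y $ Inr 1 * (\<beta>1 W * \<beta>2 X - \<beta>1 X * \<beta>2 W)
        + W $ Inr 1 * (\<beta>1 X * \<beta>2 Y - \<beta>1 Y * \<beta>2 X))" (is "_ \<longleftrightarrow> ?l = of_real (\<kappa> p) * ?r") for X Y W
  proof -
    have "wedge12 (eps (L1 (J p)) (cvec (toric_X0 p))) (eval2 (cmat (F p))) X Y W = - ?l / of_real c"
      by (simp add: wedge12_def epsX0 add_divide_distrib diff_divide_distrib)
    moreover have "wedge12 (pair (cvec (differential h p))) (eps (L1 (J p))) X Y W = of_real (partial (Inr 1) h p) * ?r / of_real c"
      using cc by (simp add: wedge12_def dh eps field_simps)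
    ultimately have "?E X Y W \<longleftrightarrow> - ?l / of_real c = - (of_real (\<kappa> p) * ?r) / of_real c"
      by (simp add: \<kappa>_def mult_ac)
    then show ?thesis
      using cc by (simp only: divide_cancel_right neg_equal_iff_equal) simp
  qed
  have \<rho>s: "\<rho> p * s 2 2 p = s 1 2 p"
    using s22_pos[OF p] by (simp add: \<rho>_eq[OF p])
  show ?thesis
  proof
    assume A: "\<forall>X Y W. ?E X Y W"
    note A = A[unfolded E, rule_format]
    \<comment> \<open>Three of the four triples of coordinate vectors suffice, because \<open>F\<close> is real while \<open>\<beta>\<^sub>1, \<beta>\<^sub>2\<close> are
      complex.\<close>
    note ev = eval2_coords cmat_def \<beta>1_def \<beta>2_def s11_def s12_def s22_def complex_eq_iff
    have "F p $ Inr 1 $ Inl 1 = \<kappa> p"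
      using A[of "coords 1 0 0 0" "coords 0 1 0 0" "coords 0 0 1 0"] by (simp add: ev)
    moreover have e2: "F p $ Inl 1 $ Inl 2 = 0" "F p $ Inr 2 $ Inl 1 = 0"
      using A[of "coords 1 0 0 0" "coords 0 1 0 0" "coords 0 0 0 1"] s22_pos[OF p] by (simp_all add: ev)
    moreover have "F p $ Inr 1 $ Inr 2 = 0"
      and g: "s 1 2 p * F p $ Inr 2 $ Inl 2 + s 2 2 p * F p $ Inl 2 $ Inr 1 = \<kappa> p * s 1 2 p"
      using A[of "coords 0 1 0 0" "coords 0 0 1 0" "coords 0 0 0 1"] by (simp_all add: ev)
    moreover have "F p $ Inl 2 $ Inr 1 = - F p $ Inr 1 $ Inl 2"
      using skew_matrix_nth[OF F(2)[OF p]] .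
    then have "s 2 2 p * F p $ Inr 1 $ Inl 2 = s 2 2 p * (\<rho> p * (F p $ Inr 2 $ Inl 2 - \<kappa> p))"
      using g unfolding \<rho>s[symmetric] by (simp add: algebra_simps)
    then have "F p $ Inr 1 $ Inl 2 = \<rho> p * (F p $ Inr 2 $ Inl 2 - \<kappa> p)"
      using s22_pos[OF p] by simp
    ultimately show "F p = kform (\<kappa> p) (\<rho> p * (F p $ Inr 2 $ Inl 2 - \<kappa> p)) (F p $ Inr 2 $ Inl 2)"
      using skew_eq_kform[OF F(2)[OF p]] by simp
  next
    assume "F p = kform (\<kappa> p) (\<rho> p * (F p $ Inr 2 $ Inl 2 - \<kappa> p)) (F p $ Inr 2 $ Inl 2)"
    then obtain l where F': "F p = kform (\<kappa> p) (\<rho> p * (l - \<kappa> p)) l" by blast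
    define \<gamma> where "\<gamma> X = of_real (\<rho> p * (l - \<kappa> p)) * X $ Inr 1 + of_real l * X $ Inr 2" for X :: "complex ^ ix"
    have \<rho>s': "of_real (\<rho> p) * s22 = s12"
      unfolding s12_def s22_def \<rho>s[symmetric] by simp
    have F'': "eval2 (cmat (F p)) X Y = of_real (\<kappa> p) * (X $ Inr 1 * \<beta>1 Y - Y $ Inr 1 * \<beta>1 X) + (\<gamma> X * \<beta>2 Y - \<gamma> Y * \<beta>2 X)" for X Y
      unfolding F' eval2_kform by (simp add: \<beta>1_def \<beta>2_def \<gamma>_def \<rho>s'[symmetric] algebra_simps)
    show "\<forall>X Y W. ?E X Y W"
      unfolding E F'' by (simp add: algebra_simps)
  qed
qed

text \<open>
  The equation for \<open>\<epsilon>\<^sub>2\<close> holds because \<open>dh\<close> vanishes on all vectors without \<open>\<mu>\<^sub>1\<close>-component.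
\<close>

lemma KK4_iff: "KK4 M G J toric_X0 h a F \<longleftrightarrow> F_form (\<lambda>p. F p $ Inr 2 $ Inl 2)"
proof -
  have "X $ Inr 1 = 0" if "p \<in> M" "X \<in> T_L1_L2 (G p) (J p) (tng toric_X0 p)
      \<or> X \<in> T_cL1_L2 (G p) (J p) (tng toric_X0 p) \<or> X \<in> T_L2 (G p) (J p) (tng toric_X0 p)" for p X
    using that(2) toric_fibre.T_L1_L2_eq[OF fibre[OF that(1)]] toric_fibre.T_L2_eq[OF fibre[OF that(1)]]
      toric_fibre.T_cL1_L2_subset[OF fibre[OF that(1)]]
    by (auto simp: toric_G_def toric_J_def tng_toric_X0)
  then have "pair (cvec (differential h p)) X = 0" if "p \<in> M" "X \<in> T_L1_L2 (G p) (J p) (tng toric_X0 p)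
      \<or> X \<in> T_cL1_L2 (G p) (J p) (tng toric_X0 p) \<or> X \<in> T_L2 (G p) (J p) (tng toric_X0 p)" for p X
    using that h_indep[OF that(1)] by (simp add: pair_coords cvec_def differential_nth)
  then show ?thesis
    using toric_fibre.fst_L1[OF fibre] KK4_first_iff
    by (simp add: KK4_def F_form_def wedge12_def[of "pair _"] toric_J_def)
qed

lemma da_iff:
  "(\<forall>p\<in>M. differential a p = - contract (toric_X0 p) (F p)) \<longleftrightarrow> (\<forall>p\<in>M. \<forall>k. partial k a p = F p $ Inl 1 $ k)"
  by (simp add: vec_eq_iff differential_nth contract_def sum_coords toric_X0_eq)

lemma partial_F:
  assumes l: "F_form l" "smooth_on M l" and p: "p \<in> M"
  shows "partial i (\<lambda>q. F q $ j $ k) p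
    = kform (partial i \<kappa> p) (partial i \<rho> p * (l p - \<kappa> p) + \<rho> p * (partial i l p - partial i \<kappa> p)) (partial i l p) $ j $ k"
proof -
  have d: "l differentiable (at p)" "\<kappa> differentiable (at p)" "\<rho> differentiable (at p)"
    using smooth_on_differentiable[OF l(2) p] smooth_on_differentiable[OF \<kappa>_smooth p]
      smooth_on_differentiable[OF \<rho>_smooth p] by simp_all
  have "\<forall>j k. partial i (\<lambda>q. kform (\<kappa> q) (\<rho> q * (l q - \<kappa> q)) (l q) $ j $ k) p
    = kform (partial i \<kappa> p) (partial i \<rho> p * (l p - \<kappa> p) + \<rho> p * (partial i l p - partial i \<kappa> p)) (partial i l p) $ j $ k"
    using d by (simp add: all_coords kform_nth partial_minus partial_mult partial_diff)
  moreover have "partial i (\<lambda>q. F q $ j $ k) p = partial i (\<lambda>q. kform (\<kappa> q) (\<rho> q * (l q - \<kappa> q)) (l q) $ j $ k) p"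
    using l(1) by (intro partial_cong_open[OF openM p]) (simp add: F_form_def)
  ultimately show ?thesis by simp
qed

text \<open>
  As \<open>\<kappa> d\<mu>\<^sub>1 \<and> dt\<^sub>1\<close> is closed, the condition is \<open>d(\<rho> (l - \<kappa>) d\<mu>\<^sub>1 + l d\<mu>\<^sub>2) \<and> dt\<^sub>2 = 0\<close>.
\<close>

lemma closed_iff:
  assumes l: "F_form l" "smooth_on M l" and \<kappa>: "\<And>p k. p \<in> M \<Longrightarrow> k \<noteq> Inr 1 \<Longrightarrow> partial k \<kappa> p = 0"
  shows "closed_2form M F \<longleftrightarrow> (\<forall>p\<in>M. partial (Inl 1) l p = 0 \<and>
    partial (Inr 1) l p = partial (Inr 2) \<rho> p * (l p - \<kappa> p) + \<rho> p * partial (Inr 2) l p)"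
  unfolding closed_2form_def
  by (intro ball_cong refl) (auto simp: all_coords partial_F[OF l] kform_nth \<kappa> \<rho>_indep_t)

text \<open>
  The flow translates along \<open>t\<^sub>1\<close>, so its differential is the identity and the components of \<open>F\<close> have to
  be constant on the segments that stay in \<open>M\<close>.
\<close>

lemma flow_invariant_if_indep:
  assumes "\<And>p j k. p \<in> M \<Longrightarrow> partial (Inl 1) (\<lambda>q. F q $ j $ k) p = 0"
  shows "flow_invariant M (const_field_flow (- axis (Inl 1) 1)) F"
  unfolding flow_invariant_def
proof (intro ballI allI impI)
  fix p x u v
  let ?\<phi> = "const_field_flow (- axis (Inl 1) 1) :: real \<Rightarrow> real ^ ix \<Rightarrow> real ^ ix"
  assume p: "p \<in> M" and seg: "\<forall>r\<in>closed_segment 0 x. ?\<phi> r p \<in> M"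
  have "(?\<phi> x has_derivative (\<lambda>v. v)) (at p)"
    unfolding const_field_flow_def by (auto intro!: derivative_eq_intros)
  then have D: "frechet_derivative (?\<phi> x) (at p) = (\<lambda>v. v)"
    by (metis frechet_derivative_at)
  have "F (?\<phi> x p) $ j $ k = F p $ j $ k" for j k
  proof -
    have "((\<lambda>r. F (?\<phi> r p) $ j $ k) has_derivative (\<lambda>_. 0)) (at r within closed_segment 0 x)"
      if "r \<in> closed_segment 0 x" for r
    proof -
      have m: "p + (- r) *\<^sub>R axis (Inl 1) 1 \<in> M"
        using seg that by (auto simp: const_field_flow_def)
      have "((\<lambda>y. F (p + y *\<^sub>R axis (Inl 1) 1) $ j $ k) has_real_derivative 0) (at (- r))"
        using DERIV_along_axis[of "\<lambda>q. F q $ j $ k" p "- r" "Inl 1"] assms[OF m]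
          smooth_on_differentiable[OF smooth_on_vec_nth[OF openM smooth_on_vec_nth[OF openM F(1)]] m]
        by simp
      moreover have "((\<lambda>r::real. - r) has_real_derivative - 1) (at r)"
        by (auto intro!: derivative_eq_intros)
      ultimately have "((\<lambda>r. F (?\<phi> r p) $ j $ k) has_real_derivative 0) (at r)"
        using DERIV_chain2[of "\<lambda>y. F (p + y *\<^sub>R axis (Inl 1) 1) $ j $ k" 0 uminus r "- 1" UNIV]
        by (simp add: const_field_flow_def)
      then show ?thesis
        unfolding lambda_zero has_field_derivative_def by (rule has_derivative_at_withinI)
    qed
    from has_derivative_zero_constant[OF convex_closed_segment this]
    obtain C where "\<forall>r\<in>closed_segment 0 x. F (?\<phi> r p) $ j $ k = C" by blast
    then have "F (?\<phi> x p) $ j $ k = F (?\<phi> 0 p) $ j $ k"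
      by (metis ends_in_segment)
    then show ?thesis by (simp add: const_field_flow_def)
  qed
  then have "F (?\<phi> x p) = F p" by (simp add: vec_eq_iff)
  then show "eval2 (F (?\<phi> x p)) (frechet_derivative (?\<phi> x) (at p) u) (frechet_derivative (?\<phi> x) (at p) v) = eval2 (F p) u v"
    by (simp add: D)
qed

lemma partial_a_iff:
  assumes p: "p \<in> M"
  shows "partial k (\<lambda>q. a q * (h q)\<^sup>2) p = 0 \<longleftrightarrow> partial k a p = - (2 * a p * partial k h p / h p)"
proof -
  have "partial k (\<lambda>q. a q * (h q)\<^sup>2) p = (partial k a p + 2 * a p * partial k h p / h p) * (h p)\<^sup>2"
    using smooth_on_differentiable[OF a(1) p] smooth_on_differentiable[OF h(1) p] h(3)[OF p]
    by (simp add: partial_mult partial_power2 field_simps power2_eq_square)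
  then show ?thesis using h(3)[OF p] by (simp add: add_eq_0_iff2)
qed

text \<open>
  The differential equation for \<open>a\<close> says that \<open>a h\<^sup>2\<close> has zero differential, hence is constant on the
  connected domain.
\<close>

lemma a_eq_iff:
  "(\<exists>k\<^sub>0. k\<^sub>0 \<noteq> 0 \<and> (\<forall>p\<in>M. a p = k\<^sub>0 / (h p)\<^sup>2)) \<longleftrightarrow>
    (\<forall>p\<in>M. \<forall>k. partial k a p = (if k = Inr 1 then - \<kappa> p else 0))" (is "?A \<longleftrightarrow> ?B")
proof
  assume ?A
  then obtain k\<^sub>0 where "\<And>p. p \<in> M \<Longrightarrow> a p * (h p)\<^sup>2 = k\<^sub>0" using h(3) by auto
  then have "partial k a p = - (2 * a p * partial k h p / h p)" if "p \<in> M" for p k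
    unfolding partial_a_iff[OF that, symmetric] by (rule partial_zero_if_const_on[OF openM that])
  then show ?B using h_indep by (simp add: \<kappa>_def)
next
  assume B: ?B
  have "partial k (\<lambda>q. a q * (h q)\<^sup>2) p = 0" if "p \<in> M" for p k
    unfolding partial_a_iff[OF that] using B that h_indep[OF that] by (simp add: \<kappa>_def)
  moreover have "smooth_on M (\<lambda>q. a q * (h q)\<^sup>2)"
    unfolding power2_eq_square by (intro smooth_on_mult a h openM)
  ultimately obtain k where k: "\<And>p. p \<in> M \<Longrightarrow> a p * (h p)\<^sup>2 = k"
    using constant_if_partials_zero[OF openM connM, of "\<lambda>q. a q * (h q)\<^sup>2"] by blast
  show ?A
  proof (cases "M = {}")
    case True
    \<comment> \<open>On the empty domain any nonzero constant will do.\<close>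
    then show ?thesis by (intro exI[of _ 1]) simp
  next
    case False
    then have "k \<noteq> 0" using k a(2) h(3) by (metis all_not_in_conv mult_eq_0_iff power_not_zero)
    then show ?thesis using k h(3) by (intro exI[of _ k]) (auto simp: field_simps)
  qed
qed

lemma \<kappa>_indep:
  assumes da: "\<And>p k. p \<in> M \<Longrightarrow> k \<noteq> Inr 1 \<Longrightarrow> partial k a p = 0" and p: "p \<in> M" and k: "k \<noteq> Inr 1"
  shows "partial k \<kappa> p = 0"
proof -
  have d: "a differentiable (at p)" "partial (Inr 1) h differentiable (at p)" "h differentiable (at p)"
    using smooth_on_differentiable[OF a(1) p] smooth_on_differentiable[OF smooth_on_partial[OF h(1)] p]
      smooth_on_differentiable[OF h(1) p] by simp_all
  show ?thesis
    unfolding \<kappa>_def[abs_def] using d h(3)[OF p] da[OF p k] dh_indep[OF p k] h_indep[OF p k]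
    by (intro partial_divide_zero) (simp_all add: partial_mult partial_cmult)
qed

text \<open>
  The projection of \<open>\<S>\<^sup>\<bottom>\<close> consists of the directions transverse to \<open>\<mu>\<^sub>1\<close>, and in these \<open>a\<close> and \<open>h\<close> are
  already constant; so (KK3) concerns \<open>f\<close> alone.
\<close>

lemma f_indep_iff:
  assumes da: "\<And>p k. p \<in> M \<Longrightarrow> k \<noteq> Inr 1 \<Longrightarrow> partial k a p = 0"
  shows "KK3 M G J toric_X0 f h a \<longleftrightarrow> depends_only_on M {Inr 1} f"
proof -
  have "partial k (\<lambda>q. a q * (f q)\<^sup>2 * (h q)\<^sup>2) p = 2 * a p * (h p)\<^sup>2 * f p * partial k f p"
    if p: "p \<in> M" and k: "k \<noteq> Inr 1" for p k
    using smooth_on_differentiable[OF a(1) p] smooth_on_differentiable[OF f(1) p] smooth_on_differentiable[OF h(1) p]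
      da[OF p k] h_indep[OF p k]
    by (simp add: partial_mult partial_power2)
  then have "partial k (\<lambda>q. a q * (f q)\<^sup>2 * (h q)\<^sup>2) p = 0 \<longleftrightarrow> partial k f p = 0"
    if p: "p \<in> M" and k: "k \<noteq> Inr 1" for p k
    using that a(2) f(3) h(3) by simp
  then show ?thesis
    unfolding KK3_iff by (auto simp: depends_only_on_def independent_of_def)
qed

section \<open>The characterization\<close>

lemma conditions_iff:
  "(closed_2form M F
      \<and> flow_invariant M (const_field_flow (- axis (Inl 1) 1)) F
      \<and> (\<forall>p\<in>M. differential a p = - contract (toric_X0 p) (F p))
      \<and> KK1 M G J toric_X0 F \<and> KK2 M G J toric_X0 f a F \<and> KK3 M G J toric_X0 f h a
      \<and> KK4 M G J toric_X0 h a F \<and> KK5 M G J toric_X0 f h a F)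
   \<longleftrightarrow>
   (depends_only_on M {Inr 1} f
      \<and> (\<exists>k\<^sub>0. k\<^sub>0 \<noteq> 0 \<and> (\<forall>p\<in>M. a p = k\<^sub>0 / (h p)\<^sup>2))
      \<and> (\<exists>l. smooth_on M l \<and> independent_of M (Inl 1) l \<and> F_form l \<and> first_relation l
          \<and> (\<forall>p\<in>M. \<rho> p * partial (Inr 2) l p - partial (Inr 1) l p
               = (1 / (((f p)\<^sup>2 - 1) * a p)) * (l p + \<kappa> p * (f p)\<^sup>2) * (l p - \<kappa> p))))"
  (is "?lhs \<longleftrightarrow> ?rhs")
proof
  assume L: ?lhs
  define l where "l p = F p $ Inr 2 $ Inl 2" for p
  have l: "F_form l" "smooth_on M l"
    using L KK4_iff unfolding l_def by (simp_all add: smooth_on_vec_nth openM F)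
  have "\<forall>k. F p $ Inl 1 $ k = (if k = Inr 1 then - \<kappa> p else 0)" if "p \<in> M" for p
    using l(1) that by (simp add: F_form_def all_coords kform_nth)
  then have da: "\<forall>p\<in>M. \<forall>k. partial k a p = (if k = Inr 1 then - \<kappa> p else 0)"
    using L da_iff by simp
  then have da0: "partial k a p = 0" if "p \<in> M" "k \<noteq> Inr 1" for p k
    using that by simp
  have f': "depends_only_on M {Inr 1} f"
    using L f_indep_iff[OF da0] by simp
  have R: "first_relation l"
    using L KK5_iff[OF _ l(1)] f' by (simp add: depends_only_on_def independent_of_def)
  have "\<forall>p\<in>M. partial (Inl 1) l p = 0 \<and>
    partial (Inr 1) l p = partial (Inr 2) \<rho> p * (l p - \<kappa> p) + \<rho> p * partial (Inr 2) l p"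
    using L closed_iff[OF l \<kappa>_indep[OF da0]] by simp
  then have "independent_of M (Inl 1) l" "\<forall>p\<in>M. \<rho> p * partial (Inr 2) l p - partial (Inr 1) l p
               = (1 / (((f p)\<^sup>2 - 1) * a p)) * (l p + \<kappa> p * (f p)\<^sup>2) * (l p - \<kappa> p)"
    using R by (simp_all add: independent_of_def first_relation_def)
  then show ?rhs
    using f' da[folded a_eq_iff] l R by blast
next
  assume R: ?rhs
  then obtain l where l: "smooth_on M l" "independent_of M (Inl 1) l" "F_form l" "first_relation l"
    and second: "\<forall>p\<in>M. \<rho> p * partial (Inr 2) l p - partial (Inr 1) l p
               = (1 / (((f p)\<^sup>2 - 1) * a p)) * (l p + \<kappa> p * (f p)\<^sup>2) * (l p - \<kappa> p)"
    by blast
  have da: "\<forall>p\<in>M. \<forall>k. partial k a p = (if k = Inr 1 then - \<kappa> p else 0)"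
    using R a_eq_iff by blast
  then have da0: "partial k a p = 0" if "p \<in> M" "k \<noteq> Inr 1" for p k
    using that by simp
  have "\<forall>k. F p $ Inl 1 $ k = (if k = Inr 1 then - \<kappa> p else 0)" if "p \<in> M" for p
    using l(3) that by (simp add: F_form_def all_coords kform_nth)
  then have "\<forall>p\<in>M. differential a p = - contract (toric_X0 p) (F p)"
    using da da_iff by simp
  moreover have f': "partial k f p = 0" if "p \<in> M" "k \<noteq> Inr 1" for p k
    using R that by (simp add: depends_only_on_def independent_of_def)
  moreover have "\<forall>p\<in>M. partial (Inl 1) l p = 0 \<and>
      partial (Inr 1) l p = partial (Inr 2) \<rho> p * (l p - \<kappa> p) + \<rho> p * partial (Inr 2) l p"
  proof (intro ballI conjI)
    fix p assume p: "p \<in> M"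
    show "partial (Inl 1) l p = 0" using l(2) p by (simp add: independent_of_def)
    have "partial (Inr 2) \<rho> p * (l p - \<kappa> p) = - ((1 / (((f p)\<^sup>2 - 1) * a p)) * (l p + \<kappa> p * (f p)\<^sup>2) * (l p - \<kappa> p))"
      using l(4) p by (simp add: first_relation_def)
    then show "partial (Inr 1) l p = partial (Inr 2) \<rho> p * (l p - \<kappa> p) + \<rho> p * partial (Inr 2) l p"
      using second p by force
  qed
  then have "closed_2form M F"
    using closed_iff[OF l(3,1) \<kappa>_indep[OF da0]] by simp
  moreover have "flow_invariant M (const_field_flow (- axis (Inl 1) 1)) F"
  proof (rule flow_invariant_if_indep)
    fix p j k assume p: "p \<in> M"
    have "partial (Inl 1) l p = 0" using l(2) p by (simp add: independent_of_def)
    moreover have "\<forall>j k. kform 0 0 0 $ j $ k = 0" by (simp add: all_coords kform_nth)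
    ultimately show "partial (Inl 1) (\<lambda>q. F q $ j $ k) p = 0"
      by (simp add: partial_F[OF l(3,1) p] \<kappa>_indep[OF da0 p] \<rho>_indep_t[OF p])
  qed
  moreover have "KK3 M G J toric_X0 f h a"
    using R f_indep_iff[OF da0] by simp
  moreover have "KK4 M G J toric_X0 h a F"
    unfolding KK4_iff F_form_def
  proof
    fix p assume "p \<in> M"
    with l(3) have F: "F p = kform (\<kappa> p) (\<rho> p * (l p - \<kappa> p)) (l p)" by (simp add: F_form_def)
    then have "F p $ Inr 2 $ Inl 2 = l p" by (simp add: kform_nth)
    with F show "F p = kform (\<kappa> p) (\<rho> p * (F p $ Inr 2 $ Inl 2 - \<kappa> p)) (F p $ Inr 2 $ Inl 2)" by simp
  qed
  ultimately show ?lhs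
    using KK1_holds[OF l(3)] KK2_holds[OF f' l(3,4)] KK5_iff[OF f' l(3)] l(4) by blast
qed

end

theorem proposition47:
  fixes M :: "(real ^ ix) set"
    and \<tau> f h a :: "real ^ ix \<Rightarrow> real"
    and C :: "real ^ 2 ^ 2"
    and F :: "real ^ ix \<Rightarrow> real ^ ix ^ ix"
  assumes M: "open M" "connected M"
    and \<tau>: "smooth_on M \<tau>" "depends_only_on M {Inr 1, Inr 2} \<tau>"
           "\<And>p. p \<in> M \<Longrightarrow> positive_definite (hess \<tau> p)"
    and C: "skew_matrix C" "C $ 1 $ 2 \<noteq> 0"
    and f: "smooth_on M f" "independent_of M (Inl 1) f"
           "\<And>p. p \<in> M \<Longrightarrow> f p \<noteq> 0" "\<And>p. p \<in> M \<Longrightarrow> (f p)\<^sup>2 - 1 \<noteq> 0"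
    and h: "smooth_on M h" "depends_only_on M {Inr 1} h" "\<And>p. p \<in> M \<Longrightarrow> h p \<noteq> 0"
    and F: "smooth_on M F" "\<And>p. p \<in> M \<Longrightarrow> skew_matrix (F p)"
    and a: "smooth_on M a" "\<And>p. p \<in> M \<Longrightarrow> a p \<noteq> 0"
  shows
    "(closed_2form M F
      \<and> flow_invariant M (const_field_flow (- axis (Inl 1) 1)) F
      \<and> (\<forall>p\<in>M. differential a p = - contract (toric_X0 p) (F p))
      \<and> KK1 M (toric_G \<tau> C) (toric_J \<tau> C) toric_X0 F
      \<and> KK2 M (toric_G \<tau> C) (toric_J \<tau> C) toric_X0 f a F
      \<and> KK3 M (toric_G \<tau> C) (toric_J \<tau> C) toric_X0 f h a
      \<and> KK4 M (toric_G \<tau> C) (toric_J \<tau> C) toric_X0 h a F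
      \<and> KK5 M (toric_G \<tau> C) (toric_J \<tau> C) toric_X0 f h a F)
     \<longleftrightarrow>
     (depends_only_on M {Inr 1} f
      \<and> (\<exists>k0. k0 \<noteq> 0 \<and> (\<forall>p\<in>M. a p = k0 / (h p)\<^sup>2))
      \<and> (\<exists>lam. smooth_on M lam \<and> independent_of M (Inl 1) lam
          \<and> (\<forall>p\<in>M. let c = 2 * a p * partial (Inr 1) h p / h p in
               F p = c *\<^sub>R wedge (d\<mu> 1) (dt 1)
                     + wedge ((\<Psi>_ratio \<tau> C p * (lam p - c)) *\<^sub>R d\<mu> 1 + lam p *\<^sub>R d\<mu> 2) (dt 2))
          \<and> (\<forall>p\<in>M. partial (Inr 2) (\<Psi>_ratio \<tau> C) p
               = - (1 / (((f p)\<^sup>2 - 1) * a p))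
                 * (lam p + 2 * a p * partial (Inr 1) h p * (f p)\<^sup>2 / h p))
          \<and> (\<forall>p\<in>M. \<Psi>_ratio \<tau> C p * partial (Inr 2) lam p - partial (Inr 1) lam p
               = (1 / (((f p)\<^sup>2 - 1) * a p))
                 * (lam p + 2 * a p * partial (Inr 1) h p * (f p)\<^sup>2 / h p)
                 * (lam p - 2 * a p * partial (Inr 1) h p / h p))))"
proof -
  interpret kk_data M \<tau> C f h a F
    by unfold_locales (use assms in blast)+
  have form: "(\<forall>p\<in>M. let c = 2 * a p * partial (Inr 1) h p / h p in
               F p = c *\<^sub>R wedge (d\<mu> 1) (dt 1)
                     + wedge ((\<Psi>_ratio \<tau> C p * (l p - c)) *\<^sub>R d\<mu> 1 + l p *\<^sub>R d\<mu> 2) (dt 2)) \<longleftrightarrow> F_form l" for l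
    by (simp add: F_form_def kform_def \<kappa>_def Let_def)
  have first: "(\<forall>p\<in>M. partial (Inr 2) (\<Psi>_ratio \<tau> C) p
               = - (1 / (((f p)\<^sup>2 - 1) * a p))
                 * (l p + 2 * a p * partial (Inr 1) h p * (f p)\<^sup>2 / h p)) \<longleftrightarrow> first_relation l" for l
    by (simp add: first_relation_def \<kappa>_def)
  have second: "(1 / (((f p)\<^sup>2 - 1) * a p))
                 * (l p + 2 * a p * partial (Inr 1) h p * (f p)\<^sup>2 / h p)
                 * (l p - 2 * a p * partial (Inr 1) h p / h p)
      = (1 / (((f p)\<^sup>2 - 1) * a p)) * (l p + \<kappa> p * (f p)\<^sup>2) * (l p - \<kappa> p)" for l p
    by (simp add: \<kappa>_def)
  show ?thesis
    unfolding form first second by (rule conditions_iff)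
qed

end
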